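(* Let $\theta_0\in L^2(0,1)$ and $T>0$. Pick any $\tau\in(0,T)$ and $s\in(1,2)$. Then there exists a function $y$, Gevrey of order $s$ on $[\tau,T]$, such that the control $$u(t):=\begin{cases}0 & \text{if } 0\le t\le\tau,\\ \displaystyle\sum_{i\ge1}\frac{y^{(i)}(t)}{(2i-1)!} & \text{if } \tau<t\le T,\end{cases}$$ steers the heat equation with boundary control $$\theta_t-\theta_{xx}=0 \ \text{ on } (0,T)\times(0,1),\qquad \theta_x(t,0)=0,\quad \theta_x(t,1)=u(t)\ \text{ for } t\in(0,T),$$ from the initial state $\theta_0$ at time $0$ to the final state $0$ at time $T$. Moreover, $u$ is Gevrey of order $s$ on $[0,T]$; the map $t\mapsto\theta(t,\cdot)$ is in $C\bigl([0,T],L^2(0,1)\bigr)$; and $\theta$ is Gevrey of order $s$ in $t$ and $s/2$ in $x$ on $[\varepsilon,T]\times[0,1]$ for all $\varepsilon\in(0,T)$. Here $\theta$ denotes the solution of the heat equation $\theta_t-\theta_{xx}=0$ on $(0,T)\times(0,1)$ with boundary conditions $\theta_x(t,0)=0$, $\theta_x(t,1)=u(t)$ for $t\in(0,T)$, and with $\theta(0,\cdot)=\theta_0$.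
   Context: Gevrey functions: a function $y\in C^\infty([a,b])$ is Gevrey of order $\sigma\ge0$ on $[a,b]$ if there exist constants $M,R>0$ such that $|y^{(p)}(t)|\le M\,\frac{(p!)^{\sigma}}{R^p}$ for all $t\in[a,b]$ and all integers $p\ge0$. If $K\subset\mathbb{R}^2$ is a compact set and $\theta$ is of class $C^\infty$ on $K$ (i.e. the restriction to $K$ of a $C^\infty$ function on an open neighbourhood of $K$), $\theta$ is Gevrey of order $s_1$ in $t$ and $s_2$ in $x$ on $K$ if there exist constants $M,R_1,R_2>0$ such that $|\partial_t^{m}\partial_x^{n}\theta(t,x)|\le M\frac{(m!)^{s_1}(n!)^{s_2}}{R_1^{m}R_2^{n}}$ for all $(t,x)\in K$ and all integers $m,n\ge0$. A control $u$ steers the system from the state $\theta_0$ at time $0$ to the state $0$ at time $T$ if the solution $\theta$ of the system with control $u$ and initial condition $\theta(0,x)=\theta_0(x)$, $x\in(0,1)$, satisfies $\theta(T,x)=0$ for $x\in(0,1)$. *)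

theory Defs
  imports "HOL-Analysis.Analysis"
begin

section \<open>Gevrey functions of one variable\<close>

text \<open>Derivatives are taken within \<open>S\<close>, hence one-sided at the end points of an interval.\<close>

definition derivs_within :: "real set \<Rightarrow> nat \<Rightarrow> (real \<Rightarrow> real) \<Rightarrow> real \<Rightarrow> real" where
  "derivs_within S p f = ((\<lambda>g t. vector_derivative g (at t within S)) ^^ p) f"

definition C_infinity_Icc :: "real \<Rightarrow> real \<Rightarrow> (real \<Rightarrow> real) \<Rightarrow> bool" where
  "C_infinity_Icc a b f \<longleftrightarrow> (\<forall>p. derivs_within {a..b} p f differentiable_on {a..b})"

definition gevrey :: "real \<Rightarrow> real \<Rightarrow> real \<Rightarrow> (real \<Rightarrow> real) \<Rightarrow> bool" where
  "gevrey \<sigma> a b y \<longleftrightarrow> C_infinity_Icc a b y \<and>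
     (\<exists>M R. M > 0 \<and> R > 0 \<and>
        (\<forall>t\<in>{a..b}. \<forall>p. \<bar>derivs_within {a..b} p y t\<bar> \<le> M * (fact p powr \<sigma> / R ^ p)))"

section \<open>Gevrey functions of two variables\<close>

definition partial_t :: "(real \<times> real \<Rightarrow> real) \<Rightarrow> real \<times> real \<Rightarrow> real" where
  "partial_t f = (\<lambda>(t, x). deriv (\<lambda>r. f (r, x)) t)"

definition partial_x :: "(real \<times> real \<Rightarrow> real) \<Rightarrow> real \<times> real \<Rightarrow> real" where
  "partial_x f = (\<lambda>(t, x). deriv (\<lambda>z. f (t, z)) x)"

primrec C_k_on :: "nat \<Rightarrow> (real \<times> real) set \<Rightarrow> (real \<times> real \<Rightarrow> real) \<Rightarrow> bool" where
  "C_k_on 0 U f \<longleftrightarrow> continuous_on U f"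
| "C_k_on (Suc k) U f \<longleftrightarrow>
     f differentiable_on U \<and> C_k_on k U (partial_t f) \<and> C_k_on k U (partial_x f)"

text \<open>
  On \<open>K\<close> the function is the restriction of a smooth \<open>g\<close> defined near \<open>K\<close>, and its derivatives
  on \<open>K\<close> are those of \<open>g\<close>. If \<open>K\<close> is the closure of its interior (such as a nondegenerate
  rectangle), these do not depend on the choice of \<open>g\<close>.
\<close>

definition gevrey2 ::
  "real \<Rightarrow> real \<Rightarrow> (real \<times> real) set \<Rightarrow> (real \<times> real \<Rightarrow> real) \<Rightarrow> bool" where
  "gevrey2 s1 s2 K \<theta> \<longleftrightarrow>
     (\<exists>U g. open U \<and> K \<subseteq> U \<and> (\<forall>k. C_k_on k U g) \<and> (\<forall>p\<in>K. g p = \<theta> p) \<and>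
        (\<exists>M R1 R2. M > 0 \<and> R1 > 0 \<and> R2 > 0 \<and>
           (\<forall>p\<in>K. \<forall>m n. \<bar>(partial_t ^^ m) ((partial_x ^^ n) g) p\<bar>
              \<le> M * (fact m powr s1 * fact n powr s2 / (R1 ^ m * R2 ^ n)))))"

section \<open>The space $L^2(0,1)$\<close>

definition L2_01 :: "(real \<Rightarrow> real) \<Rightarrow> bool" where
  "L2_01 f \<longleftrightarrow> f \<in> borel_measurable (lebesgue_on {0<..<1}) \<and>
     integrable (lebesgue_on {0<..<1}) (\<lambda>x. (f x)\<^sup>2)"

definition L2_norm_01 :: "(real \<Rightarrow> real) \<Rightarrow> real" where
  "L2_norm_01 f = sqrt (LINT x|lebesgue_on {0<..<1}. (f x)\<^sup>2)"

text \<open>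
  Continuity at the time \<open>t\<close>, relative to the set of times \<open>I\<close>, of the map sending \<open>r\<close> to
  \<open>\<lambda>x. \<theta> (r, x)\<close> with values in $L^2(0,1)$. The Bochner integral of a nonintegrable
  function is 0, so membership in $L^2$ is required explicitly, also for the times near \<open>t\<close>.
\<close>

definition L2_continuous_at :: "real set \<Rightarrow> (real \<times> real \<Rightarrow> real) \<Rightarrow> real \<Rightarrow> bool" where
  "L2_continuous_at I \<theta> t \<longleftrightarrow>
     L2_01 (\<lambda>x. \<theta> (t, x)) \<and>
     (\<forall>\<^sub>F r in at t within I. L2_01 (\<lambda>x. \<theta> (r, x))) \<and>
     ((\<lambda>r. L2_norm_01 (\<lambda>x. \<theta> (r, x) - \<theta> (t, x))) \<longlongrightarrow> 0) (at t within I)"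

section \<open>The boundary control problem\<close>

text \<open>
  Solutions are classical for \<open>0 < t < T\<close>: of class $C^{1,2}$ on $(0,T)\times(0,1)$, with \<open>\<theta>\<close>
  and \<open>\<theta>\<^sub>x\<close> continuous up to \<open>x = 0\<close> and \<open>x = 1\<close>, so that the boundary conditions make sense
  pointwise. The initial datum is only square integrable, so it is attained in $L^2(0,1)$;
  likewise the state at time \<open>T\<close> is the $L^2$ limit of the states at earlier times.
\<close>

definition heat_solution ::
  "real \<Rightarrow> (real \<Rightarrow> real) \<Rightarrow> (real \<Rightarrow> real) \<Rightarrow> (real \<times> real \<Rightarrow> real) \<Rightarrow> bool" where
  "heat_solution T u \<theta>0 \<theta> \<longleftrightarrow>
     (\<exists>\<theta>t \<theta>x \<theta>xx.
        continuous_on ({0<..<T} \<times> {0..1}) \<theta> \<and>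
        continuous_on ({0<..<T} \<times> {0..1}) \<theta>x \<and>
        continuous_on ({0<..<T} \<times> {0<..<1}) \<theta>t \<and>
        continuous_on ({0<..<T} \<times> {0<..<1}) \<theta>xx \<and>
        (\<forall>t\<in>{0<..<T}.
           (\<forall>x\<in>{0..1}. ((\<lambda>z. \<theta> (t, z)) has_real_derivative \<theta>x (t, x)) (at x within {0..1})) \<and>
           (\<forall>x\<in>{0<..<1}.
              ((\<lambda>r. \<theta> (r, x)) has_real_derivative \<theta>t (t, x)) (at t) \<and>
              ((\<lambda>z. \<theta>x (t, z)) has_real_derivative \<theta>xx (t, x)) (at x) \<and>
              \<theta>t (t, x) - \<theta>xx (t, x) = 0) \<and>
           \<theta>x (t, 0) = 0 \<and> \<theta>x (t, 1) = u t)) \<and>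
     (AE x in lebesgue_on {0<..<1}. \<theta> (0, x) = \<theta>0 x) \<and>
     L2_continuous_at {0..T} \<theta> 0 \<and> L2_continuous_at {0..T} \<theta> T"

text \<open>Uniqueness is equality in $L^2(0,1)$ at every time.\<close>

definition unique_heat_solution ::
  "real \<Rightarrow> (real \<Rightarrow> real) \<Rightarrow> (real \<Rightarrow> real) \<Rightarrow> (real \<times> real \<Rightarrow> real) \<Rightarrow> bool" where
  "unique_heat_solution T u \<theta>0 \<theta> \<longleftrightarrow>
     heat_solution T u \<theta>0 \<theta> \<and>
     (\<forall>\<theta>'. heat_solution T u \<theta>0 \<theta>' \<longrightarrow>
        (\<forall>t\<in>{0..T}. AE x in lebesgue_on {0<..<1}. \<theta>' (t, x) = \<theta> (t, x)))"

text \<open>The series over \<open>i \<ge> 1\<close> is written with \<open>Suc i\<close> in place of \<open>i\<close>, where \<open>2 * Suc i - 1 = 2 * i + 1\<close>.\<close>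

definition flat_term :: "real \<Rightarrow> real \<Rightarrow> (real \<Rightarrow> real) \<Rightarrow> real \<Rightarrow> nat \<Rightarrow> real" where
  "flat_term \<tau> T y t i = derivs_within {\<tau>..T} (Suc i) y t / fact (2 * i + 1)"

definition flat_control :: "real \<Rightarrow> real \<Rightarrow> (real \<Rightarrow> real) \<Rightarrow> real \<Rightarrow> real" where
  "flat_control \<tau> T y t = (if t \<le> \<tau> then 0 else (\<Sum>i. flat_term \<tau> T y t i))"

end

theory Submission
  imports Defs "HOL-Complex_Analysis.Cauchy_Integral_Formula"
begin

text \<open>
  The heat equation on \<open>[0,1]\<close> with \<open>\<theta>\<^sub>x(t,0) = 0\<close> is \<^emph>\<open>flat\<close>: a solution is determined by its
  trace \<open>y(t) = \<theta>(t,0)\<close>, through the series \<open>\<theta>(t,x) = \<Sum>\<^sub>i y\<^sup>(\<^sup>i\<^sup>)(t) x\<^sup>2\<^sup>i / (2i)!\<close>, and its flux at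
  \<open>x = 1\<close> is \<open>\<Sum>\<^sub>i y\<^sup>(\<^sup>i\<^sup>)(t) / (2i-1)!\<close>. Conversely, if \<open>y\<close> is Gevrey of order \<open>s < 2\<close>, the factor
  \<open>(2i)!\<close> beats \<open>(i!)\<^sup>s\<close>, so that the series converges together with all its derivatives, solves the
  heat equation, and is Gevrey of order \<open>s\<close> in \<open>t\<close> and \<open>s/2\<close> in \<open>x\<close> (\<open>heat_series_bound\<close>). A single
  function \<open>y\<close> therefore produces control and solution at once, and it only remains to choose it.

  The free evolution of \<open>\<theta>0\<close> under homogeneous Neumann conditions is the cosine series with the
  \<open>n\<close>-th mode damped by \<open>exp (- n\<^sup>2 \<pi>\<^sup>2 t)\<close>. Its trace \<open>y\<^sub>0\<close> at \<open>x = 0\<close> is Gevrey of order 1 on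
  every \<open>[\<epsilon>,\<infinity>)\<close>, and the series of derivatives of \<open>y\<^sub>0\<close> sums back to the free evolution
  (\<open>neumann_semigroup_power_series\<close>). Take \<open>y = \<Phi> y\<^sub>0\<close>, where \<open>\<Phi>\<close> is a step function, Gevrey of order
  \<open>s > 1\<close>, which is 1 until some time after \<open>\<tau>\<close> and 0 from some time before \<open>T\<close>
  (\<open>gevrey_step\<close>). The solution is then the free one until after \<open>\<tau>\<close>, so its flux at \<open>x = 1\<close> is
  zero there because the free evolution is even about \<open>x = 1\<close>; and it is zero near \<open>T\<close>. Because the
  flux already vanishes beyond \<open>\<tau>\<close>, switching the control on at \<open>\<tau>\<close> does not spoil its smoothness.

  Two facts about \<open>L\<^sup>2(0,1)\<close> complete the argument. The initial datum is attained because the free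
  evolution is a contraction of \<open>L\<^sup>2\<close> and cosine polynomials, for which the claim is evident, are
  dense (\<open>neumann_initial\<close>). Uniqueness follows from the decay of \<open>\<integral> w\<^sup>2\<close> for the difference
  \<open>w\<close> of two solutions (\<open>heat_solution_unique\<close>).
\<close>

section \<open>Gevrey bounds for sequences of derivatives\<close>

text \<open>
  A function is carried along with all its derivatives. For the series and products below these
  are given by explicit formulas, and smoothness amounts to checking one derivative at each level.
\<close>

definition derivative_tower :: "real set \<Rightarrow> (nat \<Rightarrow> real \<Rightarrow> real) \<Rightarrow> bool" where
  "derivative_tower S D \<longleftrightarrow> (\<forall>p. \<forall>t\<in>S. (D p has_real_derivative D (Suc p) t) (at t))"

definition gevrey_bounded :: "real \<Rightarrow> real set \<Rightarrow> (nat \<Rightarrow> real \<Rightarrow> real) \<Rightarrow> bool" where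
  "gevrey_bounded \<sigma> S D \<longleftrightarrow>
     (\<exists>M R. M > 0 \<and> R > 0 \<and> (\<forall>t\<in>S. \<forall>p. \<bar>D p t\<bar> \<le> M * (fact p powr \<sigma> / R ^ p)))"

text \<open>
  One-sided derivatives at the end points agree with those of any smooth extension, because the
  interval is nondegenerate. Hence iterated derivatives within \<open>{a..b}\<close> can be read off a tower.
\<close>

lemma derivs_within_eq_tower:
  assumes "a < b" and D: "derivative_tower S D" and sub: "{a..b} \<subseteq> S"
    and f: "\<And>t. t \<in> {a..b} \<Longrightarrow> f t = D 0 t" and "t \<in> {a..b}"
  shows "derivs_within {a..b} p f t = D p t"
  using \<open>t \<in> {a..b}\<close>
proof (induction p arbitrary: t)
  case 0
  then show ?case by (simp add: derivs_within_def f)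
next
  case (Suc p)
  have "(D p has_vector_derivative D (Suc p) t) (at t within {a..b})"
    using D sub Suc.prems unfolding derivative_tower_def has_real_derivative_iff_has_vector_derivative
    by (blast intro: has_vector_derivative_at_within)
  then have "(derivs_within {a..b} p f has_vector_derivative D (Suc p) t) (at t within {a..b})"
    by (rule has_vector_derivative_transform[OF Suc.prems, rotated]) (simp add: Suc.IH)
  then have "vector_derivative (derivs_within {a..b} p f) (at t within {a..b}) = D (Suc p) t"
    using Suc.prems \<open>a < b\<close> by (intro vector_derivative_within_closed_interval) auto
  then show ?case by (simp add: derivs_within_def)
qed

lemma gevrey_of_tower:
  assumes "a < b" and D: "derivative_tower S D" and sub: "{a..b} \<subseteq> S"
    and f: "\<And>t. t \<in> {a..b} \<Longrightarrow> f t = D 0 t" and bd: "gevrey_bounded \<sigma> {a..b} D"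
  shows "gevrey \<sigma> a b f"
proof -
  note eq = derivs_within_eq_tower[OF assms(1-4)]
  have "derivs_within {a..b} p f differentiable_on {a..b}" for p
    unfolding differentiable_on_def
  proof
    fix t assume t: "t \<in> {a..b}"
    have "D p differentiable at t within {a..b}"
      using D sub t unfolding derivative_tower_def
      by (meson differentiable_at_withinI real_differentiable_def subset_iff)
    then show "derivs_within {a..b} p f differentiable at t within {a..b}"
      by (rule differentiable_transform_within[where d=1]) (use t eq in auto)
  qed
  with bd eq show ?thesis
    unfolding gevrey_def C_infinity_Icc_def gevrey_bounded_def by auto
qed

lemma gevrey_bounded_mono_order:
  assumes "gevrey_bounded \<sigma> S D" and "\<sigma> \<le> \<sigma>'"
  shows "gevrey_bounded \<sigma>' S D"
proof -
  obtain M R where "M > 0" "R > 0" and b: "\<And>t p. t \<in> S \<Longrightarrow> \<bar>D p t\<bar> \<le> M * (fact p powr \<sigma> / R ^ p)"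
    using assms(1) unfolding gevrey_bounded_def by auto
  have "fact p powr \<sigma> \<le> (fact p :: real) powr \<sigma>'" for p
    using assms(2) by (intro powr_mono) (auto simp: fact_ge_1)
  then have "\<bar>D p t\<bar> \<le> M * (fact p powr \<sigma>' / R ^ p)" if "t \<in> S" for t p
    using b[OF that, of p] \<open>M > 0\<close> \<open>R > 0\<close>
    by (elim order_trans) (intro mult_left_mono divide_right_mono, auto)
  with \<open>M > 0\<close> \<open>R > 0\<close> show ?thesis unfolding gevrey_bounded_def by blast
qed

lemma gevrey_bounded_subset:
  "gevrey_bounded \<sigma> S D \<Longrightarrow> S' \<subseteq> S \<Longrightarrow> gevrey_bounded \<sigma> S' D"
  unfolding gevrey_bounded_def by (meson subset_iff)

definition leibniz_product :: "(nat \<Rightarrow> real \<Rightarrow> real) \<Rightarrow> (nat \<Rightarrow> real \<Rightarrow> real) \<Rightarrow> nat \<Rightarrow> real \<Rightarrow> real"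
  where "leibniz_product D E p t = (\<Sum>i\<le>p. real (p choose i) * (D i t * E (p - i) t))"

lemma sum_binomial_Suc:
  fixes f :: "nat \<Rightarrow> nat \<Rightarrow> real"
  shows "(\<Sum>i\<le>Suc p. real (Suc p choose i) * f i (Suc p - i)) =
         (\<Sum>i\<le>p. real (p choose i) * (f (Suc i) (p - i) + f i (Suc (p - i))))"
proof -
  have "(\<Sum>i\<le>p. real (p choose i) * f i (Suc (p - i))) = (\<Sum>i\<le>Suc p. real (p choose i) * f i (Suc p - i))"
    by (simp add: Suc_diff_le)
  also have "\<dots> = f 0 (Suc p) + (\<Sum>i\<le>p. real (p choose Suc i) * f (Suc i) (p - i))"
    by (subst sum.atMost_Suc_shift) simp
  finally have "(\<Sum>i\<le>p. real (p choose i) * f i (Suc (p - i))) = \<dots>" .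
  then show ?thesis
    by (subst sum.atMost_Suc_shift) (simp add: algebra_simps sum.distrib)
qed

lemma derivative_tower_product:
  assumes "derivative_tower S D" and "derivative_tower S E"
  shows "derivative_tower S (leibniz_product D E)"
  unfolding derivative_tower_def
proof (intro allI ballI)
  fix p t assume t: "t \<in> S"
  have d: "(D i has_real_derivative D (Suc i) t) (at t)" "(E i has_real_derivative E (Suc i) t) (at t)" for i
    using assms t unfolding derivative_tower_def by auto
  have "(leibniz_product D E p has_real_derivative
      (\<Sum>i\<le>p. real (p choose i) * (D (Suc i) t * E (p - i) t + D i t * E (Suc (p - i)) t))) (at t)"
    unfolding leibniz_product_def by (auto intro!: derivative_eq_intros d simp: algebra_simps)
  also have "(\<Sum>i\<le>p. real (p choose i) * (D (Suc i) t * E (p - i) t + D i t * E (Suc (p - i)) t))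
     = leibniz_product D E (Suc p) t"
    unfolding leibniz_product_def by (rule sum_binomial_Suc[symmetric])
  finally show "(leibniz_product D E p has_real_derivative leibniz_product D E (Suc p) t) (at t)" .
qed

text \<open>
  In Leibniz' formula \<open>i!\<^sup>\<sigma> (p-i)!\<^sup>\<sigma>\<close> times a binomial coefficient is at most \<open>p!\<^sup>\<sigma>\<close>, and the
  number \<open>p + 1\<close> of summands is absorbed by halving the radius.
\<close>

lemma gevrey_bounded_product:
  assumes "gevrey_bounded \<sigma> S D" and "gevrey_bounded \<sigma> S E" and "1 \<le> \<sigma>"
  shows "gevrey_bounded \<sigma> S (leibniz_product D E)"
proof -
  obtain M1 R1 where M1: "M1 > 0" "R1 > 0"
    and b1: "\<And>t p. t \<in> S \<Longrightarrow> \<bar>D p t\<bar> \<le> M1 * (fact p powr \<sigma> / R1 ^ p)"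
    using assms(1) unfolding gevrey_bounded_def by auto
  obtain M2 R2 where M2: "M2 > 0" "R2 > 0"
    and b2: "\<And>t p. t \<in> S \<Longrightarrow> \<bar>E p t\<bar> \<le> M2 * (fact p powr \<sigma> / R2 ^ p)"
    using assms(2) unfolding gevrey_bounded_def by auto
  define R where "R = min R1 R2"
  have R: "R > 0" "R \<le> R1" "R \<le> R2" using M1 M2 by (auto simp: R_def)
  have "\<bar>leibniz_product D E p t\<bar> \<le> M1 * M2 * (fact p powr \<sigma> / (R / 2) ^ p)" if t: "t \<in> S" for t p
  proof -
    have summand: "\<bar>real (p choose i) * (D i t * E (p - i) t)\<bar> \<le> M1 * M2 * (fact p powr \<sigma> / R ^ p)"
      if "i \<le> p" for i
    proof -
      have "\<bar>D i t\<bar> \<le> M1 * (fact i powr \<sigma> / R ^ i)"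
        using b1[OF t, of i] M1 R by (elim order_trans) (auto intro!: mult_left_mono divide_left_mono power_mono)
      moreover have "\<bar>E (p - i) t\<bar> \<le> M2 * (fact (p - i) powr \<sigma> / R ^ (p - i))"
        using b2[OF t, of "p - i"] M2 R by (elim order_trans) (auto intro!: mult_left_mono divide_left_mono power_mono)
      ultimately have "\<bar>D i t\<bar> * \<bar>E (p - i) t\<bar> \<le>
          (M1 * (fact i powr \<sigma> / R ^ i)) * (M2 * (fact (p - i) powr \<sigma> / R ^ (p - i)))"
        using M1 R by (intro mult_mono) auto
      also have "\<dots> = M1 * M2 * ((fact i * fact (p - i)) powr \<sigma> / R ^ p)"
        using that by (simp add: powr_mult power_add[symmetric])
      finally have *: "\<bar>D i t\<bar> * \<bar>E (p - i) t\<bar> \<le> \<dots>" .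
      \<comment> \<open>since \<open>\<sigma> \<ge> 1\<close>, the binomial coefficient may be moved under the power\<close>
      have "real (p choose i) \<le> real (p choose i) powr \<sigma>"
        using powr_mono[of 1 \<sigma> "real (p choose i)"] assms(3) that by (simp add: Suc_le_eq)
      with * have "real (p choose i) * (\<bar>D i t\<bar> * \<bar>E (p - i) t\<bar>) \<le>
          real (p choose i) powr \<sigma> * (M1 * M2 * ((fact i * fact (p - i)) powr \<sigma> / R ^ p))"
        by - (rule mult_mono, auto)
      also have "\<dots> = M1 * M2 * ((fact i * fact (p - i) * real (p choose i)) powr \<sigma> / R ^ p)"
        by (simp add: powr_mult)
      also have "fact i * fact (p - i) * real (p choose i) = fact p"
        by (metis (mono_tags, opaque_lifting) binomial_fact_lemma[OF that] of_nat_fact of_nat_mult)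
      finally show ?thesis by (simp add: abs_mult)
    qed
    have "\<bar>leibniz_product D E p t\<bar> \<le> (\<Sum>i\<le>p. \<bar>real (p choose i) * (D i t * E (p - i) t)\<bar>)"
      unfolding leibniz_product_def by (rule sum_abs)
    also have "\<dots> \<le> (\<Sum>i\<le>p. M1 * M2 * (fact p powr \<sigma> / R ^ p))"
      by (intro sum_mono summand) auto
    also have "\<dots> = real (Suc p) * (M1 * M2 * (fact p powr \<sigma> / R ^ p))" by simp
    also have "\<dots> \<le> 2 ^ p * (M1 * M2 * (fact p powr \<sigma> / R ^ p))"
    proof (rule mult_right_mono)
      have "Suc p \<le> 2 ^ p" by (simp add: Suc_le_eq)
      then show "real (Suc p) \<le> 2 ^ p" by (metis of_nat_le_iff of_nat_numeral of_nat_power)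
    qed (use M1 M2 R in simp)
    finally show ?thesis by (simp add: power_divide mult_ac)
  qed
  moreover have "M1 * M2 > 0" "R / 2 > 0" using M1 M2 R by auto
  ultimately show ?thesis unfolding gevrey_bounded_def by blast
qed

section \<open>A Gevrey step function\<close>

lemma derivative_tower_affine:
  assumes "derivative_tower UNIV D"
  shows "derivative_tower UNIV (\<lambda>p t. c ^ p * D p (c * t + d))"
  unfolding derivative_tower_def
proof (intro allI ballI)
  fix p and t :: real
  have "(D p has_real_derivative D (Suc p) (c * t + d)) (at (c * t + d))"
    using assms unfolding derivative_tower_def by auto
  then have "((\<lambda>t. D p (c * t + d)) has_real_derivative D (Suc p) (c * t + d) * c) (at t)"
    by (rule DERIV_chain2) (auto intro!: derivative_eq_intros)
  then have "((\<lambda>t. c ^ p * D p (c * t + d)) has_real_derivative c ^ p * (D (Suc p) (c * t + d) * c)) (at t)"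
    by (rule DERIV_cmult)
  then show "((\<lambda>t. c ^ p * D p (c * t + d)) has_real_derivative c ^ Suc p * D (Suc p) (c * t + d)) (at t)"
    by (simp add: mult_ac)
qed

lemma gevrey_bounded_affine:
  assumes "gevrey_bounded \<sigma> UNIV D" and "c \<noteq> 0"
  shows "gevrey_bounded \<sigma> UNIV (\<lambda>p t. c ^ p * D p (c * t + d))"
proof -
  obtain M R where MR: "M > 0" "R > 0" and b: "\<And>t p. \<bar>D p t\<bar> \<le> M * (fact p powr \<sigma> / R ^ p)"
    using assms(1) unfolding gevrey_bounded_def by auto
  have "\<bar>c ^ p * D p (c * t + d)\<bar> \<le> M * (fact p powr \<sigma> / (R / \<bar>c\<bar>) ^ p)" for p t
  proof -
    have "\<bar>c ^ p * D p (c * t + d)\<bar> \<le> \<bar>c\<bar> ^ p * (M * (fact p powr \<sigma> / R ^ p))"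
      unfolding abs_mult power_abs using b by (intro mult_left_mono) auto
    then show ?thesis by (simp add: power_divide mult_ac)
  qed
  with MR assms(2) show ?thesis
    unfolding gevrey_bounded_def by (intro exI[of _ M] exI[of _ "R / \<bar>c\<bar>"]) auto
qed

text \<open>
  Used to switch off all derivatives of the step function, and later of the control, where the
  function itself is locally constant.
\<close>

lemma derivative_tower_const_on_open:
  assumes "derivative_tower S D" and "open U" "U \<subseteq> S" and "\<And>t. t \<in> U \<Longrightarrow> D 0 t = c" and "t \<in> U"
  shows "D (Suc p) t = 0"
proof -
  have z: "D (Suc p) t = 0" if "\<And>t. t \<in> U \<Longrightarrow> D p t = c'" "t \<in> U" for p c' t
  proof -
    have "(D p has_real_derivative 0) (at t)"
      by (rule has_field_derivative_transform_within_open[where f="\<lambda>_. c'" and S=U])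
         (use \<open>open U\<close> that in auto)
    moreover have "(D p has_real_derivative D (Suc p) t) (at t)"
      using assms(1,3) that(2) unfolding derivative_tower_def by blast
    ultimately show ?thesis by (rule DERIV_unique[symmetric])
  qed
  have "\<forall>t\<in>U. D (Suc p) t = 0"
  proof (induction p)
    case 0
    show ?case using z[OF assms(4)] by blast
  next
    case (Suc p)
    then show ?case using z[of "Suc p" 0] by blast
  qed
  with assms(5) show ?thesis by blast
qed

text \<open>
  One term of the exponential series. It turns exponential decay into a factorial, near the flat point
  of the step function and for the damped modes of the heat semigroup alike.
\<close>

lemma power_le_fact_exp:
  fixes x :: real
  assumes "0 \<le> x"
  shows "x ^ n \<le> fact n * exp x"
proof -
  have "(\<Sum>i\<in>{n}. x ^ i /\<^sub>R fact i) \<le> (\<Sum>i. x ^ i /\<^sub>R fact i)"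
    by (rule sum_le_suminf) (use assms summable_exp_generic[of x] in auto)
  then have "x ^ n / fact n \<le> exp x" by (simp add: exp_def divide_inverse_commute)
  then show ?thesis by (simp add: field_simps)
qed

text \<open>
  Since \<open>1 / z\<^sup>k\<close> is homogeneous, this says that on a cone around the positive real axis the real
  part of \<open>1 / z\<^sup>k\<close> is comparable to its value on the axis: the discs of radius \<open>r * t\<close> around the
  points \<open>t > 0\<close> fill such a cone.
\<close>

lemma cone_inverse_power:
  fixes k :: nat
  obtains r where "0 < r" "r < 1" "\<And>w. cmod (1 - w) \<le> r \<Longrightarrow> 1 / 2 \<le> Re (inverse (w ^ k))"
proof -
  have "isCont (\<lambda>w. Re (inverse (w ^ k))) 1" by (auto intro!: continuous_intros)
  then have "\<exists>d>0. \<forall>w. dist w 1 < d \<longrightarrow> dist (Re (inverse (w ^ k))) (Re (inverse (1 ^ k))) < 1/2"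
    unfolding continuous_at_eps_delta by (elim allE[of _ "1/2"]) simp
  then obtain d where d: "d > 0" "\<And>w. dist w 1 < d \<Longrightarrow> \<bar>Re (inverse (w ^ k)) - 1\<bar> < 1/2"
    by (auto simp: dist_real_def)
  have "1 / 2 \<le> Re (inverse (w ^ k))" if "cmod (1 - w) \<le> min (d/2) (1/2)" for w
  proof -
    have "dist w 1 < d" using that d(1) by (simp add: dist_norm norm_minus_commute)
    from d(2)[OF this] show ?thesis by linarith
  qed
  with d(1) show ?thesis by (intro that[of "min (d/2) (1/2)"]) auto
qed

text \<open>
  The \<open>p\<close>-th derivative of \<open>exp (- 1 / t\<^sup>k)\<close>, extended by 0 to \<open>t \<le> 0\<close>. Complex derivatives are
  used so that Cauchy's inequality bounds all of them at once.
\<close>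

definition flat_exp :: "nat \<Rightarrow> nat \<Rightarrow> real \<Rightarrow> real" where
  "flat_exp k p t =
     (if t > 0 then Re ((deriv ^^ p) (\<lambda>z. exp (- inverse (z ^ k))) (complex_of_real t)) else 0)"

lemma flat_exp_0: "flat_exp k 0 t = (if t > 0 then exp (- inverse (t ^ k)) else 0)"
proof -
  have "exp (- inverse (complex_of_real t ^ k)) = of_real (exp (- inverse (t ^ k)))"
    by (simp flip: exp_of_real)
  then show ?thesis by (simp add: flat_exp_def)
qed

lemma holomorphic_exp_inverse_power:
  "(\<lambda>z. exp (- inverse (z ^ k))) holomorphic_on {z. Re z > 0}"
  by (auto intro!: holomorphic_intros)

text \<open>
  Cauchy's inequality on the disc of radius \<open>r * t\<close> around \<open>t\<close>, which stays in the cone where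
  \<open>\<bar>exp (- 1 / z\<^sup>k)\<bar> \<le> exp (- 1 / (2 t\<^sup>k))\<close>.
\<close>

lemma flat_exp_cauchy:
  assumes "k > 0"
  obtains r where "0 < r" "r < 1"
    "\<And>t p. t > 0 \<Longrightarrow> \<bar>flat_exp k p t\<bar> \<le> fact p / r ^ p * (exp (- inverse (t ^ k) / 2) / t ^ p)"
proof -
  obtain r where r: "0 < r" "r < 1" "\<And>w. cmod (1 - w) \<le> r \<Longrightarrow> 1 / 2 \<le> Re (inverse (w ^ k))"
    by (rule cone_inverse_power[of k]) (rule that)
  have "\<bar>flat_exp k p t\<bar> \<le> fact p / r ^ p * (exp (- inverse (t ^ k) / 2) / t ^ p)" if t: "t > 0" for t p
  proof -
    let ?f = "\<lambda>z::complex. exp (- inverse (z ^ k))"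
    have sub: "cball (complex_of_real t) (r * t) \<subseteq> {z. Re z > 0}"
    proof
      fix z assume "z \<in> cball (complex_of_real t) (r * t)"
      then have "t - Re z \<le> r * t"
        using complex_Re_le_cmod[of "of_real t - z"] by (simp add: dist_norm)
      moreover have "r * t < t" using r t by simp
      ultimately show "z \<in> {z. Re z > 0}" by auto
    qed
    have "cmod ((deriv ^^ p) ?f (of_real t)) \<le> fact p * exp (- inverse (t ^ k) / 2) / (r * t) ^ p"
    proof (rule Cauchy_inequality)
      show "?f holomorphic_on ball (of_real t) (r * t)"
        using holomorphic_exp_inverse_power
        by (rule holomorphic_on_subset) (use sub ball_subset_cball in blast)
      show "continuous_on (cball (of_real t) (r * t)) ?f"
        using holomorphic_exp_inverse_power sub
        by (meson holomorphic_on_imp_continuous_on holomorphic_on_subset)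
      show "cmod (?f z) \<le> exp (- inverse (t ^ k) / 2)" if "cmod (of_real t - z) = r * t" for z
      proof -
        define w where "w = z / of_real t"
        have z: "z = of_real t * w" using t by (simp add: w_def)
        have "of_real t - z = of_real t * (1 - w)" by (simp add: z algebra_simps)
        then have "cmod (1 - w) = r" using that t by (simp add: norm_mult)
        then have "1 / 2 \<le> Re (inverse (w ^ k))" using r(3) by simp
        moreover have "Re (inverse (z ^ k)) = inverse (t ^ k) * Re (inverse (w ^ k))"
        proof -
          have "inverse (z ^ k) = of_real (inverse (t ^ k)) * inverse (w ^ k)"
            by (simp add: z power_mult_distrib)
          then show ?thesis by (simp only: scaleR_complex.sel flip: scaleR_conv_of_real)
        qed
        ultimately have "inverse (t ^ k) / 2 \<le> Re (inverse (z ^ k))"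
          using mult_left_mono[of "1/2" "Re (inverse (w ^ k))" "inverse (t ^ k)"] t by simp
        then show ?thesis by simp
      qed
    qed (use r t in auto)
    moreover have "\<bar>flat_exp k p t\<bar> \<le> cmod ((deriv ^^ p) ?f (of_real t))"
      using t abs_Re_le_cmod by (simp add: flat_exp_def)
    ultimately show ?thesis by (simp add: power_mult_distrib)
  qed
  then show ?thesis by (rule that[OF r(1,2)])
qed

text \<open>
  With \<open>v = 1 / t\<^sup>k\<close> the \<open>k\<close>-th power of the left-hand side is \<open>v\<^sup>q exp (- k v / 2)\<close>, which is at
  most \<open>q! 2\<^sup>q\<close>. The \<open>k\<close>-th root that is left to take turns \<open>q!\<close> into \<open>q! powr (1 / k)\<close>; together
  with the \<open>p!\<close> of Cauchy's inequality it gives the Gevrey order \<open>1 + 1 / k\<close>.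
\<close>

lemma exp_inverse_power_bound:
  fixes t :: real
  assumes "k > 0" "t > 0"
  shows "exp (- inverse (t ^ k) / 2) / t ^ q \<le> fact q powr (1 / k) * 2 ^ q"
proof -
  define v where "v = inverse (t ^ k)"
  define x where "x = exp (- v / 2) / t ^ q"
  have v: "v > 0" using assms by (simp add: v_def)
  have x: "x > 0" using assms by (simp add: x_def)
  have "exp (- v / 2) ^ k = exp (- (real k * v / 2))" by (simp flip: exp_of_nat_mult)
  moreover have "inverse ((t ^ q) ^ k) = v ^ q"
    unfolding v_def power_inverse power_mult[symmetric] by (simp add: mult.commute)
  ultimately have "x ^ k = v ^ q * exp (- (real k * v / 2))"
    unfolding x_def power_mult_distrib divide_inverse power_inverse[symmetric] by (simp add: power_inverse)
  also have "\<dots> \<le> fact q * 2 ^ q"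
  proof -
    have "(v / 2) ^ q \<le> fact q * exp (v / 2)" by (rule power_le_fact_exp) (use v in simp)
    also have "\<dots> \<le> fact q * exp (real k * v / 2)" using assms v by simp
    finally have "v ^ q \<le> fact q * 2 ^ q * exp (real k * v / 2)" by (simp add: power_divide field_simps)
    then show ?thesis by (simp add: exp_minus field_simps)
  qed
  finally have "x ^ k \<le> fact q * 2 ^ q" .
  then have "(x ^ k) powr (1 / k) \<le> (fact q * 2 ^ q) powr (1 / k)"
    by (rule powr_mono2[rotated 2]) (use x in auto)
  moreover have "(x ^ k) powr (1 / k) = x"
    using x assms by (simp add: powr_realpow[symmetric] powr_powr)
  moreover have "(fact q * 2 ^ q) powr (1 / k) \<le> fact q powr (1 / k) * (2 ^ q :: real)"
  proof -
    have "(2 ^ q :: real) powr (1 / k) \<le> (2 ^ q) powr 1"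
      by (rule powr_mono) (use assms in auto)
    then show ?thesis by (simp add: powr_mult)
  qed
  ultimately show ?thesis by (simp add: x_def v_def)
qed

lemma gevrey_bounded_flat_exp:
  assumes "k > 0"
  shows "gevrey_bounded (1 + 1 / k) UNIV (flat_exp k)"
proof -
  obtain r where r: "0 < r" "r < 1" and
    bd: "\<And>t p. t > 0 \<Longrightarrow> \<bar>flat_exp k p t\<bar> \<le> fact p / r ^ p * (exp (- inverse (t ^ k) / 2) / t ^ p)"
    by (rule flat_exp_cauchy[OF assms]) (rule that)
  have "\<bar>flat_exp k p t\<bar> \<le> 1 * (fact p powr (1 + 1 / k) / (r / 2) ^ p)" for p t
  proof (cases "t > 0")
    case True
    have "\<bar>flat_exp k p t\<bar> \<le> fact p / r ^ p * (exp (- inverse (t ^ k) / 2) / t ^ p)"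
      using bd True .
    also have "\<dots> \<le> fact p / r ^ p * (fact p powr (1 / k) * 2 ^ p)"
      using r by (intro mult_left_mono exp_inverse_power_bound assms True) auto
    also have "\<dots> = 1 * (fact p powr (1 + 1 / k) / (r / 2) ^ p)"
      by (simp add: powr_add power_divide)
    finally show ?thesis .
  next
    case False
    then show ?thesis using r by (simp add: flat_exp_def)
  qed
  then show ?thesis unfolding gevrey_bounded_def using r
    by (intro exI[of _ 1] exI[of _ "r/2"]) auto
qed

text \<open>
  Only \<open>t = 0\<close> needs an argument: there the exponential beats the power \<open>t ^ (p + 2)\<close>, so every
  derivative is \<open>O(t\<^sup>2)\<close>.
\<close>

lemma derivative_tower_flat_exp:
  assumes "k > 0"
  shows "derivative_tower UNIV (flat_exp k)"
  unfolding derivative_tower_def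
proof (intro allI ballI)
  fix p and t :: real
  consider "t > 0" | "t < 0" | "t = 0" by linarith
  then show "(flat_exp k p has_real_derivative flat_exp k (Suc p) t) (at t)"
  proof cases
    case 1
    let ?f = "\<lambda>z::complex. exp (- inverse (z ^ k))"
    have op: "open {z. Re z > 0}" by (simp add: open_halfspace_Re_gt)
    have "(deriv ^^ p) ?f holomorphic_on {z. Re z > 0}"
      by (rule holomorphic_higher_deriv[OF holomorphic_exp_inverse_power op])
    then have "((deriv ^^ p) ?f has_field_derivative deriv ((deriv ^^ p) ?f) (of_real t)) (at (of_real t))"
      by (rule holomorphic_derivI[OF _ op]) (use 1 in simp)
    then have "((\<lambda>t. (deriv ^^ p) ?f (of_real t)) has_vector_derivative (deriv ^^ Suc p) ?f (of_real t)) (at t)"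
      by (simp add: has_vector_derivative_real_field)
    then have "((\<lambda>t. Re ((deriv ^^ p) ?f (of_real t))) has_real_derivative Re ((deriv ^^ Suc p) ?f (of_real t))) (at t)"
      unfolding has_real_derivative_iff_has_vector_derivative
      by (rule bounded_linear.has_vector_derivative[OF bounded_linear_Re])
    then have "(flat_exp k p has_real_derivative Re ((deriv ^^ Suc p) ?f (of_real t))) (at t)"
      by (rule has_field_derivative_transform_within_open[where S="{0<..}"])
         (use 1 in \<open>auto simp: flat_exp_def mult_nonneg_nonpos\<close>)
    then show ?thesis using 1 by (simp add: flat_exp_def)
  next
    case 2
    then show ?thesis
      by - (rule has_field_derivative_transform_within_open[where f="\<lambda>_. 0" and S="{..<0}"];
         auto simp: flat_exp_def)
  next
    case 3
    obtain r where r: "0 < r" "r < 1" and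
      bd: "\<And>t p. t > 0 \<Longrightarrow> \<bar>flat_exp k p t\<bar> \<le> fact p / r ^ p * (exp (- inverse (t ^ k) / 2) / t ^ p)"
      by (rule flat_exp_cauchy[OF assms]) (rule that)
    \<comment> \<open>Two spare powers of \<open>h\<close>: one for the difference quotient, one to make it tend to 0.\<close>
    define C where "C = fact p / r ^ p * (fact (p + 2) powr (1 / k) * 2 ^ (p + 2))"
    have C: "C \<ge> 0" using r by (simp add: C_def)
    have "\<bar>flat_exp k p h / h\<bar> \<le> C * \<bar>h\<bar>" for h
    proof (cases "h > 0")
      case True
      have "\<bar>flat_exp k p h\<bar> \<le> fact p / r ^ p * (exp (- inverse (h ^ k) / 2) / h ^ p)"
        using bd True .
      also have "exp (- inverse (h ^ k) / 2) / h ^ p = exp (- inverse (h ^ k) / 2) / h ^ (p + 2) * h\<^sup>2"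
        using True by (simp add: power_add power2_eq_square field_simps)
      also have "fact p / r ^ p * (exp (- inverse (h ^ k) / 2) / h ^ (p + 2) * h\<^sup>2)
         \<le> fact p / r ^ p * ((fact (p + 2) powr (1 / k) * 2 ^ (p + 2)) * h\<^sup>2)"
        using r True
        by (intro mult_left_mono mult_right_mono exp_inverse_power_bound[OF assms]) auto
      also have "\<dots> = C * h\<^sup>2" by (simp add: C_def)
      finally show ?thesis using True by (simp add: field_simps power2_eq_square)
    qed (use C in \<open>simp add: flat_exp_def[of k p h] mult_nonneg_nonpos\<close>)
    moreover have "((\<lambda>h. C * \<bar>h\<bar>) \<longlongrightarrow> C * \<bar>0\<bar>) (at 0)" by (intro tendsto_intros)
    ultimately have "((\<lambda>h. flat_exp k p h / h) \<longlongrightarrow> 0) (at 0)"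
      by - (rule Lim_null_comparison[where g="\<lambda>h. C * \<bar>h\<bar>"]; simp)
    then have "(flat_exp k p has_real_derivative 0) (at 0)"
      by (simp add: DERIV_def flat_exp_def[of k p 0])
    then show ?thesis using 3 by (simp add: flat_exp_def)
  qed
qed

text \<open>
  The step is \<open>1 - H / H(1)\<close>, where \<open>H\<close> is the primitive of the bump
  \<open>exp (- 1 / t\<^sup>k) exp (- 1 / (1 - t)\<^sup>k)\<close>. Passing to the primitive shifts the derivatives by one,
  which does not affect the Gevrey order.
\<close>

lemma gevrey_unit_step:
  fixes k :: nat
  assumes "k > 0"
  obtains \<Phi> where "derivative_tower UNIV \<Phi>" "gevrey_bounded (1 + 1 / k) UNIV \<Phi>"
    "\<And>t. t \<le> 0 \<Longrightarrow> \<Phi> 0 t = 1" "\<And>t. 1 \<le> t \<Longrightarrow> \<Phi> 0 t = 0"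
proof -
  define E where "E = (\<lambda>p t. (-1) ^ p * flat_exp k p (-1 * t + 1))"
  define B where "B = leibniz_product (flat_exp k) E"
  have tB: "derivative_tower UNIV B"
    unfolding B_def E_def
    by (intro derivative_tower_product derivative_tower_affine derivative_tower_flat_exp assms)
  have gB: "gevrey_bounded (1 + 1 / k) UNIV B"
    unfolding B_def E_def
    by (intro gevrey_bounded_product gevrey_bounded_affine gevrey_bounded_flat_exp assms) auto
  have B0: "B 0 t = flat_exp k 0 t * flat_exp k 0 (1 - t)" for t
    by (simp add: B_def E_def leibniz_product_def)
  have Bnn: "B 0 t \<ge> 0" for t by (simp add: B0 flat_exp_0)
  have Bz: "B 0 t = 0" if "t \<le> 0 \<or> 1 \<le> t" for t using that by (auto simp: B0 flat_exp_0)
  have cont: "continuous_on UNIV (B 0)"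
    using tB unfolding derivative_tower_def by (meson DERIV_isCont continuous_at_imp_continuous_on)
  \<comment> \<open>The base point -1 lies where the bump is zero, so \<open>H\<close> is a primitive on the whole line.\<close>
  define H where "H t = integral {-1..t} (B 0)" for t
  have Hz: "H t = 0" if "t \<le> 0" for t
  proof -
    have "integral {-1..t} (B 0) = integral {-1..t} (\<lambda>_. 0)"
      by (rule integral_cong) (use that Bz in auto)
    then show ?thesis by (simp add: H_def)
  qed
  have dH: "(H has_real_derivative B 0 t) (at t)" for t
  proof (cases "t < 0")
    case True
    then have "(H has_real_derivative 0) (at t)"
      by - (rule has_field_derivative_transform_within_open[where f="\<lambda>_. 0" and S="{..<0}"];
         auto simp: Hz)
    then show ?thesis using Bz True by simp
  next
    case False
    have "((\<lambda>x. integral {-1..x} (B 0)) has_real_derivative B 0 t) (at t within {-1..t + 1})"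
      by (rule integral_has_real_derivative) (use False cont continuous_on_subset in auto)
    moreover have "t \<in> interior {-1..t + 1}" using False by simp
    ultimately show ?thesis unfolding H_def by (metis at_within_interior)
  qed
  have H1: "H t = H 1" if "1 \<le> t" for t
  proof (cases "t = 1")
    case False
    have "continuous_on {1..t} H"
      by (rule DERIV_continuous_on[OF has_field_derivative_at_within[OF dH]])
    then show ?thesis
    proof (rule DERIV_isconst_end[rotated])
      fix x :: real assume "1 < x"
      then show "(H has_real_derivative 0) (at x)" using dH[of x] Bz[of x] by simp
    qed (use False that in simp)
  qed simp
  have mono: "H a \<le> H b" if "a \<le> b" for a b
    by (rule DERIV_nonneg_imp_nondecreasing[OF that]) (use dH Bnn in blast)
  have "H 1 \<noteq> 0"
  proof
    assume "H 1 = 0"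
    \<comment> \<open>Otherwise the monotone \<open>H\<close> would be constant where its derivative is positive.\<close>
    have "H t = 0" if "t \<in> {0<..<1}" for t
      using mono[of 0 t] mono[of t 1] that \<open>H 1 = 0\<close> Hz[of 0] by auto
    then have "(H has_real_derivative 0) (at (1/2))"
      by - (rule has_field_derivative_transform_within_open[where f="\<lambda>_. 0" and S="{0<..<1}"]; auto)
    then have "B 0 (1/2) = 0" using dH DERIV_unique by blast
    then show False by (simp add: B0 flat_exp_0)
  qed
  with mono[of 0 1] Hz[of 0] have Hpos: "H 1 > 0" by simp
  define \<Phi> where "\<Phi> p t = (case p of 0 \<Rightarrow> 1 - H t / H 1 | Suc q \<Rightarrow> - B q t / H 1)" for p t
  have "derivative_tower UNIV \<Phi>"
    unfolding derivative_tower_def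
  proof (intro allI ballI)
    fix p and t :: real
    show "(\<Phi> p has_real_derivative \<Phi> (Suc p) t) (at t)"
    proof (cases p)
      case 0
      have "((\<lambda>t. 1 - H t / H 1) has_real_derivative - B 0 t / H 1) (at t)"
        using Hpos by (auto intro!: derivative_eq_intros dH)
      then show ?thesis by (simp add: 0 \<Phi>_def[abs_def])
    next
      case (Suc q)
      have "(B q has_real_derivative B (Suc q) t) (at t)"
        using tB unfolding derivative_tower_def by auto
      then have "((\<lambda>t. - B q t / H 1) has_real_derivative - B (Suc q) t / H 1) (at t)"
        by (intro DERIV_cdivide DERIV_minus)
      then show ?thesis by (simp add: Suc \<Phi>_def[abs_def])
    qed
  qed
  moreover have "gevrey_bounded (1 + 1 / k) UNIV \<Phi>"
  proof -
    obtain M R where MR: "M > 0" "R > 0" and b: "\<And>t p. \<bar>B p t\<bar> \<le> M * (fact p powr (1 + 1 / k) / R ^ p)"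
      using gB unfolding gevrey_bounded_def by auto
    define M' where "M' = 1 + M * R / H 1"
    have M': "M' \<ge> 1" "M * R / H 1 \<le> M'" using MR Hpos by (auto simp: M'_def)
    have "\<bar>\<Phi> p t\<bar> \<le> M' * (fact p powr (1 + 1 / k) / R ^ p)" for p t
    proof (cases p)
      case 0
      have "0 \<le> H t \<and> H t \<le> H 1"
        using mono[of "min t 0" t] Hz[of "min t 0"] mono[of t "max t 1"] H1[of "max t 1"] by simp
      then have "\<bar>\<Phi> p t\<bar> \<le> 1" using Hpos by (simp add: 0 \<Phi>_def abs_le_iff)
      then show ?thesis using M' by (simp add: 0)
    next
      case (Suc q)
      have "\<bar>\<Phi> p t\<bar> = \<bar>B q t\<bar> / H 1" using Hpos by (simp add: Suc \<Phi>_def)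
      also have "\<dots> \<le> M * (fact q powr (1 + 1 / k) / R ^ q) / H 1"
        using Hpos b by (intro divide_right_mono) auto
      also have "\<dots> = M * R / H 1 * (fact q powr (1 + 1 / k) / R ^ p)"
        using MR by (simp add: Suc)
      also have "\<dots> \<le> M' * (fact p powr (1 + 1 / k) / R ^ p)"
      proof (rule mult_mono[OF M'(2)])
        have "fact q \<le> (fact p :: real)" unfolding Suc by (rule fact_mono) simp
        then show "fact q powr (1 + 1 / k) / R ^ p \<le> fact p powr (1 + 1 / k) / R ^ p"
          using MR by (intro divide_right_mono powr_mono2) auto
      qed (use M' MR in auto)
      finally show ?thesis .
    qed
    moreover have "M' > 0" using M' by simp
    ultimately show ?thesis unfolding gevrey_bounded_def using MR by blast
  qed
  moreover have "\<Phi> 0 t = 1" if "t \<le> 0" for t using that Hz by (simp add: \<Phi>_def)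
  moreover have "\<Phi> 0 t = 0" if "1 \<le> t" for t using H1[OF that] Hpos by (simp add: \<Phi>_def)
  ultimately show ?thesis by (rule that)
qed

text \<open>
  Raising the order only weakens the bounds, so any integer \<open>k \<ge> 1 / (\<sigma> - 1)\<close> will do.
\<close>

lemma gevrey_step:
  assumes "1 < \<sigma>" and "a < b"
  obtains \<Phi> where "derivative_tower UNIV \<Phi>" "gevrey_bounded \<sigma> UNIV \<Phi>"
    "\<And>t. t \<le> a \<Longrightarrow> \<Phi> 0 t = 1" "\<And>t. b \<le> t \<Longrightarrow> \<Phi> 0 t = 0"
proof -
  define k where "k = nat \<lceil>1 / (\<sigma> - 1)\<rceil>"
  have "1 / (\<sigma> - 1) > 0" using assms by simp
  then have k: "k > 0" "1 / (\<sigma> - 1) \<le> real k" unfolding k_def by linarith+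
  then have "1 + 1 / real k \<le> \<sigma>" using assms by (simp add: field_simps)
  obtain \<Phi> where \<Phi>: "derivative_tower UNIV \<Phi>" "gevrey_bounded (1 + 1 / k) UNIV \<Phi>"
    "\<And>t. t \<le> 0 \<Longrightarrow> \<Phi> 0 t = 1" "\<And>t. 1 \<le> t \<Longrightarrow> \<Phi> 0 t = 0"
    by (rule gevrey_unit_step[OF k(1)]) (rule that)
  define c where "c = 1 / (b - a)"
  have c: "c > 0" "c * (b - a) = 1" using assms by (auto simp: c_def)
  show ?thesis
  proof
    show "derivative_tower UNIV (\<lambda>p t. c ^ p * \<Phi> p (c * t + (- c * a)))"
      by (intro derivative_tower_affine \<Phi>)
    show "gevrey_bounded \<sigma> UNIV (\<lambda>p t. c ^ p * \<Phi> p (c * t + (- c * a)))"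
      using c \<open>1 + 1 / real k \<le> \<sigma>\<close>
      by (intro gevrey_bounded_affine gevrey_bounded_mono_order[OF \<Phi>(2)]) auto
    show "c ^ 0 * \<Phi> 0 (c * t + (- c * a)) = 1" if "t \<le> a" for t
      using that c by (simp add: \<Phi>)
    show "c ^ 0 * \<Phi> 0 (c * t + (- c * a)) = 0" if "b \<le> t" for t
    proof -
      have "c * (b - a) \<le> c * (t - a)" using that c by (intro mult_left_mono) auto
      then have "1 \<le> c * (t - a)" unfolding c(2) .
      then have "1 \<le> c * t + - c * a" by (simp add: algebra_simps)
      then show ?thesis using \<Phi>(4) by simp
    qed
  qed
qed

section \<open>The heat series of a flat output\<close>

lemma fact_add_le: "(fact (m + n) :: real) \<le> 2 ^ (m + n) * (fact m * fact n)"
proof -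
  have "fact (m + n) = (fact m * fact n * real ((m + n) choose m) :: real)"
    using binomial_fact_lemma[of m "m + n"] by (metis add_diff_cancel_left' le_add1 of_nat_fact of_nat_mult)
  also have "\<dots> \<le> fact m * fact n * 2 ^ (m + n)"
    using binomial_le_pow2[of "m + n" m]
    by (intro mult_left_mono) (auto simp flip: of_nat_power_le_of_nat_cancel_iff)
  finally show ?thesis by (simp add: mult.commute)
qed

lemma fact_square_le: "(fact i :: real)\<^sup>2 \<le> fact (2 * i)"
proof -
  have "fact (2 * i) = (fact i * fact i * real ((2 * i) choose i) :: real)"
    using binomial_fact_lemma[of i "2 * i"] by (metis diff_add_inverse le_add1 mult_2 of_nat_fact of_nat_mult)
  moreover have "1 \<le> real ((2 * i) choose i)" by (simp add: Suc_le_eq)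
  ultimately show ?thesis
    by (simp add: power2_eq_square mult_le_cancel_left1)
qed

text \<open>
  The ratio of consecutive terms is \<open>K (n+1) powr (\<sigma> - 1)\<close>, which tends to 0 for every \<open>K\<close>. With
  \<open>\<sigma> = s / 2\<close> this is the only place where \<open>s < 2\<close> matters.
\<close>

lemma summable_power_fact_powr:
  fixes K \<sigma> :: real
  assumes "\<sigma> < 1"
  shows "summable (\<lambda>j. K ^ j * fact j powr (\<sigma> - 1))"
proof -
  have "((\<lambda>n. \<bar>K\<bar> * real (Suc n) powr (\<sigma> - 1)) \<longlonglongrightarrow> \<bar>K\<bar> * 0)"
    by (intro tendsto_mult tendsto_const tendsto_neg_powr filterlim_compose[OF filterlim_real_sequentially filterlim_Suc])
       (use assms in auto)
  then have "\<forall>\<^sub>F n in sequentially. \<bar>K\<bar> * real (Suc n) powr (\<sigma> - 1) < 1 / 2"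
    by (rule order_tendstoD) simp
  then obtain N where N: "\<And>n. n \<ge> N \<Longrightarrow> \<bar>K\<bar> * real (Suc n) powr (\<sigma> - 1) < 1 / 2"
    by (auto simp: eventually_sequentially)
  show ?thesis
  proof (rule summable_ratio_test[of "1/2" N])
    fix n assume "n \<ge> N"
    have "norm (K ^ Suc n * fact (Suc n) powr (\<sigma> - 1)) =
        (\<bar>K\<bar> * real (Suc n) powr (\<sigma> - 1)) * norm (K ^ n * fact n powr (\<sigma> - 1))"
      by (simp add: abs_mult power_abs powr_mult del: of_nat_Suc)
    also have "\<dots> \<le> 1 / 2 * norm (K ^ n * fact n powr (\<sigma> - 1))"
      by (rule mult_right_mono) (use N[OF \<open>n \<ge> N\<close>] in auto)
    finally show "norm (K ^ Suc n * fact (Suc n) powr (\<sigma> - 1)) \<le> 1 / 2 * norm (K ^ n * fact n powr (\<sigma> - 1))" .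
  qed simp
qed

lemma open_right_half_plane: "open ({0<..} \<times> UNIV :: (real \<times> real) set)"
  by (intro open_Times open_greaterThan open_UNIV)

text \<open>
  A point of an open set has a box around it inside the set, and partial derivatives see no more.
\<close>

lemma partials_cong:
  assumes "open U" and "\<And>p. p \<in> U \<Longrightarrow> f p = g p" and "p \<in> U"
  shows "partial_t f p = partial_t g p" and "partial_x f p = partial_x g p"
proof -
  obtain t x where p: "p = (t, x)" by fastforce
  obtain A B where AB: "open A" "open B" "p \<in> A \<times> B" "A \<times> B \<subseteq> U"
    by (rule open_prod_elim[OF assms(1,3)])
  then have tx: "t \<in> A" "x \<in> B" by (auto simp: p)
  have "\<forall>\<^sub>F r in nhds t. f (r, x) = g (r, x)"
    by (rule eventually_nhds_in_open[THEN eventually_mono, OF AB(1) tx(1)]) (use AB tx assms(2) in auto)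
  then show "partial_t f p = partial_t g p"
    unfolding p partial_t_def prod.case by (rule deriv_cong_ev) simp
  have "\<forall>\<^sub>F r in nhds x. f (t, r) = g (t, r)"
    by (rule eventually_nhds_in_open[THEN eventually_mono, OF AB(2) tx(2)]) (use AB tx assms(2) in auto)
  then show "partial_x f p = partial_x g p"
    unfolding p partial_x_def prod.case by (rule deriv_cong_ev) simp
qed

lemma C_k_on_cong:
  assumes "open U" and "\<And>p. p \<in> U \<Longrightarrow> f p = g p"
  shows "C_k_on k U f \<longleftrightarrow> C_k_on k U g"
  using assms(2)
proof (induction k arbitrary: f g)
  case 0
  then show ?case by (simp cong: continuous_on_cong)
next
  case (Suc k)
  have "h differentiable_on U" if "g differentiable_on U" "\<And>p. p \<in> U \<Longrightarrow> g p = h p" for g h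
    unfolding differentiable_on_def
  proof
    fix p assume "p \<in> U"
    with that show "h differentiable at p within U"
      by (intro differentiable_transform_within[of g p U 1 h]) (auto simp: differentiable_on_def)
  qed
  from this[of f g] this[of g f] have diff: "f differentiable_on U \<longleftrightarrow> g differentiable_on U"
    using Suc.prems by auto
  show ?case
    using Suc.IH[OF partials_cong(1)[OF assms(1) Suc.prems]] Suc.IH[OF partials_cong(2)[OF assms(1) Suc.prems]]
    by (simp add: diff)
qed

text \<open>
  The sequence \<open>D\<close> consists of the derivatives of the flat output \<open>y\<close>. The bounds are required only
  away from \<open>t = 0\<close>, where the trace of an evolution with merely square integrable initial datum
  may blow up.
\<close>

locale flat_output =
  fixes D :: "nat \<Rightarrow> real \<Rightarrow> real" and s :: real
  assumes tower: "derivative_tower {0<..} D"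
    and bounded: "0 < \<epsilon> \<Longrightarrow> gevrey_bounded s {\<epsilon>..} D"
    and s: "1 \<le> s" "s < 2"
begin

text \<open>
  In \<open>\<Sum>\<^sub>j a\<^sub>j(t) x\<^sup>j / j!\<close> the heat equation reads \<open>a\<^sub>j' = a\<^sub>j\<^sub>+\<^sub>2\<close>; the odd coefficients vanish
  because of the boundary condition at \<open>x = 0\<close>, and the even ones are the derivatives of \<open>a\<^sub>0 = y\<close>.
\<close>

definition coefficient :: "nat \<Rightarrow> real \<Rightarrow> real" where
  "coefficient j t = (if even j then D (j div 2) t else 0)"

text \<open>
  The solution is the member with \<open>q = 0\<close>. Differentiation in \<open>x\<close> shifts the coefficients by one and
  differentiation in \<open>t\<close> by two, so the family contains all partial derivatives of the solution:
  \<open>m\<close> derivatives in \<open>t\<close> and \<open>n\<close> in \<open>x\<close> lead to \<open>q = n + 2 m\<close>.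
\<close>

definition heat_series :: "nat \<Rightarrow> real \<times> real \<Rightarrow> real" where
  "heat_series q = (\<lambda>(t, x). \<Sum>j. coefficient (j + q) t / fact j * x ^ j)"

lemma DERIV_coefficient:
  assumes "0 < t"
  shows "(coefficient j has_real_derivative coefficient (j + 2) t) (at t)"
  using tower assms unfolding derivative_tower_def coefficient_def by auto

text \<open>
  As \<open>(i!)\<^sup>2 \<le> (2i)!\<close>, Gevrey order \<open>s\<close> in the number \<open>i\<close> of time derivatives becomes order \<open>s / 2\<close>
  in the index \<open>j = 2 i\<close>.
\<close>

lemma coefficient_bound:
  assumes "0 < \<epsilon>"
  obtains M L where "M > 0" "L > 0"
    "\<And>t j. \<epsilon> \<le> t \<Longrightarrow> \<bar>coefficient j t\<bar> \<le> M * fact j powr (s / 2) * L ^ j"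
proof -
  obtain M R where MR: "M > 0" "R > 0"
    and b: "\<And>t p. \<epsilon> \<le> t \<Longrightarrow> \<bar>D p t\<bar> \<le> M * (fact p powr s / R ^ p)"
    using bounded[OF assms] unfolding gevrey_bounded_def by auto
  define L where "L = 1 / sqrt R"
  have L: "L > 0" "L ^ (2 * p) = 1 / R ^ p" for p
    using MR by (auto simp: L_def power_mult power_divide)
  have "\<bar>coefficient j t\<bar> \<le> M * fact j powr (s / 2) * L ^ j" if "\<epsilon> \<le> t" for j t
  proof (cases "even j")
    case True
    then obtain p where p: "j = 2 * p" by blast
    have "fact p powr s = ((fact p)\<^sup>2) powr (s / 2)"
      by (simp add: power2_eq_square powr_mult flip: powr_add)
    also have "\<dots> \<le> fact j powr (s / 2)"
      unfolding p by (rule powr_mono2) (use s fact_square_le in auto)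
    finally have "fact p powr s \<le> fact j powr (s / 2)" .
    then have "M * (fact p powr s / R ^ p) \<le> M * (fact j powr (s / 2) / R ^ p)"
      using MR by (intro mult_left_mono divide_right_mono) auto
    with b[OF that, of p] show ?thesis using L(2)[of p] by (simp add: coefficient_def p)
  next
    case False
    then show ?thesis using MR L by (simp add: coefficient_def)
  qed
  with MR L show ?thesis by (intro that[of M L])
qed

text \<open>
  The estimate \<open>(j+q)! \<le> 2\<^sup>j\<^sup>+\<^sup>q j! q!\<close> separates the order of differentiation \<open>q\<close> from the summation
  index \<open>j\<close>. It is essential that \<open>C\<close> and \<open>A\<close> are the same for all \<open>q\<close>: the factors \<open>q!\<close> and \<open>A ^ q\<close>
  become the Gevrey estimate of the sum.
\<close>

lemma heat_term_bound:
  assumes "0 < \<epsilon>" and "0 \<le> X"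
  obtains C A where "C > 0" "A > 0"
    "\<And>q. summable (\<lambda>j. C * fact q powr (s / 2) * A ^ q * ((A * X) ^ j * fact j powr (s / 2 - 1)))"
    "\<And>q t x j. \<epsilon> \<le> t \<Longrightarrow> \<bar>x\<bar> \<le> X \<Longrightarrow> \<bar>coefficient (j + q) t / fact j * x ^ j\<bar> \<le>
        C * fact q powr (s / 2) * A ^ q * ((A * X) ^ j * fact j powr (s / 2 - 1))"
proof -
  obtain M L where pos: "M > 0" "L > 0"
    and b: "\<And>t j. \<epsilon> \<le> t \<Longrightarrow> \<bar>coefficient j t\<bar> \<le> M * fact j powr (s / 2) * L ^ j"
    by (rule coefficient_bound[OF assms(1)]) (rule that)
  define A where "A = 2 powr (s / 2) * L"
  have A: "A > 0" using pos by (simp add: A_def)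
  have "\<bar>coefficient (j + q) t / fact j * x ^ j\<bar> \<le>
      M * fact q powr (s / 2) * A ^ q * ((A * X) ^ j * fact j powr ((s / 2) - 1))"
    if t: "\<epsilon> \<le> t" and x: "\<bar>x\<bar> \<le> X" for q t x j
  proof -
    have "fact (j + q) powr (s / 2) \<le> (2 ^ (j + q) * (fact j * fact q :: real)) powr (s / 2)"
      by (rule powr_mono2) (use s fact_add_le in auto)
    also have "\<dots> = (2 powr (s / 2)) ^ (j + q) * fact j powr (s / 2) * fact q powr (s / 2)"
      by (simp add: powr_mult powr_powr powr_realpow[symmetric] mult.commute)
    finally have "M * fact (j + q) powr (s / 2) * L ^ (j + q) \<le>
        M * ((2 powr (s / 2)) ^ (j + q) * fact j powr (s / 2) * fact q powr (s / 2)) * L ^ (j + q)"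
      using pos by (intro mult_left_mono mult_right_mono) auto
    also have "\<dots> = M * fact q powr (s / 2) * A ^ q * (A ^ j * fact j powr (s / 2))"
      by (simp add: A_def power_mult_distrib power_add)
    finally have "\<bar>coefficient (j + q) t\<bar> \<le> \<dots>" using b[OF t, of "j + q"] by linarith
    then have "\<bar>coefficient (j + q) t\<bar> / fact j * \<bar>x\<bar> ^ j \<le>
        M * fact q powr (s / 2) * A ^ q * (A ^ j * fact j powr (s / 2)) / fact j * X ^ j"
      using pos A x by (intro mult_mono divide_right_mono power_mono) auto
    also have "\<dots> = M * fact q powr (s / 2) * A ^ q * ((A * X) ^ j * fact j powr ((s / 2) - 1))"
      by (simp add: powr_diff power_mult_distrib)
    finally show ?thesis by (simp add: abs_mult power_abs)
  qed
  moreover have "summable (\<lambda>j. M * fact q powr (s / 2) * A ^ q * ((A * X) ^ j * fact j powr ((s / 2) - 1)))" for q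
    by (intro summable_mult summable_power_fact_powr) (use s in simp)
  ultimately show ?thesis by (intro that[OF pos(1) A])
qed

lemma heat_term_majorant:
  assumes "0 < \<epsilon>" and "0 \<le> X"
  obtains B where "summable B"
    "\<And>t x j. \<epsilon> \<le> t \<Longrightarrow> \<bar>x\<bar> \<le> X \<Longrightarrow> \<bar>coefficient (j + q) t / fact j * x ^ j\<bar> \<le> B j"
  by (rule heat_term_bound[OF assms]) (rule that)

lemma summable_heat_series:
  assumes "0 < t"
  shows "summable (\<lambda>j. coefficient (j + q) t / fact j * x ^ j)"
proof -
  obtain B where B: "summable B" "\<And>r x' j. t \<le> r \<Longrightarrow> \<bar>x'\<bar> \<le> \<bar>x\<bar> \<Longrightarrow> \<bar>coefficient (j + q) r / fact j * x' ^ j\<bar> \<le> B j"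
    by (rule heat_term_majorant[OF assms abs_ge_zero[of x]]) (rule that)
  show ?thesis by (rule summable_comparison_test'[OF B(1), of 0]) (use B(2)[of t x] in simp)
qed

lemma DERIV_heat_series_x:
  assumes "0 < t"
  shows "((\<lambda>x. heat_series q (t, x)) has_real_derivative heat_series (Suc q) (t, x)) (at x)"
proof -
  have "diffs (\<lambda>j. coefficient (j + q) t / fact j) = (\<lambda>j. coefficient (j + Suc q) t / fact j)"
    by (auto simp: diffs_def fun_eq_iff field_simps simp del: of_nat_Suc)
  then show ?thesis
    using termdiffs_strong_converges_everywhere[OF summable_heat_series[OF assms], of q x]
    by (simp add: heat_series_def)
qed

lemma DERIV_heat_series_t:
  assumes "0 < t"
  shows "((\<lambda>t. heat_series q (t, x)) has_real_derivative heat_series (q + 2) (t, x)) (at t)"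
proof -
  obtain B where B: "summable B"
    "\<And>r x' j. t / 2 \<le> r \<Longrightarrow> \<bar>x'\<bar> \<le> \<bar>x\<bar> \<Longrightarrow> \<bar>coefficient (j + (q + 2)) r / fact j * x' ^ j\<bar> \<le> B j"
    by (rule heat_term_majorant[of "t/2" "\<bar>x\<bar>" "q + 2"]) (use assms in auto)
  show ?thesis
    unfolding heat_series_def prod.case
  proof (rule has_field_derivative_series'(2)[where S="{t/2..}" and x0=t])
    show "uniformly_convergent_on {t / 2..} (\<lambda>n r. \<Sum>i<n. coefficient (i + (q + 2)) r / fact i * x ^ i)"
      by (rule Weierstrass_m_test'[of _ _ B]) (use B in auto)
    fix j r assume "r \<in> {t / 2..}"
    then have "((\<lambda>r. coefficient (j + q) r) has_real_derivative coefficient (j + (q + 2)) r) (at r within {t / 2..})"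
      using DERIV_coefficient[of r "j + q"] assms by (simp add: has_field_derivative_at_within add.assoc)
    then show "((\<lambda>r. coefficient (j + q) r / fact j * x ^ j) has_real_derivative
        coefficient (j + (q + 2)) r / fact j * x ^ j) (at r within {t / 2..})"
      by (intro DERIV_cmult_right DERIV_cdivide)
  qed (use assms summable_heat_series in auto)
qed

lemma continuous_on_heat_series: "continuous_on ({0<..} \<times> UNIV) (heat_series q)"
proof -
  have "continuous_on ({\<epsilon><..} \<times> {-X<..<X}) (heat_series q)" if eX: "0 < \<epsilon>" "0 \<le> X" for \<epsilon> X
  proof -
    obtain B where B: "summable B"
      "\<And>t x j. \<epsilon> \<le> t \<Longrightarrow> \<bar>x\<bar> \<le> X \<Longrightarrow> \<bar>coefficient (j + q) t / fact j * x ^ j\<bar> \<le> B j"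
      by (rule heat_term_majorant[OF eX, of q]) (rule that)
    have c: "continuous_on {\<epsilon><..} (coefficient j)" for j
      by (intro continuous_at_imp_continuous_on ballI DERIV_isCont[OF DERIV_coefficient])
         (use eX in auto)
    show ?thesis
    proof (rule uniform_limit_theorem)
      show "uniform_limit ({\<epsilon><..} \<times> {-X<..<X})
          (\<lambda>n p. \<Sum>j<n. coefficient (j + q) (fst p) / fact j * snd p ^ j) (heat_series q) sequentially"
        unfolding heat_series_def case_prod_beta
        by (rule Weierstrass_m_test[of _ _ B]) (use B in \<open>auto simp: abs_le_iff\<close>)
      show "\<forall>\<^sub>F n in sequentially. continuous_on ({\<epsilon><..} \<times> {-X<..<X})
          (\<lambda>p. \<Sum>j<n. coefficient (j + q) (fst p) / fact j * snd p ^ j)"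
        by (intro always_eventually allI continuous_intros continuous_on_compose2[OF c]) auto
    qed simp
  qed
  then have c: "continuous_on ({fst p / 2<..} \<times> {- (\<bar>snd p\<bar> + 1)<..<\<bar>snd p\<bar> + 1}) (heat_series q)"
    if "p \<in> {0<..} \<times> UNIV" for p
    using that by (auto simp del: minus_add_distrib)
  have "continuous_on (\<Union>p\<in>{0<..} \<times> UNIV. {fst p / 2<..} \<times> {- (\<bar>snd p\<bar> + 1)<..<\<bar>snd p\<bar> + 1}) (heat_series q)"
    by (rule continuous_on_open_UN) (intro open_Times open_greaterThan open_greaterThanLessThan, rule c)
  then show ?thesis
  proof (rule continuous_on_subset, intro subsetI)
    fix p :: "real \<times> real" assume p: "p \<in> {0<..} \<times> UNIV"
    have "p \<in> {fst p / 2<..} \<times> {- (\<bar>snd p\<bar> + 1)<..<\<bar>snd p\<bar> + 1}"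
      using p by (cases p) auto
    with p show "p \<in> (\<Union>p\<in>{0<..} \<times> UNIV. {fst p / 2<..} \<times> {- (\<bar>snd p\<bar> + 1)<..<\<bar>snd p\<bar> + 1})"
      by (rule UN_I)
  qed
qed

text \<open>
  Both partial derivatives are again heat series, hence jointly continuous.
\<close>

lemma heat_series_differentiable:
  assumes "0 < t"
  shows "heat_series q differentiable (at (t, x))"
proof -
  have "((\<lambda>(t, x). heat_series q (t, x)) has_derivative
      (\<lambda>(dt, dx). heat_series (q + 2) (t, x) * dt + blinfun_mult_right (heat_series (Suc q) (t, x)) dx))
      (at (t, x) within {0<..} \<times> UNIV)"
  proof (rule has_derivative_partialsI)
    show "((\<lambda>t. heat_series q (t, x)) has_derivative (*) (heat_series (q + 2) (t, x))) (at t within {0<..})"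
      using DERIV_heat_series_t[OF assms] by (simp add: has_field_derivative_def has_derivative_at_withinI)
    show "((\<lambda>x. heat_series q (t, x)) has_derivative blinfun_mult_right (heat_series (Suc q) (t, x))) (at x within UNIV)"
      if "t \<in> {0<..}" for t x
      using DERIV_heat_series_x[of t q x] that by (simp add: has_field_derivative_def)
    have "isCont (heat_series (Suc q)) (t, x)"
      using continuous_on_heat_series[of "Suc q"] assms continuous_on_eq_continuous_at[OF open_right_half_plane]
      by blast
    then show "continuous (at (t, x) within {0<..} \<times> UNIV) (\<lambda>(t, x). blinfun_mult_right (heat_series (Suc q) (t, x)))"
      unfolding case_prod_beta prod.collapse
      by (rule bounded_linear.continuous[OF bounded_linear_blinfun_mult_right continuous_at_imp_continuous_at_within])
  qed auto
  moreover have "(at (t, x) within {0<..} \<times> UNIV) = at (t, x)"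
    by (rule at_within_open[OF _ open_right_half_plane]) (use assms in simp)
  ultimately show ?thesis unfolding differentiable_def by (auto simp: case_prod_eta)
qed

lemma partial_heat_series:
  assumes "p \<in> {0<..} \<times> UNIV"
  shows "partial_t (heat_series q) p = heat_series (q + 2) p"
    and "partial_x (heat_series q) p = heat_series (Suc q) p"
  using assms DERIV_imp_deriv[OF DERIV_heat_series_t] DERIV_imp_deriv[OF DERIV_heat_series_x]
  by (auto simp: partial_t_def partial_x_def)

lemma C_k_on_heat_series: "C_k_on k ({0<..} \<times> UNIV) (heat_series q)"
proof (induction k arbitrary: q)
  case 0
  show ?case by (simp add: continuous_on_heat_series)
next
  case (Suc k)
  have "C_k_on k ({0<..} \<times> UNIV) (partial_t (heat_series q))"
    using C_k_on_cong[OF open_right_half_plane, of "partial_t (heat_series q)", OF partial_heat_series(1)] Suc.IH by simp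
  moreover have "C_k_on k ({0<..} \<times> UNIV) (partial_x (heat_series q))"
    using C_k_on_cong[OF open_right_half_plane, of "partial_x (heat_series q)", OF partial_heat_series(2)] Suc.IH by simp
  moreover have "heat_series q differentiable_on {0<..} \<times> UNIV"
    unfolding differentiable_on_def
    using heat_series_differentiable by (auto simp: differentiable_at_withinI)
  ultimately show ?case by simp
qed

lemma iterated_partials_heat_series:
  assumes "p \<in> {0<..} \<times> UNIV"
  shows "(partial_t ^^ m) ((partial_x ^^ n) (heat_series q)) p = heat_series (q + n + 2 * m) p"
proof -
  note cong = partials_cong[OF open_right_half_plane]
  have x: "\<forall>p\<in>{0<..} \<times> UNIV. (partial_x ^^ n) (heat_series q) p = heat_series (q + n) p"
  proof (induction n)
    case (Suc n)
    show ?case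
    proof
      fix p :: "real \<times> real" assume p: "p \<in> {0<..} \<times> UNIV"
      have "(partial_x ^^ Suc n) (heat_series q) p = partial_x (heat_series (q + n)) p"
        using cong(2)[OF _ p, of "(partial_x ^^ n) (heat_series q)" "heat_series (q + n)"] Suc.IH by simp
      then show "(partial_x ^^ Suc n) (heat_series q) p = heat_series (q + Suc n) p"
        using partial_heat_series(2)[OF p] by simp
    qed
  qed simp
  have "\<forall>p\<in>{0<..} \<times> UNIV. (partial_t ^^ m) ((partial_x ^^ n) (heat_series q)) p = heat_series (q + n + 2 * m) p"
  proof (induction m)
    case (Suc m)
    show ?case
    proof
      fix p :: "real \<times> real" assume p: "p \<in> {0<..} \<times> UNIV"
      have "(partial_t ^^ Suc m) ((partial_x ^^ n) (heat_series q)) p = partial_t (heat_series (q + n + 2 * m)) p"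
        using cong(1)[OF _ p, of "(partial_t ^^ m) ((partial_x ^^ n) (heat_series q))" "heat_series (q + n + 2 * m)"] Suc.IH
        by simp
      then show "(partial_t ^^ Suc m) ((partial_x ^^ n) (heat_series q)) p = heat_series (q + n + 2 * Suc m) p"
        using partial_heat_series(1)[OF p] by simp
    qed
  qed (use x in simp)
  then show ?thesis using assms by blast
qed

text \<open>
  Here \<open>q = n + 2 m\<close>, and \<open>((2m)!) powr (s / 2)\<close> is \<open>(m!) powr s\<close> up to a geometric factor: a time
  derivative counts as two space derivatives.
\<close>

lemma heat_series_bound:
  assumes "0 < \<epsilon>" and "0 \<le> X"
  obtains M R1 R2 where "M > 0" "R1 > 0" "R2 > 0"
    "\<And>t x m n. \<epsilon> \<le> t \<Longrightarrow> \<bar>x\<bar> \<le> X \<Longrightarrow> \<bar>heat_series (n + 2 * m) (t, x)\<bar> \<le>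
        M * (fact m powr s * fact n powr (s / 2) / (R1 ^ m * R2 ^ n))"
proof -
  obtain C A where CA: "C > 0" "A > 0"
    and sm: "\<And>q. summable (\<lambda>j. C * fact q powr (s / 2) * A ^ q * ((A * X) ^ j * fact j powr (s / 2 - 1)))"
    and bd: "\<And>q t x j. \<epsilon> \<le> t \<Longrightarrow> \<bar>x\<bar> \<le> X \<Longrightarrow> \<bar>coefficient (j + q) t / fact j * x ^ j\<bar> \<le>
        C * fact q powr (s / 2) * A ^ q * ((A * X) ^ j * fact j powr (s / 2 - 1))"
    by (rule heat_term_bound[OF assms]) (rule that)
  define S where "S = (\<Sum>j. (A * X) ^ j * fact j powr (s / 2 - 1))"
  \<comment> \<open>The summand 1 keeps \<open>M\<close> positive.\<close>
  define M where "M = C * (S + 1)"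
  have sS: "summable (\<lambda>j. (A * X) ^ j * fact j powr (s / 2 - 1))"
    by (rule summable_power_fact_powr) (use s in simp)
  have S: "S \<ge> 0" unfolding S_def using CA assms by (intro suminf_nonneg sS) auto
  define B where "B = 2 powr (s / 2) * A"
  have B: "B > 0" using CA by (simp add: B_def)
  define E where "E = B\<^sup>2 * 2 powr s"
  have E: "E > 0" using B by (simp add: E_def)
  have "\<bar>heat_series (n + 2 * m) (t, x)\<bar> \<le>
        M * (fact m powr s * fact n powr (s / 2) / ((1 / E) ^ m * (1 / B) ^ n))"
    if t: "\<epsilon> \<le> t" and x: "\<bar>x\<bar> \<le> X" for t x m n
  proof -
    define q where "q = n + 2 * m"
    have "\<bar>heat_series q (t, x)\<bar> \<le> (\<Sum>j. C * fact q powr (s / 2) * A ^ q * ((A * X) ^ j * fact j powr (s / 2 - 1)))"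
      unfolding heat_series_def prod.case
      using norm_suminf_le[OF bd[OF t x, folded real_norm_def] sm, of q] by simp
    also have "\<dots> = C * fact q powr (s / 2) * A ^ q * S"
      unfolding S_def by (rule suminf_mult[OF sS])
    also have "\<dots> \<le> M * (fact q powr (s / 2) * A ^ q)"
      using CA S by (simp add: M_def algebra_simps)
    also have "\<dots> \<le> M * (fact m powr s * fact n powr (s / 2) * E ^ m * B ^ n)"
    proof (rule mult_left_mono)
      have "fact (2 * m) \<le> 4 ^ m * (fact m * fact m :: real)"
        using fact_add_le[of m m] by (simp add: power_add mult_2 flip: power_mult_distrib)
      then have "fact (n + 2 * m) \<le> 2 ^ (n + 2 * m) * (fact n * (4 ^ m * (fact m * fact m :: real)))"
        using fact_add_le[of n "2 * m"] by (elim order_trans) (intro mult_left_mono, auto)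
      then have "fact q powr (s / 2) \<le> (2 ^ q * (fact n * (4 ^ m * (fact m * fact m :: real)))) powr (s / 2)"
        unfolding q_def by (intro powr_mono2) (use s in auto)
      also have "\<dots> = (2 powr (s / 2)) ^ q * fact n powr (s / 2) * (2 powr s) ^ m * fact m powr s"
      proof -
        have "(4 ^ m :: real) = 2 powr real (2 * m)" by (simp add: powr_realpow power_mult flip: of_nat_mult)
        moreover have "fact m powr (s / 2) * fact m powr (s / 2) = fact m powr s" by (simp flip: powr_add)
        ultimately show ?thesis by (simp add: powr_mult powr_powr powr_realpow[symmetric] mult_ac)
      qed
      finally have "fact q powr (s / 2) * A ^ q \<le> \<dots> * A ^ q" using CA by (intro mult_right_mono) auto
      also have "\<dots> = fact m powr s * fact n powr (s / 2) * E ^ m * B ^ n"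
        by (simp add: q_def E_def B_def power_add power_mult power_mult_distrib)
      finally show "fact q powr (s / 2) * A ^ q \<le> \<dots>" .
    qed (use CA S in \<open>simp add: M_def\<close>)
    finally show ?thesis by (simp add: q_def power_one_over mult_ac)
  qed
  moreover have "M > 0" "1 / E > 0" "1 / B > 0" using CA S E B by (auto simp: M_def)
  ultimately show ?thesis by (intro that)
qed

lemma gevrey2_heat_series:
  assumes "0 < \<epsilon>" and "\<And>p. p \<in> {\<epsilon>..T} \<times> {0..1} \<Longrightarrow> \<theta> p = heat_series 0 p"
  shows "gevrey2 s (s / 2) ({\<epsilon>..T} \<times> {0..1}) \<theta>"
proof -
  obtain M R1 R2 where M: "M > 0" "R1 > 0" "R2 > 0" and
    b: "\<And>t x m n. \<epsilon> \<le> t \<Longrightarrow> \<bar>x\<bar> \<le> 1 \<Longrightarrow> \<bar>heat_series (n + 2 * m) (t, x)\<bar> \<le>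
        M * (fact m powr s * fact n powr (s / 2) / (R1 ^ m * R2 ^ n))"
    by (rule heat_series_bound[OF assms(1), of 1]) (simp, rule that)
  have "\<forall>p\<in>{\<epsilon>..T} \<times> {0..1}. \<forall>m n. \<bar>(partial_t ^^ m) ((partial_x ^^ n) (heat_series 0)) p\<bar>
              \<le> M * (fact m powr s * fact n powr (s / 2) / (R1 ^ m * R2 ^ n))"
    using assms(1) b by (auto simp: iterated_partials_heat_series)
  moreover note open_right_half_plane
  moreover have "{\<epsilon>..T} \<times> {0..1} \<subseteq> {0<..} \<times> UNIV" using assms(1) by auto
  ultimately show ?thesis
    unfolding gevrey2_def using M assms(2) C_k_on_heat_series by metis
qed

end

section \<open>Square integrable functions on the unit interval\<close>

abbreviation unit_interval_measure :: "real measure" where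
  "unit_interval_measure \<equiv> lebesgue_on {0<..<1}"

text \<open>
  The square of the \<open>L\<^sup>2\<close> norm. Limits are all that is needed, and for those the inequality
  \<open>sqnorm_add_le\<close> is as good as the triangle inequality.
\<close>

definition sqnorm :: "(real \<Rightarrow> real) \<Rightarrow> real" where
  "sqnorm f = (LINT x|unit_interval_measure. (f x)\<^sup>2)"

lemma finite_unit_interval_measure: "finite_measure unit_interval_measure"
  by (rule finite_measure_lebesgue_on) (simp add: lmeasurable_box)

lemma measure_unit_interval: "measure unit_interval_measure {0<..<1} = 1"
  by (simp add: space_lebesgue_on measure_restrict_space)

lemma integrable_bounded_unit:
  fixes f :: "real \<Rightarrow> real"
  assumes "f \<in> borel_measurable unit_interval_measure" and "\<And>x. x \<in> {0<..<1} \<Longrightarrow> \<bar>f x\<bar> \<le> B"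
  shows "integrable unit_interval_measure f"
  by (rule finite_measure.integrable_const_bound[OF finite_unit_interval_measure, of _ B])
     (use assms in \<open>auto intro!: AE_I2 simp: space_lebesgue_on\<close>)

lemma continuous_unit_measurable:
  fixes f :: "real \<Rightarrow> real"
  assumes "continuous_on {0..1} f"
  shows "f \<in> borel_measurable unit_interval_measure"
proof (rule continuous_imp_measurable_on_sets_lebesgue)
  show "continuous_on {0<..<1} f" by (rule continuous_on_subset[OF assms]) auto
qed simp

lemma continuous_unit_bounded:
  fixes f :: "real \<Rightarrow> real"
  assumes "continuous_on {0..1} f"
  obtains B where "\<And>x. x \<in> {0..1} \<Longrightarrow> \<bar>f x\<bar> \<le> B"
proof -
  have "bounded (f ` {0..1})"
    using compact_continuous_image[OF assms compact_Icc] compact_imp_bounded by blast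
  then obtain B where "\<forall>x\<in>{0..1}. \<bar>f x\<bar> \<le> B" unfolding bounded_iff by auto
  then show ?thesis by (intro that[of B]) auto
qed

lemma continuous_unit_integrable:
  fixes f :: "real \<Rightarrow> real"
  assumes "continuous_on {0..1} f"
  shows "integrable unit_interval_measure f"
proof -
  obtain B where "\<And>x. x \<in> {0..1} \<Longrightarrow> \<bar>f x\<bar> \<le> B"
    by (rule continuous_unit_bounded[OF assms]) (rule that)
  then show ?thesis
    by (intro integrable_bounded_unit[where B=B] continuous_unit_measurable assms) auto
qed

lemma integral_unit_eq:
  fixes f :: "real \<Rightarrow> real"
  assumes "continuous_on {0..1} f"
  shows "(LINT x|unit_interval_measure. f x) = integral {0..1} f"
  using lebesgue_integral_eq_integral[OF continuous_unit_integrable[OF assms]]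
  by (simp add: integral_open_interval_real)

lemma L2_continuous:
  assumes "continuous_on {0..1} f"
  shows "L2_01 f"
  unfolding L2_01_def
  by (intro conjI continuous_unit_measurable continuous_unit_integrable continuous_intros assms)

lemma L2_measurable: "L2_01 f \<Longrightarrow> f \<in> borel_measurable unit_interval_measure"
  by (simp add: L2_01_def)

lemma L2_integrable_power2: "L2_01 f \<Longrightarrow> integrable unit_interval_measure (\<lambda>x. (f x)\<^sup>2)"
  by (simp add: L2_01_def)

lemma L2_cmult: "L2_01 f \<Longrightarrow> L2_01 (\<lambda>x. c * f x)"
  unfolding L2_01_def by (auto simp: power_mult_distrib)

lemma add_power2_le: "((a::real) + b)\<^sup>2 \<le> 2 * a\<^sup>2 + 2 * b\<^sup>2"
  using zero_le_power2[of "a - b"] by (simp add: power2_eq_square algebra_simps)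

lemma L2_add:
  assumes "L2_01 f" and "L2_01 g"
  shows "L2_01 (\<lambda>x. f x + g x)"
proof -
  have "integrable unit_interval_measure (\<lambda>x. (f x + g x)\<^sup>2)"
  proof (rule Bochner_Integration.integrable_bound)
    show "integrable unit_interval_measure (\<lambda>x. 2 * (f x)\<^sup>2 + 2 * (g x)\<^sup>2)"
      using assms by (simp add: L2_01_def)
    show "AE x in unit_interval_measure. norm ((f x + g x)\<^sup>2) \<le> norm (2 * (f x)\<^sup>2 + 2 * (g x)\<^sup>2)"
      by (intro AE_I2) (use add_power2_le in auto)
  qed (use assms in \<open>auto simp: L2_01_def\<close>)
  then show ?thesis using assms by (simp add: L2_01_def borel_measurable_add)
qed

lemma L2_diff: "L2_01 f \<Longrightarrow> L2_01 g \<Longrightarrow> L2_01 (\<lambda>x. f x - g x)"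
  using L2_add[of f "\<lambda>x. (-1) * g x"] L2_cmult[of g "-1"] by simp

lemma L2_mult_integrable:
  assumes "L2_01 f" and "L2_01 g"
  shows "integrable unit_interval_measure (\<lambda>x. f x * g x)"
proof (rule Bochner_Integration.integrable_bound)
  show "integrable unit_interval_measure (\<lambda>x. (f x)\<^sup>2 + (g x)\<^sup>2)"
    using assms by (simp add: L2_01_def)
  have "\<bar>a * b\<bar> \<le> a\<^sup>2 + b\<^sup>2" for a b :: real
  proof -
    have "2 * (\<bar>a\<bar> * \<bar>b\<bar>) \<le> a\<^sup>2 + b\<^sup>2"
      using sum_squares_bound[of "\<bar>a\<bar>" "\<bar>b\<bar>"] by simp
    moreover have "0 \<le> \<bar>a\<bar> * \<bar>b\<bar>" by simp
    ultimately show ?thesis unfolding abs_mult by linarith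
  qed
  then show "AE x in unit_interval_measure. norm (f x * g x) \<le> norm ((f x)\<^sup>2 + (g x)\<^sup>2)"
    by (intro AE_I2) simp
qed (use assms in \<open>auto simp: L2_01_def\<close>)

lemma sqnorm_nonneg: "0 \<le> sqnorm f"
  unfolding sqnorm_def by (intro integral_nonneg_AE) simp

lemma sqnorm_add_le:
  assumes "L2_01 f" and "L2_01 g"
  shows "sqnorm (\<lambda>x. f x + g x) \<le> 2 * sqnorm f + 2 * sqnorm g"
proof -
  have "sqnorm (\<lambda>x. f x + g x) \<le> (LINT x|unit_interval_measure. 2 * (f x)\<^sup>2 + 2 * (g x)\<^sup>2)"
    unfolding sqnorm_def
    by (rule integral_mono) (use L2_add[OF assms] assms add_power2_le in \<open>auto simp: L2_01_def\<close>)
  also have "\<dots> = 2 * sqnorm f + 2 * sqnorm g"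
    using assms by (simp add: sqnorm_def L2_01_def)
  finally show ?thesis .
qed

lemma sqnorm_le_bound:
  assumes "L2_01 f" and "\<And>x. x \<in> {0<..<1} \<Longrightarrow> \<bar>f x\<bar> \<le> B"
  shows "sqnorm f \<le> B\<^sup>2"
proof -
  have "(f x)\<^sup>2 \<le> B\<^sup>2" if "x \<in> {0<..<1}" for x
    using assms(2)[OF that] by (simp add: abs_le_square_iff[symmetric])
  then have "sqnorm f \<le> (LINT x|unit_interval_measure. B\<^sup>2)"
    unfolding sqnorm_def using assms(1) finite_measure.integrable_const[OF finite_unit_interval_measure]
    by (intro integral_mono) (auto simp: L2_01_def space_lebesgue_on)
  then show ?thesis by (simp add: measure_unit_interval space_lebesgue_on)
qed

lemma sqnorm_tendsto_zero_bounded: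
  assumes "\<And>n. f n \<in> borel_measurable unit_interval_measure"
    and "AE x in unit_interval_measure. (\<lambda>n. f n x) \<longlonglongrightarrow> 0"
    and "integrable unit_interval_measure w"
    and "\<And>n x. x \<in> {0<..<1} \<Longrightarrow> (f n x)\<^sup>2 \<le> w x"
  shows "(\<lambda>n. sqnorm (f n)) \<longlonglongrightarrow> 0"
proof -
  have "(\<lambda>n. LINT x|unit_interval_measure. (f n x)\<^sup>2) \<longlonglongrightarrow> (LINT x|unit_interval_measure. 0)"
  proof (rule integral_dominated_convergence[where w=w])
    show "AE x in unit_interval_measure. (\<lambda>n. (f n x)\<^sup>2) \<longlonglongrightarrow> 0"
      using assms(2) by eventually_elim (use tendsto_power[of _ 0 _ 2] in fastforce)
  qed (use assms in \<open>auto simp: space_lebesgue_on intro!: AE_I2\<close>)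
  then show ?thesis by (simp add: sqnorm_def)
qed

text \<open>
  Two applications of dominated convergence: first \<open>f\<close> is cut off at height \<open>K\<close>, then the bounded
  function is approximated almost everywhere by continuous functions, cut off at the same height.
\<close>

lemma L2_approx_continuous:
  assumes "L2_01 f" and "0 < e"
  obtains g where "continuous_on UNIV g" "sqnorm (\<lambda>x. f x - g x) < e"
proof -
  define cl where "cl K y = max (- real K) (min (real K) y)" for K and y :: real
  have cl_cont: "continuous_on UNIV (cl K)" for K
    unfolding cl_def by (intro continuous_intros)
  have cl_meas: "cl K \<in> borel_measurable borel" for K
    using cl_cont by (rule borel_measurable_continuous_onI)
  have fm: "f \<in> borel_measurable unit_interval_measure" using assms by (simp add: L2_01_def)
  have "(\<lambda>K. sqnorm (\<lambda>x. f x - cl K (f x))) \<longlonglongrightarrow> 0"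
  proof (rule sqnorm_tendsto_zero_bounded[where w="\<lambda>x. (f x)\<^sup>2"])
    show "(\<lambda>x. f x - cl K (f x)) \<in> borel_measurable unit_interval_measure" for K
      by (intro borel_measurable_diff fm measurable_compose[OF fm cl_meas])
    show "AE x in unit_interval_measure. (\<lambda>K. f x - cl K (f x)) \<longlonglongrightarrow> 0"
    proof (intro AE_I2 tendsto_eventually)
      fix x
      obtain N :: nat where "\<bar>f x\<bar> \<le> real N" using real_arch_simple by blast
      then show "\<forall>\<^sub>F K in sequentially. f x - cl K (f x) = 0"
        by (intro eventually_sequentiallyI[of N]) (auto simp: cl_def)
    qed
    show "(f x - cl K (f x))\<^sup>2 \<le> (f x)\<^sup>2" for K x
      by (rule abs_le_square_iff[THEN iffD1]) (auto simp: cl_def)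
  qed (use assms in \<open>simp add: L2_01_def\<close>)
  then have "\<forall>\<^sub>F K in sequentially. sqnorm (\<lambda>x. f x - cl K (f x)) < e / 4"
    by (rule order_tendstoD) (use assms in simp)
  then obtain K where K: "sqnorm (\<lambda>x. f x - cl K (f x)) < e / 4"
    by (auto dest: eventually_happens)
  have "f measurable_on {0<..<1}"
    using fm by (subst measurable_on_iff_borel_measurable) auto
  then obtain N g where N: "negligible N" and g: "\<And>n. continuous_on UNIV (g n)"
    and lim: "\<And>x. x \<notin> N \<Longrightarrow> (\<lambda>n. g n x) \<longlonglongrightarrow> (if x \<in> {0<..<1} then f x else 0)"
    unfolding measurable_on_def by blast
  have gc: "continuous_on UNIV (\<lambda>x. cl K (g n x))" for n
    using continuous_on_compose2[OF cl_cont g] by simp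
  have clm: "(\<lambda>x. cl K (f x)) \<in> borel_measurable unit_interval_measure"
    by (rule measurable_compose[OF fm cl_meas])
  have gm: "(\<lambda>x. cl K (g n x)) \<in> borel_measurable unit_interval_measure" for n
    by (rule continuous_unit_measurable) (use gc continuous_on_subset in blast)
  have "(\<lambda>n. sqnorm (\<lambda>x. cl K (f x) - cl K (g n x))) \<longlonglongrightarrow> 0"
  proof (rule sqnorm_tendsto_zero_bounded[where w="\<lambda>x. (2 * real K)\<^sup>2"])
    show "(\<lambda>x. cl K (f x) - cl K (g n x)) \<in> borel_measurable unit_interval_measure" for n
      by (intro borel_measurable_diff clm gm)
    have "AE x in lebesgue. x \<notin> N"
      using N by (simp add: negligible_iff_null_sets AE_not_in)
    then have "AE x in lebesgue. x \<in> {0<..<1} \<longrightarrow> (\<lambda>n. cl K (f x) - cl K (g n x)) \<longlonglongrightarrow> 0"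
    proof eventually_elim
      case (elim x)
      have "(\<lambda>n. cl K (f x) - cl K (g n x)) \<longlonglongrightarrow> cl K (f x) - cl K (f x)" if "x \<in> {0<..<1}"
        unfolding cl_def using lim[OF elim] that by (intro tendsto_intros) auto
      then show ?case by simp
    qed
    then show "AE x in unit_interval_measure. (\<lambda>n. cl K (f x) - cl K (g n x)) \<longlonglongrightarrow> 0"
      by (simp add: AE_restrict_space_iff)
    show "(cl K (f x) - cl K (g n x))\<^sup>2 \<le> (2 * real K)\<^sup>2" for n x
      by (rule abs_le_square_iff[THEN iffD1]) (auto simp: cl_def)
  qed (rule finite_measure.integrable_const[OF finite_unit_interval_measure])
  then have "\<forall>\<^sub>F n in sequentially. sqnorm (\<lambda>x. cl K (f x) - cl K (g n x)) < e / 4"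
    by (rule order_tendstoD) (use assms in simp)
  then obtain n where n: "sqnorm (\<lambda>x. cl K (f x) - cl K (g n x)) < e / 4"
    by (auto dest: eventually_happens)
  have Lcl: "L2_01 (\<lambda>x. cl K (f x))"
    unfolding L2_01_def
  proof (intro conjI clm)
    have "\<bar>(cl K (f x))\<^sup>2\<bar> \<le> (real K)\<^sup>2" for x
      unfolding abs_power2 by (rule abs_le_square_iff[THEN iffD1]) (auto simp: cl_def)
    then show "integrable unit_interval_measure (\<lambda>x. (cl K (f x))\<^sup>2)"
      by (intro integrable_bounded_unit[where B="(real K)\<^sup>2"] borel_measurable_power clm) auto
  qed
  have Lg: "L2_01 (\<lambda>x. cl K (g n x))"
    by (rule L2_continuous) (use gc continuous_on_subset in blast)
  have "sqnorm (\<lambda>x. (f x - cl K (f x)) + (cl K (f x) - cl K (g n x))) \<le>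
      2 * sqnorm (\<lambda>x. f x - cl K (f x)) + 2 * sqnorm (\<lambda>x. cl K (f x) - cl K (g n x))"
    by (intro sqnorm_add_le L2_diff assms Lcl Lg)
  with K n have "sqnorm (\<lambda>x. f x - cl K (g n x)) < e" by simp
  with gc that show ?thesis by blast
qed

section \<open>Cosine expansions and the Neumann heat semigroup\<close>

text \<open>
  The linear span of the modes, generated in such a way that linear properties follow by induction.
\<close>

inductive_set cosine_polynomials :: "(real \<Rightarrow> real) set" where
  cosine: "(\<lambda>x. a * cos (real n * pi * x)) \<in> cosine_polynomials"
| add: "f \<in> cosine_polynomials \<Longrightarrow> g \<in> cosine_polynomials \<Longrightarrow> (\<lambda>x. f x + g x) \<in> cosine_polynomials"

lemma cosine_polynomials_continuous: "f \<in> cosine_polynomials \<Longrightarrow> continuous_on S f"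
  by (induction rule: cosine_polynomials.induct) (auto intro!: continuous_intros)

text \<open>
  The product formula for cosines; it makes the span an algebra, as the Stone-Weierstrass theorem
  requires.
\<close>

lemma cosine_polynomials_mult:
  assumes "f \<in> cosine_polynomials" and "g \<in> cosine_polynomials"
  shows "(\<lambda>x. f x * g x) \<in> cosine_polynomials"
  using assms
proof (induction rule: cosine_polynomials.induct)
  case (cosine a n)
  then show ?case
  proof (induction rule: cosine_polynomials.induct)
    case (cosine b m)
    define k where "k = (if m \<le> n then n - m else m - n)"
    have "cos (real n * pi * x - real m * pi * x) = cos (real k * pi * x)" for x
    proof (cases "m \<le> n")
      case True
      then show ?thesis by (simp add: k_def of_nat_diff algebra_simps)
    next
      case False
      have "cos (real n * pi * x - real m * pi * x) = cos (real m * pi * x - real n * pi * x)"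
        by (metis cos_minus minus_diff_eq)
      then show ?thesis using False by (simp add: k_def of_nat_diff algebra_simps)
    qed
    then have "a * cos (real n * pi * x) * (b * cos (real m * pi * x)) =
        (a * b / 2) * cos (real k * pi * x) + (a * b / 2) * cos (real (n + m) * pi * x)" for x
    proof -
      have "a * cos (real n * pi * x) * (b * cos (real m * pi * x)) =
          a * b * (cos (real n * pi * x) * cos (real m * pi * x))" by simp
      also have "\<dots> = a * b * ((cos (real k * pi * x) + cos (real n * pi * x + real m * pi * x)) / 2)"
        by (simp only: cos_times_cos \<open>cos (real n * pi * x - real m * pi * x) = cos (real k * pi * x)\<close>)
      also have "real n * pi * x + real m * pi * x = real (n + m) * pi * x"
        by (simp add: algebra_simps)
      finally show ?thesis by (simp add: algebra_simps)
    qed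
    then have "(\<lambda>x. a * cos (real n * pi * x) * (b * cos (real m * pi * x))) =
        (\<lambda>x. (a * b / 2) * cos (real k * pi * x) + (a * b / 2) * cos (real (n + m) * pi * x))" by auto
    then show ?case by (simp only: cosine_polynomials.intros)
  next
    case (add f g)
    then show ?case by (simp only: distrib_left cosine_polynomials.add)
  qed
next
  case (add f g)
  then show ?case by (simp only: distrib_right cosine_polynomials.add)
qed

text \<open>
  Points are separated by \<open>cos (\<pi> x)\<close>, which is injective on \<open>[0,1]\<close>.
\<close>

lemma cosine_polynomials_dense:
  assumes "continuous_on {0..1} f" and "0 < e"
  shows "\<exists>g\<in>cosine_polynomials. \<forall>x\<in>{0..1}. \<bar>f x - g x\<bar> < e"
proof -
  interpret function_ring_on cosine_polynomials "{0..1::real}"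
  proof
    show "(\<lambda>_. c) \<in> cosine_polynomials" for c using cosine_polynomials.cosine[of c 0] by simp
    show "\<exists>f\<in>cosine_polynomials. f x \<noteq> f y" if "x \<in> {0..1}" "y \<in> {0..1}" "x \<noteq> y" for x y :: real
    proof -
      have "cos (pi * x) \<noteq> cos (pi * y)"
      proof
        assume "cos (pi * x) = cos (pi * y)"
        then have "pi * x = pi * y"
          by (rule cos_inj_pi[rotated -1]) (use that in \<open>auto simp: mult_le_cancel_left1\<close>)
        then show False using that by simp
      qed
      then show ?thesis using cosine_polynomials.cosine[of 1 1] by (intro bexI) auto
    qed
  qed (auto simp: cosine_polynomials_continuous cosine_polynomials.add cosine_polynomials_mult)
  show ?thesis by (rule Stone_Weierstrass_basic[OF assms])
qed

lemma L2_approx_cosine_polynomial: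
  assumes "L2_01 f" and "0 < e"
  obtains g where "g \<in> cosine_polynomials" "sqnorm (\<lambda>x. f x - g x) < e"
proof -
  obtain h where h: "continuous_on UNIV h" "sqnorm (\<lambda>x. f x - h x) < e / 4"
    by (rule L2_approx_continuous[OF assms(1), of "e/4"]) (use assms in auto)
  have hc: "continuous_on {0..1} h" using h(1) continuous_on_subset by blast
  have "0 < sqrt (e / 8)" using assms by simp
  from cosine_polynomials_dense[OF hc this] obtain g where
    g: "g \<in> cosine_polynomials" "\<And>x. x \<in> {0..1} \<Longrightarrow> \<bar>h x - g x\<bar> < sqrt (e / 8)" by blast
  note gc = cosine_polynomials_continuous[OF g(1)]
  have "sqnorm (\<lambda>x. h x - g x) \<le> (sqrt (e / 8))\<^sup>2"
  proof (rule sqnorm_le_bound)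
    show "L2_01 (\<lambda>x. h x - g x)" by (intro L2_diff L2_continuous hc gc)
    show "\<bar>h x - g x\<bar> \<le> sqrt (e / 8)" if "x \<in> {0<..<1}" for x
      using g(2)[of x] that by auto
  qed
  then have "sqnorm (\<lambda>x. h x - g x) \<le> e / 8" using assms by simp
  moreover have "sqnorm (\<lambda>x. (f x - h x) + (h x - g x)) \<le> 2 * sqnorm (\<lambda>x. f x - h x) + 2 * sqnorm (\<lambda>x. h x - g x)"
    by (intro sqnorm_add_le L2_diff L2_continuous hc gc assms)
  ultimately have "sqnorm (\<lambda>x. f x - g x) < e" using h(2) assms(2) by simp
  with g(1) show ?thesis by (rule that)
qed

definition eigenvalue :: "nat \<Rightarrow> real" where
  "eigenvalue n = (real n * pi)\<^sup>2"

text \<open>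
  The squared \<open>L\<^sup>2\<close> norm of the \<open>n\<close>-th mode.
\<close>

definition cosine_weight :: "nat \<Rightarrow> real" where
  "cosine_weight n = (if n = 0 then 1 else 1 / 2)"

definition cosine_coefficient :: "(real \<Rightarrow> real) \<Rightarrow> nat \<Rightarrow> real" where
  "cosine_coefficient f n = (LINT x|unit_interval_measure. f x * cos (real n * pi * x)) / cosine_weight n"

text \<open>
  The solution at time \<open>t\<close> of the heat equation with homogeneous Neumann conditions and initial
  datum \<open>f\<close>. At \<open>t = 0\<close> the series need not converge.
\<close>

definition neumann_semigroup :: "(real \<Rightarrow> real) \<Rightarrow> real \<Rightarrow> real \<Rightarrow> real" where
  "neumann_semigroup f t x =
     (\<Sum>n. cosine_coefficient f n * exp (- eigenvalue n * t) * cos (real n * pi * x))"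

lemma integral_cos_int_pi:
  "((\<lambda>x. cos (of_int j * pi * x)) has_integral (if j = 0 then 1 else 0)) {0..1}"
proof (cases "j = 0")
  case True
  then show ?thesis using has_integral_const_real[of "1::real" 0 1] by simp
next
  case False
  have "((\<lambda>x. cos (of_int j * pi * x)) has_integral
      sin (of_int j * pi * 1) / (of_int j * pi) - sin (of_int j * pi * 0) / (of_int j * pi)) {0..1}"
    by (rule fundamental_theorem_of_calculus)
       (use False in \<open>auto intro!: derivative_eq_intros simp flip: has_real_derivative_iff_has_vector_derivative\<close>)
  moreover have "sin (of_int j * pi) = 0" by (simp add: sin_times_pi_eq_0)
  ultimately show ?thesis using False by simp
qed

lemma cosine_orthogonality:
  "(LINT x|unit_interval_measure. cos (real n * pi * x) * cos (real k * pi * x)) =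
     (if n = k then cosine_weight n else 0)"
proof -
  have hi: "((\<lambda>x. (cos (of_int (int n - int k) * pi * x) + cos (of_int (int n + int k) * pi * x)) / 2) has_integral
      ((if int n - int k = 0 then 1 else 0) + (if int n + int k = 0 then 1 else 0)) / 2) {0..1}"
    by (intro has_integral_divide has_integral_add integral_cos_int_pi)
  have eq: "cos (real n * pi * x) * cos (real k * pi * x) =
      (cos (of_int (int n - int k) * pi * x) + cos (of_int (int n + int k) * pi * x)) / 2" for x
    unfolding cos_times_cos by (simp add: algebra_simps)
  have "integral {0..1} (\<lambda>x. cos (real n * pi * x) * cos (real k * pi * x)) =
      ((if int n - int k = 0 then 1 else 0) + (if int n + int k = 0 then 1 else 0)) / 2"
    unfolding eq by (rule integral_unique[OF hi])
  also have "\<dots> = (if n = k then cosine_weight n else 0)"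
    by (auto simp: cosine_weight_def)
  finally show ?thesis
    by (subst integral_unit_eq) (auto intro!: continuous_intros)
qed

lemma L2_cos: "L2_01 (\<lambda>x. cos (real n * pi * x))"
  by (intro L2_continuous continuous_intros)

lemma cosine_weight_pos: "0 < cosine_weight n"
  by (simp add: cosine_weight_def)

lemma L2_sum:
  assumes "\<And>n. n \<in> A \<Longrightarrow> L2_01 (f n)"
  shows "L2_01 (\<lambda>x. \<Sum>n\<in>A. f n x)"
  using assms
proof (induction A rule: infinite_finite_induct)
  case (insert a A)
  then show ?case using L2_add[of "f a"] by simp
qed (auto intro: L2_continuous)

lemma L2_cosine_sum: "L2_01 (\<lambda>x. \<Sum>n\<in>A. a n * cos (real n * pi * x))"
  by (intro L2_sum L2_cmult L2_cos)

lemma sqnorm_cosine_sum: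
  "sqnorm (\<lambda>x. \<Sum>n<N. a n * cos (real n * pi * x)) = (\<Sum>n<N. (a n)\<^sup>2 * cosine_weight n)"
proof -
  have int: "integrable unit_interval_measure (\<lambda>x. a n * a k * (cos (real n * pi * x) * cos (real k * pi * x)))" for n k
    by (intro integrable_mult_right L2_mult_integrable L2_cos)
  have "sqnorm (\<lambda>x. \<Sum>n<N. a n * cos (real n * pi * x)) =
      (LINT x|unit_interval_measure. (\<Sum>n<N. \<Sum>k<N. a n * a k * (cos (real n * pi * x) * cos (real k * pi * x))))"
    unfolding sqnorm_def power2_eq_square sum_product by (simp add: mult_ac)
  also have "\<dots> = (\<Sum>n<N. \<Sum>k<N. LINT x|unit_interval_measure. a n * a k * (cos (real n * pi * x) * cos (real k * pi * x)))"
    by (simp only: Bochner_Integration.integral_sum Bochner_Integration.integrable_sum int)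
  also have "\<dots> = (\<Sum>n<N. \<Sum>k<N. if n = k then a n * a k * cosine_weight n else 0)"
    by (intro sum.cong refl) (simp add: cosine_orthogonality)
  also have "\<dots> = (\<Sum>n<N. (a n)\<^sup>2 * cosine_weight n)"
  proof (intro sum.cong refl)
    fix n assume "n \<in> {..<N}"
    then show "(\<Sum>k<N. if n = k then a n * a k * cosine_weight n else 0) = (a n)\<^sup>2 * cosine_weight n"
      using sum.delta'[of "{..<N}" n "\<lambda>k. a n * a k * cosine_weight n"]
      by (simp add: power2_eq_square)
  qed
  finally show ?thesis .
qed

text \<open>
  The squared distance from \<open>f\<close> to its \<open>N\<close>-th partial sum is the difference of the two sides.
\<close>

lemma bessel_inequality:
  assumes "L2_01 f"
  shows "(\<Sum>n<N. (cosine_coefficient f n)\<^sup>2 * cosine_weight n) \<le> sqnorm f"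
proof -
  define P where "P x = (\<Sum>n<N. cosine_coefficient f n * cos (real n * pi * x))" for x
  have P: "L2_01 P" unfolding P_def by (rule L2_cosine_sum)
  define B where "B = (\<Sum>n<N. (cosine_coefficient f n)\<^sup>2 * cosine_weight n)"
  have PP: "sqnorm P = B" unfolding P_def B_def by (rule sqnorm_cosine_sum)
  have "(LINT x|unit_interval_measure. f x * P x) =
      (LINT x|unit_interval_measure. (\<Sum>n<N. cosine_coefficient f n * (f x * cos (real n * pi * x))))"
    by (simp add: P_def sum_distrib_left mult_ac)
  also have "\<dots> = (\<Sum>n<N. LINT x|unit_interval_measure. cosine_coefficient f n * (f x * cos (real n * pi * x)))"
    by (intro Bochner_Integration.integral_sum integrable_mult_right L2_mult_integrable L2_cos assms)
  also have "\<dots> = B"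
    unfolding B_def using cosine_weight_pos
    by (intro sum.cong) (auto simp: cosine_coefficient_def power2_eq_square less_imp_neq[symmetric])
  finally have fP: "(LINT x|unit_interval_measure. f x * P x) = B" .
  have "0 \<le> sqnorm (\<lambda>x. f x - P x)" by (rule sqnorm_nonneg)
  also have "\<dots> = (LINT x|unit_interval_measure. ((f x)\<^sup>2 + (P x)\<^sup>2) - 2 * (f x * P x))"
    by (simp add: sqnorm_def power2_diff mult_ac)
  also have "\<dots> = sqnorm f + sqnorm P - 2 * (LINT x|unit_interval_measure. f x * P x)"
    using assms P L2_mult_integrable[OF assms P]
    by (simp add: sqnorm_def L2_integrable_power2)
  finally show ?thesis using PP fP by (simp add: B_def)
qed

lemma cosine_coefficient_bound:
  assumes "L2_01 f"
  obtains C where "\<And>n. \<bar>cosine_coefficient f n\<bar> \<le> C"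
proof
  fix n
  have "(cosine_coefficient f n)\<^sup>2 * cosine_weight n \<le>
      (\<Sum>k<Suc n. (cosine_coefficient f k)\<^sup>2 * cosine_weight k)"
    using cosine_weight_pos[THEN less_imp_le] by (intro member_le_sum) auto
  also have "\<dots> \<le> sqnorm f" by (rule bessel_inequality[OF assms])
  finally have "(cosine_coefficient f n)\<^sup>2 * cosine_weight n \<le> sqnorm f" .
  moreover have "(cosine_coefficient f n)\<^sup>2 * (1 / 2) \<le> (cosine_coefficient f n)\<^sup>2 * cosine_weight n"
    by (rule mult_left_mono) (auto simp: cosine_weight_def)
  ultimately have "(cosine_coefficient f n)\<^sup>2 \<le> 2 * sqnorm f" by simp
  then show "\<bar>cosine_coefficient f n\<bar> \<le> sqrt (2 * sqnorm f)" by (rule real_le_rsqrt[of "\<bar>_\<bar>", simplified])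
qed

lemma cosine_coefficient_add:
  assumes "L2_01 f" and "L2_01 g"
  shows "cosine_coefficient (\<lambda>x. f x + g x) n = cosine_coefficient f n + cosine_coefficient g n"
  using L2_mult_integrable[OF assms(1) L2_cos] L2_mult_integrable[OF assms(2) L2_cos]
  by (simp add: cosine_coefficient_def distrib_right add_divide_distrib)

lemma cosine_coefficient_cos:
  "cosine_coefficient (\<lambda>x. a * cos (real k * pi * x)) n = (if n = k then a else 0)"
proof -
  have "(LINT x|unit_interval_measure. a * cos (real k * pi * x) * cos (real n * pi * x)) =
      a * (if k = n then cosine_weight k else 0)"
    by (simp only: mult.assoc[of a] integral_mult_right_zero cosine_orthogonality)
  then show ?thesis using cosine_weight_pos[of k] by (auto simp: cosine_coefficient_def)
qed

lemma eigenvalue_nonneg: "0 \<le> eigenvalue n"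
  by (simp add: eigenvalue_def)

text \<open>
  As \<open>n\<^sup>2 \<ge> n\<close>, the terms are dominated by a geometric sequence.
\<close>

lemma summable_exp_eigenvalue:
  assumes "0 < t"
  shows "summable (\<lambda>n. exp (- eigenvalue n * t))"
proof (rule summable_comparison_test')
  show "summable (\<lambda>n. exp (- (pi\<^sup>2 * t)) ^ n)"
    by (rule summable_geometric) (use assms in simp)
  fix n
  have "real n \<le> (real n)\<^sup>2" by (cases n) (auto simp: power2_eq_square)
  then have "real n * (pi\<^sup>2 * t) \<le> (real n)\<^sup>2 * (pi\<^sup>2 * t)"
    using assms by (intro mult_right_mono) auto
  then show "norm (exp (- eigenvalue n * t)) \<le> exp (- (pi\<^sup>2 * t)) ^ n"
    by (simp add: eigenvalue_def power_mult_distrib mult_ac flip: exp_of_nat_mult)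
qed

lemma neumann_term_bound:
  assumes "0 < t" and "L2_01 f"
  obtains B where "summable B"
    "\<And>n x. \<bar>cosine_coefficient f n * exp (- eigenvalue n * t) * cos (real n * pi * x)\<bar> \<le> B n"
proof -
  obtain C where C: "\<And>n. \<bar>cosine_coefficient f n\<bar> \<le> C"
    by (rule cosine_coefficient_bound[OF assms(2)]) (rule that)
  have "\<bar>cosine_coefficient f n * exp (- eigenvalue n * t) * cos (real n * pi * x)\<bar> \<le> C * exp (- eigenvalue n * t)" for n x
  proof -
    have "\<bar>cosine_coefficient f n\<bar> * exp (- eigenvalue n * t) * \<bar>cos (real n * pi * x)\<bar> \<le> C * exp (- eigenvalue n * t) * 1"
      using C[of n] abs_ge_zero[of "cosine_coefficient f n"] by (intro mult_mono) (auto intro: order_trans)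
    then show ?thesis by (simp add: abs_mult)
  qed
  moreover have "summable (\<lambda>n. C * exp (- eigenvalue n * t))"
    by (intro summable_mult summable_exp_eigenvalue assms)
  ultimately show ?thesis by (intro that)
qed

lemma summable_neumann:
  assumes "0 < t" and "L2_01 f"
  shows "summable (\<lambda>n. cosine_coefficient f n * exp (- eigenvalue n * t) * cos (real n * pi * x))"
proof -
  obtain B where B: "summable B"
    "\<And>n x. \<bar>cosine_coefficient f n * exp (- eigenvalue n * t) * cos (real n * pi * x)\<bar> \<le> B n"
    by (rule neumann_term_bound[OF assms]) (rule that)
  show ?thesis by (rule summable_comparison_test'[OF B(1), of 0]) (use B(2) in simp)
qed

lemma neumann_uniform_limit:
  assumes "0 < t" and "L2_01 f"
  shows "uniform_limit UNIV (\<lambda>N x. \<Sum>n<N. cosine_coefficient f n * exp (- eigenvalue n * t) * cos (real n * pi * x))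
    (neumann_semigroup f t) sequentially"
proof -
  obtain B where B: "summable B"
    "\<And>n x. \<bar>cosine_coefficient f n * exp (- eigenvalue n * t) * cos (real n * pi * x)\<bar> \<le> B n"
    by (rule neumann_term_bound[OF assms]) (rule that)
  show ?thesis unfolding neumann_semigroup_def
    by (rule Weierstrass_m_test[OF _ B(1)]) (use B(2) in simp)
qed

lemma neumann_continuous:
  assumes "0 < t" and "L2_01 f"
  shows "continuous_on S (neumann_semigroup f t)"
proof -
  have "continuous_on UNIV (neumann_semigroup f t)"
    by (rule uniform_limit_theorem[OF _ neumann_uniform_limit[OF assms]])
       (auto intro!: always_eventually continuous_intros)
  then show ?thesis by (rule continuous_on_subset) simp
qed

text \<open>
  For partial sums this is Bessel's inequality, since the damping factors are at most 1; the partial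
  sums converge uniformly.
\<close>

lemma neumann_contraction:
  assumes "0 < t" and "L2_01 f"
  shows "sqnorm (neumann_semigroup f t) \<le> sqnorm f"
proof -
  define P where "P N x = (\<Sum>n<N. cosine_coefficient f n * exp (- eigenvalue n * t) * cos (real n * pi * x))" for N x
  obtain B where B: "summable B"
    "\<And>n x. \<bar>cosine_coefficient f n * exp (- eigenvalue n * t) * cos (real n * pi * x)\<bar> \<le> B n"
    by (rule neumann_term_bound[OF assms]) (rule that)
  have B0: "0 \<le> B n" for n using B(2)[of n 0] by linarith
  have Pb: "\<bar>P N x\<bar> \<le> suminf B" for N x
  proof -
    have "\<bar>P N x\<bar> \<le> (\<Sum>n<N. B n)"
      unfolding P_def by (rule order_trans[OF sum_abs sum_mono[OF B(2)]])
    also have "\<dots> \<le> suminf B" by (rule sum_le_suminf[OF B(1)]) (use B0 in auto)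
    finally show ?thesis .
  qed
  have L2P: "L2_01 (P N)" for N
    unfolding P_def by (rule L2_cosine_sum)
  have "(\<lambda>N. LINT x|unit_interval_measure. (P N x)\<^sup>2) \<longlonglongrightarrow>
      (LINT x|unit_interval_measure. (neumann_semigroup f t x)\<^sup>2)"
  proof (rule integral_dominated_convergence[where w="\<lambda>_. (suminf B)\<^sup>2"])
    show "(\<lambda>x. (neumann_semigroup f t x)\<^sup>2) \<in> borel_measurable unit_interval_measure"
      by (intro borel_measurable_power continuous_unit_measurable neumann_continuous assms)
    show "(\<lambda>x. (P N x)\<^sup>2) \<in> borel_measurable unit_interval_measure" for N
      by (intro borel_measurable_power L2_measurable L2P)
    show "integrable unit_interval_measure (\<lambda>_. (suminf B)\<^sup>2)"
      by (rule finite_measure.integrable_const[OF finite_unit_interval_measure])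
    show "AE x in unit_interval_measure. (\<lambda>N. (P N x)\<^sup>2) \<longlonglongrightarrow> (neumann_semigroup f t x)\<^sup>2"
      unfolding P_def
      by (intro AE_I2 tendsto_power tendsto_uniform_limitI[OF neumann_uniform_limit[OF assms]]) auto
    show "AE x in unit_interval_measure. norm ((P N x)\<^sup>2) \<le> (suminf B)\<^sup>2" for N
    proof (intro AE_I2)
      fix x
      have "\<bar>P N x\<bar> \<le> \<bar>suminf B\<bar>" using Pb[of N x] by linarith
      then show "norm ((P N x)\<^sup>2) \<le> (suminf B)\<^sup>2" by (simp add: abs_le_square_iff)
    qed
  qed
  then have "(\<lambda>N. sqnorm (P N)) \<longlonglongrightarrow> sqnorm (neumann_semigroup f t)" by (simp add: sqnorm_def)
  moreover have "sqnorm (P N) \<le> sqnorm f" for N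
  proof -
    have "sqnorm (P N) = (\<Sum>n<N. (cosine_coefficient f n * exp (- eigenvalue n * t))\<^sup>2 * cosine_weight n)"
      unfolding P_def by (rule sqnorm_cosine_sum)
    also have "\<dots> \<le> (\<Sum>n<N. (cosine_coefficient f n)\<^sup>2 * cosine_weight n)"
    proof (intro sum_mono mult_right_mono)
      fix n
      have "(exp (- eigenvalue n * t))\<^sup>2 \<le> 1"
        using eigenvalue_nonneg[of n] assms by (intro power_le_one) auto
      then have "(cosine_coefficient f n)\<^sup>2 * (exp (- eigenvalue n * t))\<^sup>2 \<le> (cosine_coefficient f n)\<^sup>2 * 1"
        by (intro mult_left_mono) auto
      then show "(cosine_coefficient f n * exp (- eigenvalue n * t))\<^sup>2 \<le> (cosine_coefficient f n)\<^sup>2"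
        by (simp add: power_mult_distrib)
    qed (use cosine_weight_pos in \<open>auto intro: less_imp_le\<close>)
    also have "\<dots> \<le> sqnorm f" by (rule bessel_inequality[OF assms(2)])
    finally show ?thesis .
  qed
  ultimately show ?thesis by (intro LIMSEQ_le_const2) auto
qed

lemma neumann_add:
  assumes "0 < t" and "L2_01 f" and "L2_01 g"
  shows "neumann_semigroup (\<lambda>x. f x + g x) t x = neumann_semigroup f t x + neumann_semigroup g t x"
  unfolding neumann_semigroup_def
  using suminf_add[OF summable_neumann[OF assms(1,2)] summable_neumann[OF assms(1,3)], of x x]
  by (simp add: cosine_coefficient_add[OF assms(2,3)] distrib_right)

lemma neumann_cos:
  "neumann_semigroup (\<lambda>x. a * cos (real k * pi * x)) t x = a * exp (- eigenvalue k * t) * cos (real k * pi * x)"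
proof -
  have "neumann_semigroup (\<lambda>x. a * cos (real k * pi * x)) t x =
     (\<Sum>n\<in>{k}. cosine_coefficient (\<lambda>x. a * cos (real k * pi * x)) n * exp (- eigenvalue n * t) * cos (real n * pi * x))"
    unfolding neumann_semigroup_def by (rule suminf_finite) (auto simp: cosine_coefficient_cos)
  then show ?thesis by (simp add: cosine_coefficient_cos)
qed

lemma sqnorm_neumann_add_diff:
  assumes "0 < t" and "L2_01 f" and "L2_01 g"
  shows "sqnorm (\<lambda>x. neumann_semigroup (\<lambda>x. f x + g x) t x - (f x + g x)) \<le>
    2 * sqnorm (\<lambda>x. neumann_semigroup f t x - f x) + 2 * sqnorm (\<lambda>x. neumann_semigroup g t x - g x)"
proof -
  have "sqnorm (\<lambda>x. (neumann_semigroup f t x - f x) + (neumann_semigroup g t x - g x)) \<le>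
    2 * sqnorm (\<lambda>x. neumann_semigroup f t x - f x) + 2 * sqnorm (\<lambda>x. neumann_semigroup g t x - g x)"
    by (intro sqnorm_add_le L2_diff L2_continuous neumann_continuous assms)
  then show ?thesis by (simp add: neumann_add[OF assms] algebra_simps)
qed

lemma neumann_initial_cosine_polynomial:
  assumes "f \<in> cosine_polynomials"
  shows "((\<lambda>t. sqnorm (\<lambda>x. neumann_semigroup f t x - f x)) \<longlongrightarrow> 0) (at_right 0)"
  using assms
proof (induction rule: cosine_polynomials.induct)
  case (cosine a n)
  have "\<forall>\<^sub>F t in at_right 0. norm (sqnorm (\<lambda>x. neumann_semigroup (\<lambda>x. a * cos (real n * pi * x)) t x - a * cos (real n * pi * x)))
      \<le> (\<bar>a\<bar> * \<bar>exp (- eigenvalue n * t) - 1\<bar>)\<^sup>2"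
  proof (intro always_eventually allI)
    fix t
    have "sqnorm (\<lambda>x. neumann_semigroup (\<lambda>x. a * cos (real n * pi * x)) t x - a * cos (real n * pi * x))
      \<le> (\<bar>a\<bar> * \<bar>exp (- eigenvalue n * t) - 1\<bar>)\<^sup>2"
      unfolding neumann_cos
    proof (rule sqnorm_le_bound)
      show "L2_01 (\<lambda>x. a * exp (- eigenvalue n * t) * cos (real n * pi * x) - a * cos (real n * pi * x))"
        by (intro L2_continuous continuous_intros)
      fix x
      have "a * exp (- eigenvalue n * t) * cos (real n * pi * x) - a * cos (real n * pi * x) =
          a * (exp (- eigenvalue n * t) - 1) * cos (real n * pi * x)" by (simp add: algebra_simps)
      then show "\<bar>a * exp (- eigenvalue n * t) * cos (real n * pi * x) - a * cos (real n * pi * x)\<bar>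
          \<le> \<bar>a\<bar> * \<bar>exp (- eigenvalue n * t) - 1\<bar>"
        by (simp only: abs_mult) (rule mult_left_le, auto)
    qed
    then show "norm (sqnorm (\<lambda>x. neumann_semigroup (\<lambda>x. a * cos (real n * pi * x)) t x - a * cos (real n * pi * x)))
      \<le> (\<bar>a\<bar> * \<bar>exp (- eigenvalue n * t) - 1\<bar>)\<^sup>2" by (simp add: sqnorm_nonneg)
  qed
  moreover have "((\<lambda>t. (\<bar>a\<bar> * \<bar>exp (- eigenvalue n * t) - 1\<bar>)\<^sup>2) \<longlongrightarrow> (\<bar>a\<bar> * \<bar>exp (- eigenvalue n * 0) - 1\<bar>)\<^sup>2) (at_right 0)"
    by (intro tendsto_intros)
  then have "((\<lambda>t. (\<bar>a\<bar> * \<bar>exp (- eigenvalue n * t) - 1\<bar>)\<^sup>2) \<longlongrightarrow> 0) (at_right 0)" by simp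
  ultimately show ?case by (rule Lim_null_comparison)
next
  case (add f g)
  have L: "L2_01 f" "L2_01 g"
    using add.hyps by (auto intro: L2_continuous cosine_polynomials_continuous)
  have "((\<lambda>t. 2 * sqnorm (\<lambda>x. neumann_semigroup f t x - f x) + 2 * sqnorm (\<lambda>x. neumann_semigroup g t x - g x))
     \<longlongrightarrow> 2 * 0 + 2 * 0) (at_right 0)"
    by (intro tendsto_intros add.IH)
  then have lim: "((\<lambda>t. 2 * sqnorm (\<lambda>x. neumann_semigroup f t x - f x) + 2 * sqnorm (\<lambda>x. neumann_semigroup g t x - g x))
     \<longlongrightarrow> 0) (at_right 0)" by simp
  show ?case
    by (rule Lim_null_comparison[OF _ lim])
       (use sqnorm_neumann_add_diff[OF _ L] in \<open>auto simp: eventually_at_right_field sqnorm_nonneg intro!: exI[of _ 1]\<close>)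
qed

text \<open>
  A family of contractions that converges strongly to the identity on a dense set does so
  everywhere.
\<close>

theorem neumann_initial:
  assumes "L2_01 f"
  shows "((\<lambda>t. sqnorm (\<lambda>x. neumann_semigroup f t x - f x)) \<longlongrightarrow> 0) (at_right 0)"
proof (rule tendstoI)
  fix e :: real assume e: "0 < e"
  \<comment> \<open>The error for \<open>f\<close> is at most \<open>2 (e/4) + 2 * 4 (e/16) = e\<close>: the first part comes from \<open>g\<close>, the
    second from \<open>f - g\<close>, which contributes itself and its evolution.\<close>
  obtain g where g: "g \<in> cosine_polynomials" "sqnorm (\<lambda>x. f x - g x) < e / 16"
    by (rule L2_approx_cosine_polynomial[OF assms, of "e/16"]) (use e in auto)
  have Lg: "L2_01 g" by (intro L2_continuous cosine_polynomials_continuous g)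
  have Ld: "L2_01 (\<lambda>x. f x - g x)" by (intro L2_diff assms Lg)
  have "\<forall>\<^sub>F t in at_right 0. sqnorm (\<lambda>x. neumann_semigroup g t x - g x) < e / 4"
    by (rule order_tendstoD(2)[OF neumann_initial_cosine_polynomial[OF g(1)]]) (use e in simp)
  moreover have "\<forall>\<^sub>F t in at_right (0::real). 0 < t" by (simp add: eventually_at_right_less)
  ultimately show "\<forall>\<^sub>F t in at_right 0. dist (sqnorm (\<lambda>x. neumann_semigroup f t x - f x)) 0 < e"
  proof eventually_elim
    case (elim t)
    have "sqnorm (\<lambda>x. neumann_semigroup (\<lambda>x. f x - g x) t x + (-1) * (f x - g x)) \<le>
        2 * sqnorm (neumann_semigroup (\<lambda>x. f x - g x) t) + 2 * sqnorm (\<lambda>x. (-1) * (f x - g x))"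
      by (intro sqnorm_add_le L2_continuous neumann_continuous elim Ld L2_cmult)
    also have "sqnorm (\<lambda>x. (-1) * (f x - g x)) = sqnorm (\<lambda>x. f x - g x)"
      by (simp add: sqnorm_def power2_commute)
    also have "sqnorm (neumann_semigroup (\<lambda>x. f x - g x) t) \<le> sqnorm (\<lambda>x. f x - g x)"
      by (rule neumann_contraction[OF elim(2) Ld])
    finally have "sqnorm (\<lambda>x. neumann_semigroup (\<lambda>x. f x - g x) t x - (f x - g x)) \<le> 4 * sqnorm (\<lambda>x. f x - g x)"
      by (simp add: algebra_simps)
    with sqnorm_neumann_add_diff[OF elim(2) Lg Ld] elim g(2)
    show ?case by (simp add: sqnorm_nonneg)
  qed
qed

section \<open>The boundary trace of the Neumann semigroup\<close>

text \<open>
  One half of the exponential pays for the power of the eigenvalue, at the price of \<open>p!\<close>; the other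
  half is kept to sum over \<open>n\<close>.
\<close>

lemma eigenvalue_power_exp_bound:
  assumes "0 < \<epsilon>" and "\<epsilon> \<le> t"
  shows "eigenvalue n ^ p * exp (- eigenvalue n * t) \<le> fact p * (2 / \<epsilon>) ^ p * exp (- eigenvalue n * (\<epsilon> / 2))"
proof -
  define \<mu> where "\<mu> = eigenvalue n"
  have \<mu>: "0 \<le> \<mu>" by (simp add: \<mu>_def eigenvalue_nonneg)
  have "(\<mu> * (\<epsilon> / 2)) ^ p \<le> fact p * exp (\<mu> * (\<epsilon> / 2))"
    by (rule power_le_fact_exp) (use \<mu> assms in simp)
  then have "\<mu> ^ p \<le> fact p * (2 / \<epsilon>) ^ p * exp (\<mu> * (\<epsilon> / 2))"
    using assms by (simp add: power_mult_distrib power_divide field_simps)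
  then have "\<mu> ^ p * exp (- \<mu> * t) \<le> fact p * (2 / \<epsilon>) ^ p * exp (\<mu> * (\<epsilon> / 2)) * exp (- \<mu> * t)"
    by (rule mult_right_mono) simp
  also have "\<dots> \<le> fact p * (2 / \<epsilon>) ^ p * exp (\<mu> * (\<epsilon> / 2)) * exp (- \<mu> * \<epsilon>)"
    using \<mu> assms by (intro mult_left_mono) (auto intro: mult_left_mono)
  also have "\<dots> = fact p * (2 / \<epsilon>) ^ p * exp (- \<mu> * (\<epsilon> / 2))"
    by (simp add: mult.assoc flip: exp_add)
  finally show ?thesis by (simp add: \<mu>_def)
qed

text \<open>
  The \<open>p\<close>-th time derivative of the free evolution at \<open>x = 0\<close>, term by term.
\<close>

definition neumann_trace :: "(real \<Rightarrow> real) \<Rightarrow> nat \<Rightarrow> real \<Rightarrow> real" where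
  "neumann_trace f p t = (\<Sum>n. cosine_coefficient f n * ((- eigenvalue n) ^ p * exp (- eigenvalue n * t)))"

lemma neumann_trace_term_bound:
  assumes "L2_01 f"
  obtains C where "0 \<le> C" "\<And>\<epsilon> t n p. 0 < \<epsilon> \<Longrightarrow> \<epsilon> \<le> t \<Longrightarrow>
     \<bar>cosine_coefficient f n * ((- eigenvalue n) ^ p * exp (- eigenvalue n * t))\<bar> \<le>
       C * (fact p * (2 / \<epsilon>) ^ p * exp (- eigenvalue n * (\<epsilon> / 2)))"
proof -
  obtain C where C: "\<And>n. \<bar>cosine_coefficient f n\<bar> \<le> C"
    by (rule cosine_coefficient_bound[OF assms]) (rule that)
  have C0: "0 \<le> C" using C[of 0] by linarith
  have "\<bar>cosine_coefficient f n * ((- eigenvalue n) ^ p * exp (- eigenvalue n * t))\<bar> \<le>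
       C * (fact p * (2 / \<epsilon>) ^ p * exp (- eigenvalue n * (\<epsilon> / 2)))" if "0 < \<epsilon>" "\<epsilon> \<le> t" for \<epsilon> t n p
  proof -
    have "\<bar>cosine_coefficient f n * ((- eigenvalue n) ^ p * exp (- eigenvalue n * t))\<bar> =
        \<bar>cosine_coefficient f n\<bar> * (eigenvalue n ^ p * exp (- eigenvalue n * t))"
      using eigenvalue_nonneg[of n] by (simp add: abs_mult power_abs)
    also have "\<dots> \<le> C * (fact p * (2 / \<epsilon>) ^ p * exp (- eigenvalue n * (\<epsilon> / 2)))"
      using C0 eigenvalue_nonneg[of n] by (intro mult_mono C eigenvalue_power_exp_bound that) auto
    finally show ?thesis .
  qed
  with C0 show ?thesis by (rule that)
qed

lemma summable_trace_majorant:
  "0 < \<epsilon> \<Longrightarrow> summable (\<lambda>n. C * (fact p * (2 / \<epsilon>) ^ p * exp (- eigenvalue n * (\<epsilon> / 2))))"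
  by (intro summable_mult summable_exp_eigenvalue) simp

lemma derivative_tower_neumann_trace:
  assumes "L2_01 f"
  shows "derivative_tower {0<..} (neumann_trace f)"
  unfolding derivative_tower_def
proof (intro allI ballI)
  fix p and t :: real assume t: "t \<in> {0<..}"
  obtain C where C: "0 \<le> C" "\<And>\<epsilon> t n p. 0 < \<epsilon> \<Longrightarrow> \<epsilon> \<le> t \<Longrightarrow>
     \<bar>cosine_coefficient f n * ((- eigenvalue n) ^ p * exp (- eigenvalue n * t))\<bar> \<le>
       C * (fact p * (2 / \<epsilon>) ^ p * exp (- eigenvalue n * (\<epsilon> / 2)))"
    by (rule neumann_trace_term_bound[OF assms]) (rule that)
  show "(neumann_trace f p has_real_derivative neumann_trace f (Suc p) t) (at t)"
    unfolding neumann_trace_def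
  proof (rule has_field_derivative_series'(2)[where S="{t / 2..}" and x0=t])
    show "((\<lambda>r. cosine_coefficient f n * ((- eigenvalue n) ^ p * exp (- eigenvalue n * r))) has_real_derivative
        cosine_coefficient f n * ((- eigenvalue n) ^ Suc p * exp (- eigenvalue n * r))) (at r within {t / 2..})" for n r
      by (auto intro!: derivative_eq_intros)
    show "uniformly_convergent_on {t / 2..} (\<lambda>N r. \<Sum>i<N. cosine_coefficient f i * ((- eigenvalue i) ^ Suc p * exp (- eigenvalue i * r)))"
    proof (rule Weierstrass_m_test'[OF _ summable_trace_majorant[of "t / 2" C "Suc p"]])
      fix n r assume "r \<in> {t / 2..}"
      then show "norm (cosine_coefficient f n * ((- eigenvalue n) ^ Suc p * exp (- eigenvalue n * r))) \<le>
          C * (fact (Suc p) * (2 / (t / 2)) ^ Suc p * exp (- eigenvalue n * (t / 2 / 2)))"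
        unfolding real_norm_def using t by (intro C(2)) auto
    qed (use t in simp)
    show "summable (\<lambda>n. cosine_coefficient f n * ((- eigenvalue n) ^ p * exp (- eigenvalue n * t)))"
      by (rule summable_comparison_test'[OF summable_trace_majorant[of t C p], of 0])
         (use t C(2)[of t t _ p] in auto)
  qed (use t in auto)
qed

lemma gevrey_bounded_neumann_trace:
  assumes "L2_01 f" and "0 < \<epsilon>"
  shows "gevrey_bounded 1 {\<epsilon>..} (neumann_trace f)"
proof -
  obtain C where C: "0 \<le> C" "\<And>\<epsilon> t n p. 0 < \<epsilon> \<Longrightarrow> \<epsilon> \<le> t \<Longrightarrow>
     \<bar>cosine_coefficient f n * ((- eigenvalue n) ^ p * exp (- eigenvalue n * t))\<bar> \<le>
       C * (fact p * (2 / \<epsilon>) ^ p * exp (- eigenvalue n * (\<epsilon> / 2)))"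
    by (rule neumann_trace_term_bound[OF assms(1)]) (rule that)
  define S where "S = (\<Sum>n. exp (- eigenvalue n * (\<epsilon> / 2)))"
  have sS: "summable (\<lambda>n. exp (- eigenvalue n * (\<epsilon> / 2)))"
    by (rule summable_exp_eigenvalue) (use assms in simp)
  have S: "0 \<le> S" unfolding S_def by (rule suminf_nonneg[OF sS]) simp
  have "\<bar>neumann_trace f p t\<bar> \<le> (C * S + 1) * (fact p powr 1 / (\<epsilon> / 2) ^ p)" if "\<epsilon> \<le> t" for t p
  proof -
    have "\<bar>neumann_trace f p t\<bar> \<le> (\<Sum>n. C * (fact p * (2 / \<epsilon>) ^ p * exp (- eigenvalue n * (\<epsilon> / 2))))"
      using norm_suminf_le[OF C(2)[OF assms(2) that, folded real_norm_def] summable_trace_majorant[OF assms(2)], of p]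
      by (simp add: neumann_trace_def)
    also have "\<dots> = C * (fact p * (2 / \<epsilon>) ^ p * S)"
      using suminf_mult[OF sS, of "C * (fact p * (2 / \<epsilon>) ^ p)"] by (simp add: S_def mult.assoc)
    also have "\<dots> = C * S * (fact p * (2 / \<epsilon>) ^ p)" by simp
    also have "\<dots> \<le> (C * S + 1) * (fact p * (2 / \<epsilon>) ^ p)"
      by (intro mult_right_mono) (use assms in auto)
    finally show ?thesis by (simp add: power_divide)
  qed
  moreover have "C * S + 1 > 0" using C(1) S by (simp add: add_nonneg_pos)
  moreover have "\<epsilon> / 2 > 0" using assms by simp
  ultimately show ?thesis unfolding gevrey_bounded_def by (metis atLeast_iff)
qed

lemma suminf_swap_abs:
  fixes f :: "nat \<Rightarrow> nat \<Rightarrow> real"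
  assumes "\<And>n. summable (\<lambda>j. \<bar>f n j\<bar>)" and "summable (\<lambda>n. \<Sum>j. \<bar>f n j\<bar>)"
  shows "(\<Sum>n. \<Sum>j. f n j) = (\<Sum>j. \<Sum>n. f n j)"
proof -
  have inf: "infsum h UNIV = suminf h" if "h summable_on UNIV" for h :: "nat \<Rightarrow> real"
    using has_sum_imp_sums[OF has_sum_infsum[OF that]] by (rule sums_unique)
  have abs_row: "(\<lambda>j. \<bar>f n j\<bar>) summable_on UNIV" for n
    using assms(1)[of n] by (simp add: summable_on_UNIV_nonneg_real_iff)
  have abs_rows: "(\<lambda>n. \<Sum>\<^sub>\<infinity>j. \<bar>f n j\<bar>) summable_on UNIV"
    using assms by (simp add: inf[OF abs_row] summable_on_UNIV_nonneg_real_iff suminf_nonneg)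
  have "(\<lambda>p. norm (case p of (n, j) \<Rightarrow> f n j)) summable_on (SIGMA n:UNIV. UNIV)"
    by (subst Infinite_Sum.abs_summable_on_Sigma_iff) (use abs_row abs_rows in \<open>simp add: infsum_nonneg\<close>)
  then have s: "(\<lambda>(n, j). f n j) summable_on UNIV \<times> UNIV"
    by (rule Infinite_Sum.abs_summable_summable)
  then have s': "(\<lambda>(j, n). f n j) summable_on UNIV \<times> UNIV"
    using summable_on_swap[THEN iffD1, OF s] by simp
  have rows: "(\<lambda>j. f n j) summable_on UNIV" for n
    using summable_on_Sigma_banach[OF s] summable_on_SigmaD1[OF s] by simp
  have cols: "(\<lambda>n. f n j) summable_on UNIV" for j
    using summable_on_SigmaD1[OF s'] by simp
  have "(\<Sum>\<^sub>\<infinity>n. \<Sum>\<^sub>\<infinity>j. f n j) = (\<Sum>\<^sub>\<infinity>j. \<Sum>\<^sub>\<infinity>n. f n j)"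
    by (rule infsum_swap_banach[OF s])
  moreover have "(\<Sum>\<^sub>\<infinity>n. \<Sum>\<^sub>\<infinity>j. f n j) = (\<Sum>n. \<Sum>j. f n j)"
    using inf[OF summable_on_Sigma_banach[OF s]] by (simp add: inf[OF rows])
  moreover have "(\<Sum>\<^sub>\<infinity>j. \<Sum>\<^sub>\<infinity>n. f n j) = (\<Sum>j. \<Sum>n. f n j)"
    using inf[OF summable_on_Sigma_banach[OF s']] by (simp add: inf[OF cols])
  ultimately show ?thesis by simp
qed

text \<open>
  Each cosine is expanded in powers of \<open>x\<close> and the two sums are exchanged. Absolute convergence of the
  double series holds because \<open>n \<pi> \<bar>x\<bar> \<le> x\<^sup>2 / (2 t) + n\<^sup>2 \<pi>\<^sup>2 t / 2\<close>, so that half of the damping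
  controls the factor \<open>exp (n \<pi> \<bar>x\<bar>)\<close> coming from the power series.
\<close>

lemma neumann_semigroup_power_series:
  assumes "L2_01 f" and "0 < t"
  shows "neumann_semigroup f t x =
     (\<Sum>j. (if even j then neumann_trace f (j div 2) t else 0) / fact j * x ^ j)"
proof -
  obtain C where C: "\<And>n. \<bar>cosine_coefficient f n\<bar> \<le> C"
    by (rule cosine_coefficient_bound[OF assms(1)]) (rule that)
  have C0: "0 \<le> C" using C[of 0] by linarith
  define c where "c n = cosine_coefficient f n * exp (- eigenvalue n * t)" for n
  define F where "F n j = c n * (cos_coeff j * (real n * pi * x) ^ j)" for n j
  have cos_sum: "(\<lambda>j. cos_coeff j * z ^ j) sums cos z" for z :: real
    using cos_converges[of z] by simp
  have abs_le: "\<bar>F n j\<bar> \<le> \<bar>c n\<bar> * (\<bar>real n * pi * x\<bar> ^ j /\<^sub>R fact j)" for n j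
    unfolding F_def abs_mult power_abs[symmetric]
    by (intro mult_left_mono) (auto simp: cos_coeff_def divide_inverse mult.commute abs_mult power_abs)
  have sm: "summable (\<lambda>j. \<bar>c n\<bar> * (\<bar>real n * pi * x\<bar> ^ j /\<^sub>R fact j))" for n
    by (intro summable_mult summable_exp_generic)
  have row: "summable (\<lambda>j. \<bar>F n j\<bar>)" for n
    by (rule summable_comparison_test'[OF sm[of n], of 0]) (use abs_le in simp)
  have row_sum: "(\<Sum>j. \<bar>F n j\<bar>) \<le> C * exp (x\<^sup>2 / (2 * t)) * exp (- eigenvalue n * (t / 2))" for n
  proof -
    have "(\<Sum>j. \<bar>F n j\<bar>) \<le> (\<Sum>j. \<bar>c n\<bar> * (\<bar>real n * pi * x\<bar> ^ j /\<^sub>R fact j))"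
      by (rule suminf_le[OF abs_le row sm])
    also have "\<dots> = \<bar>c n\<bar> * exp \<bar>real n * pi * x\<bar>"
      unfolding exp_def by (rule suminf_mult[OF summable_exp_generic])
    also have "\<dots> \<le> C * exp (- eigenvalue n * t) * exp \<bar>real n * pi * x\<bar>"
      unfolding c_def abs_mult by (intro mult_right_mono) (use C in auto)
    also have "\<dots> = C * exp (\<bar>real n * pi * x\<bar> - eigenvalue n * t)"
      by (simp add: mult.assoc flip: exp_add)
    also have "\<dots> \<le> C * exp (x\<^sup>2 / (2 * t) - eigenvalue n * (t / 2))"
    proof -
      have "0 \<le> (\<bar>x\<bar> - real n * pi * t)\<^sup>2 / (2 * t)" using assms by simp
      also have "\<dots> = x\<^sup>2 / (2 * t) - real n * pi * \<bar>x\<bar> + (real n * pi)\<^sup>2 * (t / 2)"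
        using assms by (simp add: power2_eq_square field_simps)
      finally show ?thesis
        using C0 by (intro mult_left_mono) (auto simp: eigenvalue_def abs_mult)
    qed
    also have "\<dots> = C * exp (x\<^sup>2 / (2 * t)) * exp (- eigenvalue n * (t / 2))"
      by (simp add: mult.assoc flip: exp_add)
    finally show ?thesis .
  qed
  have "summable (\<lambda>n. \<Sum>j. \<bar>F n j\<bar>)"
  proof (rule summable_comparison_test')
    show "summable (\<lambda>n. C * exp (x\<^sup>2 / (2 * t)) * exp (- eigenvalue n * (t / 2)))"
      by (intro summable_mult summable_exp_eigenvalue) (use assms in simp)
    show "norm (\<Sum>j. \<bar>F n j\<bar>) \<le> C * exp (x\<^sup>2 / (2 * t)) * exp (- eigenvalue n * (t / 2))" for n
      using row_sum[of n] suminf_nonneg[OF row[of n]] by simp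
  qed
  then have "(\<Sum>n. \<Sum>j. F n j) = (\<Sum>j. \<Sum>n. F n j)"
    by (rule suminf_swap_abs[OF row])
  moreover have "(\<Sum>j. F n j) = cosine_coefficient f n * exp (- eigenvalue n * t) * cos (real n * pi * x)" for n
    unfolding F_def c_def by (rule sums_unique[symmetric, OF sums_mult[OF cos_sum]])
  moreover have "(\<Sum>n. F n j) = (if even j then neumann_trace f (j div 2) t else 0) / fact j * x ^ j" for j
  proof (cases "even j")
    case True
    then obtain i where j: "j = 2 * i" by blast
    define K where "K = x ^ j / fact j"
    have F: "F n j = K * (cosine_coefficient f n * ((- eigenvalue n) ^ i * exp (- eigenvalue n * t)))" for n
    proof -
      have "(real n * pi * x) ^ j = eigenvalue n ^ i * x ^ j"
        unfolding j by (simp only: power_mult power_mult_distrib eigenvalue_def)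
      then show ?thesis
        by (simp add: F_def c_def K_def j cos_coeff_def power_minus[of "eigenvalue n"] field_simps)
    qed
    obtain B where B: "0 \<le> B" "\<And>\<epsilon> t n p. 0 < \<epsilon> \<Longrightarrow> \<epsilon> \<le> t \<Longrightarrow>
     \<bar>cosine_coefficient f n * ((- eigenvalue n) ^ p * exp (- eigenvalue n * t))\<bar> \<le>
       B * (fact p * (2 / \<epsilon>) ^ p * exp (- eigenvalue n * (\<epsilon> / 2)))"
      by (rule neumann_trace_term_bound[OF assms(1)]) (rule that)
    have "summable (\<lambda>n. cosine_coefficient f n * ((- eigenvalue n) ^ i * exp (- eigenvalue n * t)))"
      by (rule summable_comparison_test'[OF summable_trace_majorant[OF assms(2), of B i], of 0])
         (use B(2)[of t t _ i] assms in auto)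
    from suminf_mult[OF this, of K] have "(\<Sum>n. F n j) = K * neumann_trace f i t"
      by (simp add: F neumann_trace_def)
    then show ?thesis by (simp add: K_def j)
  qed (simp add: F_def cos_coeff_def)
  ultimately show ?thesis by (simp add: neumann_semigroup_def)
qed

lemma neumann_semigroup_reflect: "neumann_semigroup f t (2 - x) = neumann_semigroup f t x"
proof -
  have "cos (real n * pi * (2 - x)) = cos (real n * pi * x)" for n
  proof -
    have "cos (real n * pi * (2 - x)) = cos (2 * real n * pi - real n * pi * x)" by (simp add: algebra_simps)
    also have "\<dots> = cos (real n * pi * x)" by (simp only: cos_diff sin_2npi cos_2npi mult_1 mult_zero_left add_0_right)
    finally show ?thesis .
  qed
  then show ?thesis by (simp add: neumann_semigroup_def)
qed

section \<open>Uniqueness by the energy method\<close>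

lemma tendsto_integral_shrinking:
  fixes f :: "real \<Rightarrow> real"
  assumes "continuous_on {0..1} f"
  shows "((\<lambda>\<delta>. integral {\<delta>..1 - \<delta>} f) \<longlongrightarrow> integral {0..1} f) (at_right 0)"
proof -
  define I where "I x = integral {0..x} f" for x
  have int: "f integrable_on {a..b}" if "0 \<le> a" "b \<le> 1" for a b
    by (intro integrable_continuous_real continuous_on_subset[OF assms]) (use that in auto)
  have I: "continuous_on {0..1} I"
    unfolding I_def by (rule indefinite_integral_continuous_1) (rule int, auto)
  have fl: "filterlim (\<lambda>\<delta>::real. \<delta>) (at 0 within {0..1}) (at_right 0)"
    "filterlim (\<lambda>\<delta>::real. 1 - \<delta>) (at 1 within {0..1}) (at_right 0)"
    unfolding filterlim_at
    by (auto intro!: tendsto_eq_intros exI[of _ 1] simp: eventually_at_right_field)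
  have "((\<lambda>\<delta>. I (1 - \<delta>) - I \<delta>) \<longlongrightarrow> I 1 - I 0) (at_right 0)"
    using I by (intro tendsto_diff filterlim_compose[OF _ fl(1)] filterlim_compose[OF _ fl(2)])
      (auto simp: continuous_on_def)
  moreover have "I 1 - I 0 = integral {0..1} f" by (simp add: I_def)
  moreover have "\<forall>\<^sub>F \<delta> in at_right 0. I (1 - \<delta>) - I \<delta> = integral {\<delta>..1 - \<delta>} f"
  proof -
    have "I (1 - \<delta>) - I \<delta> = integral {\<delta>..1 - \<delta>} f" if "0 < \<delta>" "\<delta> < 1/2" for \<delta>
      using Henstock_Kurzweil_Integration.integral_combine[where a=0 and c=\<delta> and b="1 - \<delta>" and f=f] int[of 0 "1 - \<delta>"] that
      by (simp add: I_def)
    then show ?thesis unfolding eventually_at_right_field by (intro exI[of _ "1/2"]) auto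
  qed
  ultimately show ?thesis using Lim_transform_eventually by fastforce
qed

text \<open>
  Formally \<open>d/dt \<integral> w\<^sup>2 = 2 [w w\<^sub>x] - 2 \<integral> w\<^sub>x\<^sup>2\<close>, where the boundary term vanishes. As \<open>w\<^sub>t\<close> and
  \<open>w\<^sub>x\<^sub>x\<close> are not controlled up to the boundary, the identity is used on \<open>[\<delta>, 1 - \<delta>]\<close>. There the
  boundary term is small, uniformly in time, because \<open>w w\<^sub>x\<close> is continuous on a compact
  rectangle and zero on its lateral sides; finally \<open>\<delta> \<rightarrow> 0\<close>.
\<close>

lemma heat_energy_decreasing:
  fixes w wt wx wxx :: "real \<times> real \<Rightarrow> real"
  assumes ab: "a < b"
    and cw: "continuous_on ({a..b} \<times> {0..1}) w"
    and cwx: "continuous_on ({a..b} \<times> {0..1}) wx"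
    and cwt: "continuous_on ({a..b} \<times> {0<..<1}) wt"
    and cwxx: "continuous_on ({a..b} \<times> {0<..<1}) wxx"
    and dx: "\<And>t x. t \<in> {a..b} \<Longrightarrow> x \<in> {0..1} \<Longrightarrow>
        ((\<lambda>z. w (t, z)) has_real_derivative wx (t, x)) (at x within {0..1})"
    and dt: "\<And>t x. t \<in> {a..b} \<Longrightarrow> x \<in> {0<..<1} \<Longrightarrow> ((\<lambda>r. w (r, x)) has_real_derivative wt (t, x)) (at t)"
    and dxx: "\<And>t x. t \<in> {a..b} \<Longrightarrow> x \<in> {0<..<1} \<Longrightarrow> ((\<lambda>z. wx (t, z)) has_real_derivative wxx (t, x)) (at x)"
    and heat: "\<And>t x. t \<in> {a..b} \<Longrightarrow> x \<in> {0<..<1} \<Longrightarrow> wt (t, x) = wxx (t, x)"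
    and bc: "\<And>t. t \<in> {a..b} \<Longrightarrow> wx (t, 0) = 0" "\<And>t. t \<in> {a..b} \<Longrightarrow> wx (t, 1) = 0"
  shows "integral {0..1} (\<lambda>x. (w (b, x))\<^sup>2) \<le> integral {0..1} (\<lambda>x. (w (a, x))\<^sup>2)"
proof -
  define q where "q p = w p * wx p" for p
  have "continuous_on ({a..b} \<times> {0..1}) q"
    unfolding q_def by (intro continuous_intros cw cwx)
  then have uc: "uniformly_continuous_on ({a..b} \<times> {0..1}) q"
    by (intro compact_uniformly_continuous compact_Times compact_Icc)
  have small: "integral {\<delta>..1 - \<delta>} (\<lambda>x. (w (b, x))\<^sup>2) - integral {\<delta>..1 - \<delta>} (\<lambda>x. (w (a, x))\<^sup>2) \<le> 4 * e * (b - a)"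
    if d: "0 < \<delta>" "\<delta> < 1/2" and qe: "\<And>t. t \<in> {a..b} \<Longrightarrow> \<bar>q (t, \<delta>)\<bar> \<le> e" "\<And>t. t \<in> {a..b} \<Longrightarrow> \<bar>q (t, 1 - \<delta>)\<bar> \<le> e"
    for \<delta> e
  proof -
    define F where "F t = integral {\<delta>..1 - \<delta>} (\<lambda>x. (w (t, x))\<^sup>2)" for t
    have sub: "{\<delta>..1 - \<delta>} \<subseteq> {0<..<1}" "{\<delta>..1 - \<delta>} \<subseteq> {0..1}" using d by auto
    have slice: "continuous_on {\<delta>..1 - \<delta>} (\<lambda>x. w (t, x))" "continuous_on {\<delta>..1 - \<delta>} (\<lambda>x. wx (t, x))"
      "continuous_on {\<delta>..1 - \<delta>} (\<lambda>x. wt (t, x))" if "t \<in> {a..b}" for t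
      by (rule continuous_on_compose2[OF cw] continuous_on_compose2[OF cwx] continuous_on_compose2[OF cwt];
          use that sub in \<open>auto intro!: continuous_intros\<close>)+
    have dF: "(F has_real_derivative integral {\<delta>..1 - \<delta>} (\<lambda>x. 2 * w (t, x) * wt (t, x))) (at t within {a..b})"
      if t: "t \<in> {a..b}" for t
      unfolding F_def cbox_interval[of \<delta> "1 - \<delta>", symmetric]
    proof (rule leibniz_rule_field_derivative[OF _ _ _ t])
      show "((\<lambda>r. (w (r, x))\<^sup>2) has_real_derivative 2 * w (r, x) * wt (r, x)) (at r within {a..b})"
        if "r \<in> {a..b}" "x \<in> cbox \<delta> (1 - \<delta>)" for r x
      proof -
        have "((\<lambda>r. w (r, x)) has_real_derivative wt (r, x)) (at r within {a..b})"
          using dt[OF that(1), of x] that sub by (auto simp: has_field_derivative_at_within)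
        then show ?thesis by (auto intro!: derivative_eq_intros)
      qed
      show "(\<lambda>x. (w (r, x))\<^sup>2) integrable_on cbox \<delta> (1 - \<delta>)" if "r \<in> {a..b}" for r
        unfolding cbox_interval
        by (intro integrable_continuous_real continuous_on_power slice that)
      have "continuous_on ({a..b} \<times> {\<delta>..1 - \<delta>}) (\<lambda>p. 2 * w p * wt p)"
        by (intro continuous_intros continuous_on_subset[OF cw] continuous_on_subset[OF cwt]) (use sub in auto)
      then show "continuous_on ({a..b} \<times> cbox \<delta> (1 - \<delta>)) (\<lambda>(t, x). 2 * w (t, x) * wt (t, x))"
        by (simp add: case_prod_beta)
    qed auto
    have le: "integral {\<delta>..1 - \<delta>} (\<lambda>x. 2 * w (t, x) * wt (t, x)) \<le> 4 * e" if t: "t \<in> {a..b}" for t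
    proof -
      have "((\<lambda>x. 2 * (wx (t, x))\<^sup>2 + 2 * w (t, x) * wt (t, x)) has_integral (2 * q (t, 1 - \<delta>) - 2 * q (t, \<delta>))) {\<delta>..1 - \<delta>}"
      proof (rule fundamental_theorem_of_calculus)
        fix x assume x: "x \<in> {\<delta>..1 - \<delta>}"
        have wx': "((\<lambda>z. w (t, z)) has_real_derivative wx (t, x)) (at x within {\<delta>..1 - \<delta>})"
          by (rule DERIV_subset[OF dx[OF t] sub(2)]) (use x sub in auto)
        have "((\<lambda>z. wx (t, z)) has_real_derivative wt (t, x)) (at x within {\<delta>..1 - \<delta>})"
          using dxx[OF t, of x] heat[OF t, of x] x sub by (auto simp: has_field_derivative_at_within)
        with wx' have "((\<lambda>x. 2 * q (t, x)) has_real_derivative 2 * (wx (t, x))\<^sup>2 + 2 * w (t, x) * wt (t, x)) (at x within {\<delta>..1 - \<delta>})"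
          unfolding q_def by (auto intro!: derivative_eq_intros simp: power2_eq_square)
        then show "((\<lambda>x. 2 * q (t, x)) has_vector_derivative 2 * (wx (t, x))\<^sup>2 + 2 * w (t, x) * wt (t, x)) (at x within {\<delta>..1 - \<delta>})"
          by (simp add: has_real_derivative_iff_has_vector_derivative)
      qed (use d in simp)
      then have "integral {\<delta>..1 - \<delta>} (\<lambda>x. 2 * (wx (t, x))\<^sup>2 + 2 * w (t, x) * wt (t, x)) = 2 * q (t, 1 - \<delta>) - 2 * q (t, \<delta>)"
        by (rule integral_unique)
      moreover have "integral {\<delta>..1 - \<delta>} (\<lambda>x. 2 * w (t, x) * wt (t, x)) \<le>
          integral {\<delta>..1 - \<delta>} (\<lambda>x. 2 * (wx (t, x))\<^sup>2 + 2 * w (t, x) * wt (t, x))"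
        by (intro integral_le integrable_continuous_real continuous_intros slice t) auto
      ultimately show ?thesis using qe(1)[OF t] qe(2)[OF t] by linarith
    qed
    have "\<exists>z\<in>{a<..<b}. F b - F a = (b - a) * integral {\<delta>..1 - \<delta>} (\<lambda>x. 2 * w (z, x) * wt (z, x))"
    proof -
      have "\<exists>z\<in>{a<..<b}. F b - F a = (\<lambda>h. integral {\<delta>..1 - \<delta>} (\<lambda>x. 2 * w (z, x) * wt (z, x)) * h) (b - a)"
        using dF unfolding has_field_derivative_def by (intro mvt_simple[OF ab]) auto
      then show ?thesis by (simp add: mult.commute)
    qed
    then obtain z where "z \<in> {a<..<b}" and z: "F b - F a = (b - a) * integral {\<delta>..1 - \<delta>} (\<lambda>x. 2 * w (z, x) * wt (z, x))"
      by blast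
    then have "F b - F a \<le> (b - a) * (4 * e)"
      using le[of z] ab by (simp add: mult_left_mono)
    then show ?thesis by (simp add: F_def mult.commute)
  qed
  have lim: "((\<lambda>\<delta>. integral {\<delta>..1 - \<delta>} (\<lambda>x. (w (t, x))\<^sup>2)) \<longlongrightarrow> integral {0..1} (\<lambda>x. (w (t, x))\<^sup>2)) (at_right 0)"
    if "t \<in> {a..b}" for t
    by (intro tendsto_integral_shrinking continuous_on_power continuous_on_compose2[OF cw])
       (use that in \<open>auto intro!: continuous_intros\<close>)
  have key: "integral {0..1} (\<lambda>x. (w (b, x))\<^sup>2) - integral {0..1} (\<lambda>x. (w (a, x))\<^sup>2) \<le> 4 * e * (b - a)" if e: "0 < e" for e
  proof (rule tendsto_upperbound[OF tendsto_diff[OF lim lim]])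
    obtain d where d: "d > 0" "\<And>p p'. p \<in> {a..b} \<times> {0..1} \<Longrightarrow> p' \<in> {a..b} \<times> {0..1} \<Longrightarrow> dist p' p < d \<Longrightarrow> dist (q p') (q p) < e"
      using uc e unfolding uniformly_continuous_on_def by metis
    \<comment> \<open>By the boundary conditions, uniform continuity makes \<open>q\<close> small near both sides.\<close>
    have q0: "q (t, 0) = 0" "q (t, 1) = 0" if "t \<in> {a..b}" for t using bc that by (auto simp: q_def)
    have near: "\<bar>q (t, \<delta>)\<bar> \<le> e" "\<bar>q (t, 1 - \<delta>)\<bar> \<le> e" if "0 < \<delta>" "\<delta> < min d (1/2)" "t \<in> {a..b}" for t \<delta>
      using d(2)[of "(t, 0)" "(t, \<delta>)"] d(2)[of "(t, 1)" "(t, 1 - \<delta>)"] q0[OF that(3)] that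
      by (auto simp: dist_Pair_Pair dist_real_def)
    show "\<forall>\<^sub>F \<delta> in at_right 0. integral {\<delta>..1 - \<delta>} (\<lambda>x. (w (b, x))\<^sup>2) - integral {\<delta>..1 - \<delta>} (\<lambda>x. (w (a, x))\<^sup>2) \<le> 4 * e * (b - a)"
      unfolding eventually_at_right_field
      by (rule exI[of _ "min d (1/2)"]) (use d(1) near small in auto)
  qed (use ab in auto)
  have "integral {0..1} (\<lambda>x. (w (b, x))\<^sup>2) - integral {0..1} (\<lambda>x. (w (a, x))\<^sup>2) \<le> 0"
  proof (rule field_le_epsilon)
    fix e :: real assume "0 < e"
    moreover have "4 * (e / (4 * (b - a))) * (b - a) = e" using ab by (simp add: field_simps)
    ultimately show "integral {0..1} (\<lambda>x. (w (b, x))\<^sup>2) - integral {0..1} (\<lambda>x. (w (a, x))\<^sup>2) \<le> 0 + e"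
      using key[of "e / (4 * (b - a))"] ab by (simp del: times_divide_eq_right)
  qed
  then show ?thesis by simp
qed

lemma L2_norm_eq: "L2_norm_01 f = sqrt (sqnorm f)"
  by (simp add: L2_norm_01_def sqnorm_def)

lemma L2_continuous_at_sqnorm:
  assumes "L2_continuous_at I \<theta> t"
  shows "((\<lambda>r. sqnorm (\<lambda>x. \<theta> (r, x) - \<theta> (t, x))) \<longlongrightarrow> 0) (at t within I)"
proof -
  have "((\<lambda>r. (L2_norm_01 (\<lambda>x. \<theta> (r, x) - \<theta> (t, x)))\<^sup>2) \<longlongrightarrow> 0\<^sup>2) (at t within I)"
    using assms unfolding L2_continuous_at_def by (intro tendsto_power) auto
  then show ?thesis by (simp add: L2_norm_eq sqnorm_nonneg)
qed

lemma L2_continuous_atI: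
  assumes "\<And>r. r \<in> I \<Longrightarrow> L2_01 (\<lambda>x. \<theta> (r, x))" and "t \<in> I"
    and "((\<lambda>r. sqnorm (\<lambda>x. \<theta> (r, x) - \<theta> (t, x))) \<longlongrightarrow> 0) (at t within I)"
  shows "L2_continuous_at I \<theta> t"
proof -
  have "((\<lambda>r. L2_norm_01 (\<lambda>x. \<theta> (r, x) - \<theta> (t, x))) \<longlongrightarrow> sqrt 0) (at t within I)"
    unfolding L2_norm_eq by (intro tendsto_real_sqrt assms)
  then show ?thesis using assms by (auto simp: L2_continuous_at_def eventually_at_filter)
qed

lemma sqnorm_cong_AE:
  assumes "L2_01 f" and "L2_01 g" and "AE x in unit_interval_measure. f x = g x"
  shows "sqnorm f = sqnorm g"
  unfolding sqnorm_def
  by (rule integral_cong_AE) (use assms L2_measurable in auto)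

lemma sqnorm_zero_AE:
  assumes "L2_01 f" and "sqnorm f = 0"
  shows "AE x in unit_interval_measure. f x = 0"
  using integral_nonneg_eq_0_iff_AE[OF L2_integrable_power2[OF assms(1)]] assms(2)
  by (simp add: sqnorm_def)

text \<open>
  The classical part of the definition, with its quantifiers turned into rules.
\<close>

lemma heat_solution_classical:
  assumes "heat_solution T u \<theta>0 \<theta>"
  obtains \<theta>t \<theta>x \<theta>xx where
        "continuous_on ({0<..<T} \<times> {0..1}) \<theta>"
        "continuous_on ({0<..<T} \<times> {0..1}) \<theta>x"
        "continuous_on ({0<..<T} \<times> {0<..<1}) \<theta>t"
        "continuous_on ({0<..<T} \<times> {0<..<1}) \<theta>xx"
        "\<And>t x. t \<in> {0<..<T} \<Longrightarrow> x \<in> {0..1} \<Longrightarrow> ((\<lambda>z. \<theta> (t, z)) has_real_derivative \<theta>x (t, x)) (at x within {0..1})"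
        "\<And>t x. t \<in> {0<..<T} \<Longrightarrow> x \<in> {0<..<1} \<Longrightarrow> ((\<lambda>r. \<theta> (r, x)) has_real_derivative \<theta>t (t, x)) (at t)"
        "\<And>t x. t \<in> {0<..<T} \<Longrightarrow> x \<in> {0<..<1} \<Longrightarrow> ((\<lambda>z. \<theta>x (t, z)) has_real_derivative \<theta>xx (t, x)) (at x)"
        "\<And>t x. t \<in> {0<..<T} \<Longrightarrow> x \<in> {0<..<1} \<Longrightarrow> \<theta>t (t, x) = \<theta>xx (t, x)"
        "\<And>t. t \<in> {0<..<T} \<Longrightarrow> \<theta>x (t, 0) = 0"
        "\<And>t. t \<in> {0<..<T} \<Longrightarrow> \<theta>x (t, 1) = u t"
proof -
  from assms obtain \<theta>t \<theta>x \<theta>xx where h: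
        "continuous_on ({0<..<T} \<times> {0..1}) \<theta>"
        "continuous_on ({0<..<T} \<times> {0..1}) \<theta>x"
        "continuous_on ({0<..<T} \<times> {0<..<1}) \<theta>t"
        "continuous_on ({0<..<T} \<times> {0<..<1}) \<theta>xx"
        "\<forall>t\<in>{0<..<T}.
           (\<forall>x\<in>{0..1}. ((\<lambda>z. \<theta> (t, z)) has_real_derivative \<theta>x (t, x)) (at x within {0..1})) \<and>
           (\<forall>x\<in>{0<..<1}.
              ((\<lambda>r. \<theta> (r, x)) has_real_derivative \<theta>t (t, x)) (at t) \<and>
              ((\<lambda>z. \<theta>x (t, z)) has_real_derivative \<theta>xx (t, x)) (at x) \<and>
              \<theta>t (t, x) - \<theta>xx (t, x) = 0) \<and>
           \<theta>x (t, 0) = 0 \<and> \<theta>x (t, 1) = u t"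
    unfolding heat_solution_def by (elim conjE exE)
  show ?thesis
  proof (rule that[OF h(1-4)])
    show "\<theta>t (t, x) = \<theta>xx (t, x)" if "t \<in> {0<..<T}" "x \<in> {0<..<1}" for t x
      using h(5) that by (metis eq_iff_diff_eq_0)
  qed (use h(5) in metis)+
qed

lemma heat_solution_slice:
  assumes "heat_solution T u \<theta>0 \<theta>" and "t \<in> {0<..<T}"
  shows "continuous_on {0..1} (\<lambda>x. \<theta> (t, x))"
proof -
  have "continuous_on ({0<..<T} \<times> {0..1}) \<theta>" using assms(1) unfolding heat_solution_def by blast
  then show ?thesis
    by (rule continuous_on_compose2) (use assms(2) in \<open>auto intro!: continuous_intros\<close>)
qed

lemma heat_difference_sqnorm_decreasing:
  assumes A: "heat_solution T u \<theta>0 \<theta>" and B: "heat_solution T u \<theta>0 \<theta>'"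
    and "0 < a" "a < b" "b < T"
  shows "sqnorm (\<lambda>x. \<theta>' (b, x) - \<theta> (b, x)) \<le> sqnorm (\<lambda>x. \<theta>' (a, x) - \<theta> (a, x))"
proof -
  obtain \<theta>t \<theta>x \<theta>xx where h:
        "continuous_on ({0<..<T} \<times> {0..1}) \<theta>"
        "continuous_on ({0<..<T} \<times> {0..1}) \<theta>x"
        "continuous_on ({0<..<T} \<times> {0<..<1}) \<theta>t"
        "continuous_on ({0<..<T} \<times> {0<..<1}) \<theta>xx"
        "\<And>t x. t \<in> {0<..<T} \<Longrightarrow> x \<in> {0..1} \<Longrightarrow> ((\<lambda>z. \<theta> (t, z)) has_real_derivative \<theta>x (t, x)) (at x within {0..1})"
        "\<And>t x. t \<in> {0<..<T} \<Longrightarrow> x \<in> {0<..<1} \<Longrightarrow> ((\<lambda>r. \<theta> (r, x)) has_real_derivative \<theta>t (t, x)) (at t)"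
        "\<And>t x. t \<in> {0<..<T} \<Longrightarrow> x \<in> {0<..<1} \<Longrightarrow> ((\<lambda>z. \<theta>x (t, z)) has_real_derivative \<theta>xx (t, x)) (at x)"
        "\<And>t x. t \<in> {0<..<T} \<Longrightarrow> x \<in> {0<..<1} \<Longrightarrow> \<theta>t (t, x) = \<theta>xx (t, x)"
        "\<And>t. t \<in> {0<..<T} \<Longrightarrow> \<theta>x (t, 0) = 0"
        "\<And>t. t \<in> {0<..<T} \<Longrightarrow> \<theta>x (t, 1) = u t"
    by (rule heat_solution_classical[OF A]) (rule that)
  obtain \<theta>t' \<theta>x' \<theta>xx' where h':
        "continuous_on ({0<..<T} \<times> {0..1}) \<theta>'"
        "continuous_on ({0<..<T} \<times> {0..1}) \<theta>x'"
        "continuous_on ({0<..<T} \<times> {0<..<1}) \<theta>t'"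
        "continuous_on ({0<..<T} \<times> {0<..<1}) \<theta>xx'"
        "\<And>t x. t \<in> {0<..<T} \<Longrightarrow> x \<in> {0..1} \<Longrightarrow> ((\<lambda>z. \<theta>' (t, z)) has_real_derivative \<theta>x' (t, x)) (at x within {0..1})"
        "\<And>t x. t \<in> {0<..<T} \<Longrightarrow> x \<in> {0<..<1} \<Longrightarrow> ((\<lambda>r. \<theta>' (r, x)) has_real_derivative \<theta>t' (t, x)) (at t)"
        "\<And>t x. t \<in> {0<..<T} \<Longrightarrow> x \<in> {0<..<1} \<Longrightarrow> ((\<lambda>z. \<theta>x' (t, z)) has_real_derivative \<theta>xx' (t, x)) (at x)"
        "\<And>t x. t \<in> {0<..<T} \<Longrightarrow> x \<in> {0<..<1} \<Longrightarrow> \<theta>t' (t, x) = \<theta>xx' (t, x)"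
        "\<And>t. t \<in> {0<..<T} \<Longrightarrow> \<theta>x' (t, 0) = 0"
        "\<And>t. t \<in> {0<..<T} \<Longrightarrow> \<theta>x' (t, 1) = u t"
    by (rule heat_solution_classical[OF B]) (rule that)
  have sub: "{a..b} \<times> S \<subseteq> {0<..<T} \<times> S" for S :: "real set" using assms by auto
  have ab: "t \<in> {0<..<T}" if "t \<in> {a..b}" for t using that assms by auto
  have "integral {0..1} (\<lambda>x. (\<theta>' (b, x) - \<theta> (b, x))\<^sup>2) \<le> integral {0..1} (\<lambda>x. (\<theta>' (a, x) - \<theta> (a, x))\<^sup>2)"
  proof (rule heat_energy_decreasing[where w="\<lambda>p. \<theta>' p - \<theta> p" and wx="\<lambda>p. \<theta>x' p - \<theta>x p"
        and wt="\<lambda>p. \<theta>t' p - \<theta>t p" and wxx="\<lambda>p. \<theta>xx' p - \<theta>xx p"])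
    show "continuous_on ({a..b} \<times> {0..1}) (\<lambda>p. \<theta>' p - \<theta> p)"
      "continuous_on ({a..b} \<times> {0..1}) (\<lambda>p. \<theta>x' p - \<theta>x p)"
      "continuous_on ({a..b} \<times> {0<..<1}) (\<lambda>p. \<theta>t' p - \<theta>t p)"
      "continuous_on ({a..b} \<times> {0<..<1}) (\<lambda>p. \<theta>xx' p - \<theta>xx p)"
      by (intro continuous_on_diff continuous_on_subset[OF h(1) sub] continuous_on_subset[OF h(2) sub]
        continuous_on_subset[OF h(3) sub] continuous_on_subset[OF h(4) sub]
        continuous_on_subset[OF h'(1) sub] continuous_on_subset[OF h'(2) sub]
        continuous_on_subset[OF h'(3) sub] continuous_on_subset[OF h'(4) sub])+
  qed (use assms ab h h' in \<open>auto intro!: DERIV_diff\<close>)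
  moreover have "sqnorm (\<lambda>x. \<theta>' (t, x) - \<theta> (t, x)) = integral {0..1} (\<lambda>x. (\<theta>' (t, x) - \<theta> (t, x))\<^sup>2)"
    if "t \<in> {a..b}" for t
    unfolding sqnorm_def
    by (intro integral_unit_eq continuous_intros heat_solution_slice[OF A ab[OF that]] heat_solution_slice[OF B ab[OF that]])
  ultimately show ?thesis using assms by simp
qed

text \<open>
  The energy of the difference is nonincreasing on \<open>(0,T)\<close> and tends to 0 as \<open>t \<rightarrow> 0\<close>, because both
  solutions attain the same datum in \<open>L\<^sup>2\<close>. The state at \<open>T\<close> is the limit of earlier states.
\<close>

theorem heat_solution_unique:
  assumes T: "0 < T" and A: "heat_solution T u \<theta>0 \<theta>" and B: "heat_solution T u \<theta>0 \<theta>'"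
    and t: "t \<in> {0..T}"
  shows "AE x in unit_interval_measure. \<theta>' (t, x) = \<theta> (t, x)"
proof -
  have c: "L2_continuous_at {0..T} \<theta> 0" "L2_continuous_at {0..T} \<theta> T"
     "L2_continuous_at {0..T} \<theta>' 0" "L2_continuous_at {0..T} \<theta>' T"
    and i: "AE x in unit_interval_measure. \<theta> (0, x) = \<theta>0 x" "AE x in unit_interval_measure. \<theta>' (0, x) = \<theta>0 x"
    using A B unfolding heat_solution_def by auto
  have L: "L2_01 (\<lambda>x. \<theta> (r, x))" "L2_01 (\<lambda>x. \<theta>' (r, x))" if "r \<in> {0..T}" for r
  proof -
    have "r = 0 \<or> r = T \<or> r \<in> {0<..<T}" using that by auto
    then show "L2_01 (\<lambda>x. \<theta> (r, x))" "L2_01 (\<lambda>x. \<theta>' (r, x))"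
      using c L2_continuous[OF heat_solution_slice[OF A]] L2_continuous[OF heat_solution_slice[OF B]]
      by (auto simp: L2_continuous_at_def)
  qed
  note lim = c[THEN L2_continuous_at_sqnorm]
  note right = at_within_Icc_at_right[OF T] and left = at_within_Icc_at_left[OF T]
  have zero: "AE x in unit_interval_measure. \<theta>' (0, x) = \<theta> (0, x)"
    using i by eventually_elim simp
  have split: "sqnorm (\<lambda>x. \<theta>' (r, x) - \<theta> (r, x)) \<le>
      2 * sqnorm (\<lambda>x. \<theta>' (r, x) - \<theta>' (q, x)) + 2 * sqnorm (\<lambda>x. \<theta> (r, x) - \<theta> (q, x))"
    if rq: "r \<in> {0..T}" "q \<in> {0..T}" and ae: "AE x in unit_interval_measure. \<theta>' (q, x) = \<theta> (q, x)" for r q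
  proof -
    have "sqnorm (\<lambda>x. \<theta>' (r, x) - \<theta> (r, x)) =
        sqnorm (\<lambda>x. (\<theta>' (r, x) - \<theta>' (q, x)) + (-1) * (\<theta> (r, x) - \<theta> (q, x)))"
      by (intro sqnorm_cong_AE L2_add L2_cmult L2_diff L rq) (use ae in eventually_elim, simp)
    also have "\<dots> \<le> 2 * sqnorm (\<lambda>x. \<theta>' (r, x) - \<theta>' (q, x)) + 2 * sqnorm (\<lambda>x. (-1) * (\<theta> (r, x) - \<theta> (q, x)))"
      by (intro sqnorm_add_le L2_cmult L2_diff L rq)
    also have "sqnorm (\<lambda>x. (-1) * (\<theta> (r, x) - \<theta> (q, x))) = sqnorm (\<lambda>x. \<theta> (r, x) - \<theta> (q, x))"
      by (simp add: sqnorm_def power2_commute)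
    finally show ?thesis .
  qed
  have mid: "AE x in unit_interval_measure. \<theta>' (t, x) = \<theta> (t, x)" if t: "t \<in> {0<..<T}" for t
  proof -
    have "((\<lambda>r. 2 * sqnorm (\<lambda>x. \<theta>' (r, x) - \<theta>' (0, x)) + 2 * sqnorm (\<lambda>x. \<theta> (r, x) - \<theta> (0, x))) \<longlongrightarrow> 2 * 0 + 2 * 0) (at_right 0)"
      using lim(1) lim(3) unfolding right by (intro tendsto_intros)
    moreover have "\<forall>\<^sub>F r in at_right 0. sqnorm (\<lambda>x. \<theta>' (t, x) - \<theta> (t, x)) \<le>
        2 * sqnorm (\<lambda>x. \<theta>' (r, x) - \<theta>' (0, x)) + 2 * sqnorm (\<lambda>x. \<theta> (r, x) - \<theta> (0, x))"
      unfolding eventually_at_right_field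
    proof (intro exI[of _ t] conjI allI impI)
      fix r assume "0 < r" "r < t"
      then show "sqnorm (\<lambda>x. \<theta>' (t, x) - \<theta> (t, x)) \<le>
        2 * sqnorm (\<lambda>x. \<theta>' (r, x) - \<theta>' (0, x)) + 2 * sqnorm (\<lambda>x. \<theta> (r, x) - \<theta> (0, x))"
        using heat_difference_sqnorm_decreasing[OF A B, of r t] split[OF _ _ zero, of r] t
        by (auto intro: order_trans)
    qed (use t in simp)
    ultimately have "sqnorm (\<lambda>x. \<theta>' (t, x) - \<theta> (t, x)) \<le> 0"
      using tendsto_lowerbound trivial_limit_at_right_real by fastforce
    then have "sqnorm (\<lambda>x. \<theta>' (t, x) - \<theta> (t, x)) = 0" using sqnorm_nonneg by (rule antisym)
    with sqnorm_zero_AE[OF L2_diff[OF L(2) L(1)], of t] t show ?thesis by auto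
  qed
  have final: "AE x in unit_interval_measure. \<theta>' (T, x) = \<theta> (T, x)"
  proof -
    have "((\<lambda>r. 2 * sqnorm (\<lambda>x. \<theta>' (r, x) - \<theta>' (T, x)) + 2 * sqnorm (\<lambda>x. \<theta> (r, x) - \<theta> (T, x))) \<longlongrightarrow> 2 * 0 + 2 * 0) (at_left T)"
      using lim(2) lim(4) unfolding left by (intro tendsto_intros)
    moreover have "\<forall>\<^sub>F r in at_left T. sqnorm (\<lambda>x. \<theta>' (T, x) - \<theta> (T, x)) \<le>
        2 * sqnorm (\<lambda>x. \<theta>' (r, x) - \<theta>' (T, x)) + 2 * sqnorm (\<lambda>x. \<theta> (r, x) - \<theta> (T, x))"
      unfolding eventually_at_left_field
    proof (intro exI[of _ 0] conjI allI impI)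
      fix r assume r: "0 < r" "r < T"
      have sym: "sqnorm (\<lambda>x. f (T, x) - f (r, x)) = sqnorm (\<lambda>x. f (r, x) - f (T, x))" for f :: "real \<times> real \<Rightarrow> real"
        by (simp add: sqnorm_def power2_commute)
      from split[of T r] mid[of r] r T show "sqnorm (\<lambda>x. \<theta>' (T, x) - \<theta> (T, x)) \<le>
        2 * sqnorm (\<lambda>x. \<theta>' (r, x) - \<theta>' (T, x)) + 2 * sqnorm (\<lambda>x. \<theta> (r, x) - \<theta> (T, x))"
        by (simp add: sym)
    qed (use T in simp)
    ultimately have "sqnorm (\<lambda>x. \<theta>' (T, x) - \<theta> (T, x)) \<le> 0"
      using tendsto_lowerbound trivial_limit_at_left_real by fastforce
    then have "sqnorm (\<lambda>x. \<theta>' (T, x) - \<theta> (T, x)) = 0" using sqnorm_nonneg by (rule antisym)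
    with sqnorm_zero_AE[OF L2_diff[OF L(2) L(1)], of T] T show ?thesis by auto
  qed
  have "t = 0 \<or> t = T \<or> t \<in> {0<..<T}" using t by auto
  with zero mid final show ?thesis by blast
qed

section \<open>Steering to zero\<close>

context flat_output
begin

text \<open>
  Only the odd powers survive in the derivative of an even power series, and this reindexing turns
  the flux at \<open>x = 1\<close> into the series that defines the control.
\<close>

lemma flat_sums:
  assumes "0 < t"
  shows "(\<lambda>i. D (Suc i) t / fact (2 * i + 1)) sums heat_series 1 (t, 1)"
proof -
  have "(\<lambda>j. coefficient (j + 1) t / fact j * 1 ^ j) sums heat_series 1 (t, 1)"
    using summable_sums[OF summable_heat_series[OF assms, of 1 1]] by (simp add: heat_series_def)
  then have *: "(\<lambda>j. coefficient (j + 1) t / fact j) sums heat_series 1 (t, 1)" by simp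
  have "(\<lambda>i. coefficient ((2 * i + 1) + 1) t / fact (2 * i + 1)) sums heat_series 1 (t, 1)"
  proof (subst sums_mono_reindex[of "\<lambda>i. 2 * i + 1" "\<lambda>j. coefficient (j + 1) t / fact j"])
    show "strict_mono (\<lambda>i::nat. 2 * i + 1)" by (simp add: strict_mono_def)
    show "coefficient (j + 1) t / fact j = 0" if "j \<notin> range (\<lambda>i. 2 * i + 1)" for j
    proof -
      have "even j" using that by (metis oddE rangeI)
      then show ?thesis by (simp add: coefficient_def)
    qed
  qed (rule *)
  then show ?thesis by (simp add: coefficient_def)
qed

lemma heat_series_left_boundary: "heat_series 1 (t, 0) = 0"
proof -
  have "heat_series 1 (t, 0) = (\<Sum>j\<in>{0}. coefficient (j + 1) t / fact j * 0 ^ j)"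
    unfolding heat_series_def prod.case by (rule suminf_finite) auto
  then show ?thesis by (simp add: coefficient_def)
qed

lemma derivative_tower_control: "derivative_tower {0<..} (\<lambda>p t. heat_series (1 + 2 * p) (t, 1))"
  unfolding derivative_tower_def
proof (intro allI ballI)
  fix p and t :: real assume "t \<in> {0<..}"
  then show "((\<lambda>t. heat_series (1 + 2 * p) (t, 1)) has_real_derivative heat_series (1 + 2 * Suc p) (t, 1)) (at t)"
    using DERIV_heat_series_t[of t "1 + 2 * p" 1] by simp
qed

text \<open>
  The heat series for the flux vanishes on \<open>(0,b)\<close> with \<open>b > \<tau>\<close>, so it agrees with the control on both
  sides of \<open>\<tau>\<close>; all its time derivatives vanish there as well. This also removes the singularity at
  \<open>t = 0\<close>.
\<close>

lemma gevrey_control: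
  assumes \<tau>: "0 < \<tau>" "\<tau> < b" "\<tau> < T"
    and vanish: "\<And>t. t \<in> {0<..<b} \<Longrightarrow> heat_series 1 (t, 1) = 0"
    and u: "\<And>t. t \<in> {0..T} \<Longrightarrow> u t = (if t \<le> \<tau> then 0 else heat_series 1 (t, 1))"
  shows "gevrey s 0 T u"
proof -
  define U where "U p t = (if t \<le> \<tau> then 0 else heat_series (1 + 2 * p) (t, 1))" for p t
  have z: "heat_series (1 + 2 * p) (t, 1) = 0" if "t \<in> {0<..<b}" for p t
  proof (cases p)
    case 0
    then show ?thesis using vanish[OF that] by simp
  next
    case (Suc q)
    show ?thesis unfolding Suc
      by (rule derivative_tower_const_on_open[OF derivative_tower_control, of "{0<..<b}" 0])
         (use vanish that in auto)
  qed
  have Upos: "U p t = heat_series (1 + 2 * p) (t, 1)" if "0 < t" for p t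
    using z[of t p] that \<tau> by (auto simp: U_def)
  have "derivative_tower UNIV U"
    unfolding derivative_tower_def
  proof (intro allI ballI)
    fix p and t :: real
    show "(U p has_real_derivative U (Suc p) t) (at t)"
    proof (cases "0 < t")
      case True
      then have "((\<lambda>t. heat_series (1 + 2 * p) (t, 1)) has_real_derivative U (Suc p) t) (at t)"
        using derivative_tower_control unfolding derivative_tower_def by (simp add: Upos)
      then show ?thesis
        by (rule has_field_derivative_transform_within_open[where S="{0<..}"]) (use True Upos in auto)
    next
      case False
      have "((\<lambda>_. 0) has_real_derivative 0) (at t)" by simp
      then have "(U p has_real_derivative 0) (at t)"
        by (rule has_field_derivative_transform_within_open[where S="{..<\<tau>}"])
           (use False \<tau> in \<open>auto simp: U_def\<close>)
      then show ?thesis using False \<tau> by (simp add: U_def)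
    qed
  qed
  moreover have "gevrey_bounded s {0..T} U"
  proof -
    obtain M R1 R2 where M: "M > 0" "R1 > 0" "R2 > 0" and
      b: "\<And>t x m n. \<tau> \<le> t \<Longrightarrow> \<bar>x\<bar> \<le> 1 \<Longrightarrow> \<bar>heat_series (n + 2 * m) (t, x)\<bar> \<le>
        M * (fact m powr s * fact n powr (s / 2) / (R1 ^ m * R2 ^ n))"
      by (rule heat_series_bound[OF \<tau>(1), of 1]) (simp, rule that)
    have "\<bar>U p t\<bar> \<le> M / R2 * (fact p powr s / R1 ^ p)" for p t
      using b[of t 1 1 p] M by (auto simp: U_def mult_ac)
    moreover have "M / R2 > 0" using M by simp
    ultimately show ?thesis unfolding gevrey_bounded_def using M(2) by blast
  qed
  ultimately show ?thesis
    by (intro gevrey_of_tower[of 0 T UNIV U]) (use \<tau> u in \<open>auto simp: U_def\<close>)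
qed

lemma heat_series_slice: "0 < t \<Longrightarrow> continuous_on S (\<lambda>x. heat_series q (t, x))"
  by (rule continuous_on_compose2[OF continuous_on_heat_series]) (auto intro!: continuous_intros)

text \<open>
  On a compact rectangle the series is uniformly continuous, and a uniform bound on \<open>(0,1)\<close> is an
  \<open>L\<^sup>2\<close> bound.
\<close>

lemma heat_series_L2_continuous:
  assumes "0 < t"
  shows "((\<lambda>r. sqnorm (\<lambda>x. heat_series 0 (r, x) - heat_series 0 (t, x))) \<longlongrightarrow> 0) (at t within S)"
proof (rule tendstoI)
  fix e :: real assume e: "0 < e"
  let ?K = "{t / 2..t + 1} \<times> {0..1::real}"
  have "uniformly_continuous_on ?K (heat_series 0)"
    by (intro compact_uniformly_continuous compact_Times compact_Icc
        continuous_on_subset[OF continuous_on_heat_series]) (use assms in auto)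
  moreover have "0 < sqrt (e / 2)" using e by simp
  ultimately obtain d where d: "d > 0"
    "\<And>p p'. p \<in> ?K \<Longrightarrow> p' \<in> ?K \<Longrightarrow> dist p' p < d \<Longrightarrow> dist (heat_series 0 p') (heat_series 0 p) < sqrt (e / 2)"
    unfolding uniformly_continuous_on_def by metis
  have "sqnorm (\<lambda>x. heat_series 0 (r, x) - heat_series 0 (t, x)) < e" if r: "dist r t < min d (min (t / 2) 1)" for r
  proof -
    have rt: "r \<in> {t / 2..t + 1}" "t \<in> {t / 2..t + 1}" "0 < r"
      using r assms by (auto simp: dist_real_def abs_if split: if_splits)
    have "sqnorm (\<lambda>x. heat_series 0 (r, x) - heat_series 0 (t, x)) \<le> (sqrt (e / 2))\<^sup>2"
    proof (rule sqnorm_le_bound)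
      show "L2_01 (\<lambda>x. heat_series 0 (r, x) - heat_series 0 (t, x))"
        by (intro L2_diff L2_continuous heat_series_slice rt assms)
      show "\<bar>heat_series 0 (r, x) - heat_series 0 (t, x)\<bar> \<le> sqrt (e / 2)" if "x \<in> {0<..<1}" for x
        using d(2)[of "(t, x)" "(r, x)"] rt r that by (auto simp: dist_Pair_Pair dist_real_def)
    qed
    then show ?thesis using e by simp
  qed
  then show "\<forall>\<^sub>F r in at t within S. dist (sqnorm (\<lambda>x. heat_series 0 (r, x) - heat_series 0 (t, x))) 0 < e"
    unfolding eventually_at using d(1) assms
    by (intro exI[of _ "min d (min (t / 2) 1)"]) (auto simp: sqnorm_nonneg)
qed

end

theorem theorem4:
  fixes \<theta>0 :: "real \<Rightarrow> real" and T \<tau> s :: real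
  assumes "L2_01 \<theta>0" and "0 < T" and "\<tau> \<in> {0<..<T}" and "s \<in> {1<..<2}"
  shows "\<exists>y :: real \<Rightarrow> real.
    gevrey s \<tau> T y \<and>
    (\<forall>t\<in>{\<tau><..T}. summable (flat_term \<tau> T y t)) \<and>
    gevrey s 0 T (flat_control \<tau> T y) \<and>
    (\<exists>\<theta> :: real \<times> real \<Rightarrow> real.
       unique_heat_solution T (flat_control \<tau> T y) \<theta>0 \<theta> \<and>
       (\<forall>x\<in>{0<..<1}. \<theta> (T, x) = 0) \<and>
       (\<forall>t\<in>{0..T}. L2_continuous_at {0..T} \<theta> t) \<and>
       (\<forall>\<epsilon>\<in>{0<..<T}. gevrey2 s (s / 2) ({\<epsilon>..T} \<times> {0..1}) \<theta>))"
proof -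
  note L2 = assms(1) and T = assms(2) and \<tau> = assms(3) and s = assms(4)
  \<comment> \<open>The step function falls from 1 to 0 between two times strictly inside \<open>(\<tau>,T)\<close>, so that \<open>y\<close> is the
    free trace in a neighbourhood of \<open>\<tau>\<close> and zero in a neighbourhood of \<open>T\<close>.\<close>
  define a where "a = (2 * \<tau> + T) / 3"
  define b where "b = (\<tau> + 2 * T) / 3"
  have ab: "0 < \<tau>" "\<tau> < a" "a < b" "b < T" using \<tau> by (auto simp: a_def b_def)
  obtain \<Phi> where \<Phi>: "derivative_tower UNIV \<Phi>" "gevrey_bounded s UNIV \<Phi>"
    "\<And>t. t \<le> a \<Longrightarrow> \<Phi> 0 t = 1" "\<And>t. b \<le> t \<Longrightarrow> \<Phi> 0 t = 0"
    by (rule gevrey_step[of s a b]) (use s ab in auto)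
  define D where "D = leibniz_product \<Phi> (neumann_trace \<theta>0)"
  interpret flat_output D s
  proof
    have "derivative_tower {0<..} \<Phi>" using \<Phi>(1) by (simp add: derivative_tower_def)
    then show "derivative_tower {0<..} D"
      unfolding D_def by (intro derivative_tower_product derivative_tower_neumann_trace L2)
    show "gevrey_bounded s {\<epsilon>..} D" if "0 < \<epsilon>" for \<epsilon>
      unfolding D_def
      by (intro gevrey_bounded_product gevrey_bounded_subset[OF \<Phi>(2)]
          gevrey_bounded_mono_order[OF gevrey_bounded_neumann_trace[OF L2 that]]) (use s in auto)
  qed (use s in auto)
  \<comment> \<open>Before \<open>a\<close> only the undifferentiated \<open>\<Phi> = 1\<close> contributes to Leibniz' formula.\<close>
  have D_early: "D p t = neumann_trace \<theta>0 p t" if "t \<in> {0<..<a}" for p t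
  proof -
    have "\<Phi> i t = 0" if "i \<noteq> 0" for i
      using derivative_tower_const_on_open[OF \<Phi>(1), of "{..<a}" 1 t "i - 1"] \<Phi>(3) \<open>t \<in> {0<..<a}\<close> that by simp
    then have "D p t = (\<Sum>i\<le>p. if i = 0 then neumann_trace \<theta>0 p t else 0)"
      unfolding D_def leibniz_product_def using \<Phi>(3)[of t] that by (intro sum.cong) auto
    then show ?thesis by simp
  qed
  have D_late: "D p t = 0" if "b < t" for p t
  proof -
    have "\<Phi> i t = 0" for i
      using derivative_tower_const_on_open[OF \<Phi>(1), of "{b<..}" 0 t "i - 1"] \<Phi>(4) that by (cases i) auto
    then show ?thesis by (simp add: D_def leibniz_product_def)
  qed
  have series_early: "heat_series 0 (t, x) = neumann_semigroup \<theta>0 t x" if "t \<in> {0<..<a}" for t x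
    unfolding heat_series_def coefficient_def
    using neumann_semigroup_power_series[OF L2, of t x] that by (simp add: D_early[OF that] cong: if_cong)
  \<comment> \<open>The free evolution is even about \<open>x = 1\<close>, so its derivative there is its own negative.\<close>
  have vanish: "heat_series 1 (t, 1) = 0" if t: "t \<in> {0<..<a}" for t
  proof -
    have d: "((\<lambda>x. heat_series 0 (t, x)) has_real_derivative heat_series 1 (t, 1)) (at 1)"
      using DERIV_heat_series_x[of t 0 1] t by simp
    have "((\<lambda>x. heat_series 0 (t, x)) has_real_derivative heat_series 1 (t, 1)) (at (2 - 1))"
      using d by simp
    then have "((\<lambda>x. heat_series 0 (t, 2 - x)) has_real_derivative heat_series 1 (t, 1) * (- 1)) (at 1)"
      by (rule DERIV_chain2) (auto intro!: derivative_eq_intros)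
    moreover have "(\<lambda>x. heat_series 0 (t, 2 - x)) = (\<lambda>x. heat_series 0 (t, x))"
      by (simp add: series_early[OF t] neumann_semigroup_reflect)
    ultimately have "heat_series 1 (t, 1) * (- 1) = heat_series 1 (t, 1)"
      using DERIV_unique d by metis
    then show ?thesis by simp
  qed
  define y where "y = D 0"
  have y_derivs: "derivs_within {\<tau>..T} p y t = D p t" if "t \<in> {\<tau>..T}" for p t
    by (rule derivs_within_eq_tower[OF _ tower]) (use that \<tau> in \<open>auto simp: y_def\<close>)
  have flat: "flat_term \<tau> T y t = (\<lambda>i. D (Suc i) t / fact (2 * i + 1))" if "t \<in> {\<tau><..T}" for t
    using that y_derivs[of t] by (simp add: flat_term_def fun_eq_iff)
  have control: "flat_control \<tau> T y t = (if t \<le> \<tau> then 0 else heat_series 1 (t, 1))" if "t \<in> {0..T}" for t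
    using that flat[of t] sums_unique[OF flat_sums[of t]] \<tau> by (simp add: flat_control_def)
  have control': "flat_control \<tau> T y t = heat_series 1 (t, 1)" if "t \<in> {0<..T}" for t
    using control[of t] vanish[of t] that ab by auto
  \<comment> \<open>The series makes sense only for positive times; at time 0 the datum itself is taken.\<close>
  define \<theta> where "\<theta> p = (if fst p \<le> 0 then \<theta>0 (snd p) else heat_series 0 p)" for p :: "real \<times> real"
  have \<theta>_pos: "\<theta> (t, x) = heat_series 0 (t, x)" if "0 < t" for t x using that by (simp add: \<theta>_def)
  have \<theta>_L2: "L2_01 (\<lambda>x. \<theta> (t, x))" for t
    by (cases "0 < t") (auto simp: \<theta>_def L2 intro: L2_continuous heat_series_slice)
  have \<theta>_cont: "L2_continuous_at {0..T} \<theta> t" if t: "t \<in> {0..T}" for t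
  proof (rule L2_continuous_atI[OF \<theta>_L2 t])
    show "((\<lambda>r. sqnorm (\<lambda>x. \<theta> (r, x) - \<theta> (t, x))) \<longlongrightarrow> 0) (at t within {0..T})"
    proof (cases "t = 0")
      case True
      have "\<forall>\<^sub>F r in at_right 0. sqnorm (\<lambda>x. neumann_semigroup \<theta>0 r x - \<theta>0 x) = sqnorm (\<lambda>x. \<theta> (r, x) - \<theta> (t, x))"
        unfolding eventually_at_right_field
        by (rule exI[of _ a]) (use ab True in \<open>auto simp: \<theta>_def series_early\<close>)
      with neumann_initial[OF L2] show ?thesis
        unfolding True at_within_Icc_at_right[OF T] by (rule Lim_transform_eventually)
    next
      case False
      with t have "0 < t" by simp
      have "\<forall>\<^sub>F r in at t within {0..T}. 0 < r"
        using eventually_at_in_open'[of "{0<..}" t] \<open>0 < t\<close>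
        by (metis (mono_tags) at_le eventually_mono filter_leD greaterThan_iff open_greaterThan subset_UNIV)
      then have "\<forall>\<^sub>F r in at t within {0..T}. sqnorm (\<lambda>x. heat_series 0 (r, x) - heat_series 0 (t, x)) = sqnorm (\<lambda>x. \<theta> (r, x) - \<theta> (t, x))"
        by eventually_elim (use \<open>0 < t\<close> in \<open>simp add: \<theta>_pos\<close>)
      with heat_series_L2_continuous[OF \<open>0 < t\<close>] show ?thesis by (rule Lim_transform_eventually)
    qed
  qed
  have sol: "heat_solution T (flat_control \<tau> T y) \<theta>0 \<theta>"
    unfolding heat_solution_def
  proof (intro conjI exI ballI)
    have c: "continuous_on ({0<..<T} \<times> S) (heat_series q)" for q S
      by (rule continuous_on_subset[OF continuous_on_heat_series]) auto
    show "continuous_on ({0<..<T} \<times> {0..1}) (heat_series 1)" "continuous_on ({0<..<T} \<times> {0<..<1}) (heat_series 2)"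
      "continuous_on ({0<..<T} \<times> {0<..<1}) (heat_series 2)" by (rule c)+
    show "continuous_on ({0<..<T} \<times> {0..1}) \<theta>"
      by (subst continuous_on_cong[OF refl, of _ _ "heat_series 0"]) (auto simp: \<theta>_pos c)
    show "L2_continuous_at {0..T} \<theta> 0" "L2_continuous_at {0..T} \<theta> T" using \<theta>_cont T by auto
    show "AE x in lebesgue_on {0<..<1}. \<theta> (0, x) = \<theta>0 x" by (simp add: \<theta>_def)
    fix t assume t: "t \<in> {0<..<T}"
    then have t0: "0 < t" by simp
    show "heat_series 1 (t, 0) = 0" by (rule heat_series_left_boundary)
    show "heat_series 1 (t, 1) = flat_control \<tau> T y t" using control'[of t] t by simp
    show "((\<lambda>z. \<theta> (t, z)) has_real_derivative heat_series 1 (t, x)) (at x within {0..1})" for x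
      unfolding \<theta>_pos[OF t0] using DERIV_heat_series_x[OF t0, of 0 x] by (simp add: has_field_derivative_at_within)
    show "heat_series 2 (t, x) - heat_series 2 (t, x) = 0" for x by simp
    show "((\<lambda>z. heat_series 1 (t, z)) has_real_derivative heat_series 2 (t, x)) (at x)" for x
      using DERIV_heat_series_x[OF t0, of 1 x] by (simp add: numeral_2_eq_2)
    show "((\<lambda>r. \<theta> (r, x)) has_real_derivative heat_series 2 (t, x)) (at t)" for x
    proof -
      have "((\<lambda>r. heat_series 0 (r, x)) has_real_derivative heat_series 2 (t, x)) (at t)"
        using DERIV_heat_series_t[OF t0, of 0 x] by (simp add: numeral_2_eq_2)
      then show ?thesis
        by (rule has_field_derivative_transform_within_open[where S="{0<..}"]) (use t0 \<theta>_pos in auto)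
    qed
  qed
  show ?thesis
  proof (intro exI conjI ballI)
    show "gevrey s \<tau> T y"
      by (rule gevrey_of_tower[OF _ tower]) (use \<tau> bounded[of \<tau>] in \<open>auto simp: y_def elim: gevrey_bounded_subset\<close>)
    show "summable (flat_term \<tau> T y t)" if "t \<in> {\<tau><..T}" for t
      unfolding flat[OF that] using flat_sums[of t] that \<tau> by (simp add: sums_iff)
    show "gevrey s 0 T (flat_control \<tau> T y)"
      by (rule gevrey_control[of \<tau> a]) (use ab vanish control in auto)
    show "unique_heat_solution T (flat_control \<tau> T y) \<theta>0 \<theta>"
      unfolding unique_heat_solution_def using sol heat_solution_unique[OF T sol] by blast
    show "\<theta> (T, x) = 0" for x
      using T by (simp add: \<theta>_pos heat_series_def coefficient_def D_late[OF ab(4)] cong: if_cong)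
    show "L2_continuous_at {0..T} \<theta> t" if "t \<in> {0..T}" for t using \<theta>_cont[OF that] .
    show "gevrey2 s (s / 2) ({\<epsilon>..T} \<times> {0..1}) \<theta>" if "\<epsilon> \<in> {0<..<T}" for \<epsilon>
      by (rule gevrey2_heat_series) (use that \<theta>_pos in auto)
  qed
qed

end
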